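(* Let $-\infty<a<b<\infty$ and $k>0$. For $m\in\mathbb{N}$ put $$\lambda_m=\left(\frac{(2m-1)\pi}{b-a}\right)^2+k,\quad z_{m,1}(x)=\sqrt{\tfrac{2}{b-a}}\cos\left(\tfrac{(2m-1)\pi}{b-a}x\right),\quad z_{m,2}(x)=\sqrt{\tfrac{2}{b-a}}\sin\left(\tfrac{(2m-1)\pi}{b-a}x\right).$$ For each $n\in\mathbb{N}$, let $Z_{m,n,j}=\lambda_m^{-n/2}z_{m,j}$ $(m\in\mathbb{N};\ j=1,2)$ and $E_n=\{Z_{m,n,1}\}_{m\in\mathbb{N}}\cup\{Z_{m,n,2}\}_{m\in\mathbb{N}}$. Let $H_n=(V_n,(\cdot,\cdot)_n)$ be the Hilbert space, with norm $\|f\|_n=(f,f)_n^{1/2}$, defined by $$V_n=\{f:[a,b]\to\mathbb{C}\mid f^{(j)}\in AC[a,b],\ f^{(j)}(a)=-f^{(j)}(b)\ (j=0,1,\ldots,n-1);\ f^{(n)}\in L^2[a,b]\},$$ $$(f,g)_n=\sum_{j=0}^{n}\binom{n}{j}k^{n-j}\int_a^b f^{(j)}(x)\,\overline{g}^{(j)}(x)\,dx\quad(f,g\in V_n).$$ Then $E_n$ is a complete orthonormal set in $H_n$. Furthermore, for $f\in H_n\subset L^2[a,b]$ and $N\in\mathbb{N}$, define the partial sums $$S_{N,n}(f)(x)=\sum_{m=1}^{N}A_{m,n}(f)\cos\left(\frac{(2m-1)\pi}{b-a}x\right)+\sum_{m=1}^{N}B_{m,n}(f)\sin\left(\frac{(2m-1)\pi}{b-a}x\right)\quad(x\in[a,b]),$$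 where $\{A_{m,n}(f)\}_{m\in\mathbb{N}}$ and $\{B_{m,n}(f)\}_{m\in\mathbb{N}}$ are the Fourier coefficients of $f$ relative to $E_n$ defined by $$A_{m,n}(f):=(f,Z_{m,n,1})_n,\qquad B_{m,n}(f):=(f,Z_{m,n,2})_n\quad(m\in\mathbb{N}).$$ Then: (a) $\|f-S_{N,n}(f)\|_n\to0$ as $N\to\infty$; (b) $\|f\|_n^2=\sum_{m=1}^{\infty}|A_{m,n}(f)|^2+\sum_{m=1}^{\infty}|B_{m,n}(f)|^2$; (c) $A_{m,n}(f)=\lambda_m^{n/2}a_m(f)$ and $B_{m,n}(f)=\lambda_m^{n/2}b_m(f)$ for all $m\in\mathbb{N}$, where $a_m(f)=(f,z_{m,1})_{L^2[a,b]}$ and $b_m(f)=(f,z_{m,2})_{L^2[a,b]}$ are the Fourier coefficients of $f$ relative to the orthonormal basis $\{z_{m,1}\}_{m\in\mathbb{N}}\cup\{z_{m,2}\}_{m\in\mathbb{N}}$ of $L^2[a,b]$.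
   Context: $\mathbb{N}=\{1,2,3,\ldots\}$. $L^2[a,b]$ is the complex Hilbert space with $(f,g)_{L^2[a,b]}=\int_a^b f(x)\overline{g}(x)\,dx$; $AC[a,b]$ denotes the complex-valued absolutely continuous functions on $[a,b]$. The $\lambda_m$ are the eigenvalues, and the $z_{m,1},z_{m,2}$ the corresponding eigenfunctions (forming a complete orthonormal set in $L^2[a,b]$), of the self-adjoint operator $Af=-f''+kf$ in $L^2[a,b]$ with semi-periodic boundary conditions $f(a)=-f(b)$, $f'(a)=-f'(b)$. A complete orthonormal set means an orthonormal set whose linear span is dense (equivalently, an orthonormal basis).
   Formalization: The partial sums S_{N,n}(f) are taken with Z_{m,n,1}, Z_{m,n,2} instead of the bare cosines and sines, i.e. with the missing factor λ_m^{-n/2}√(2/(b−a)); as printed, (a) fails, for example for f = Z_{1,n,1} unless λ_1^{-n/2}√(2/(b−a)) = 1. *)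

theory Defs
  imports "HOL-Analysis.Analysis" "HOL-Library.Function_Algebras"
begin

text \<open>
  A function $[a,b] \to C$ is represented by a total function \<^typ>\<open>real \<Rightarrow> complex\<close>; all notions
  below depend on its values on \<^term>\<open>{a..b}\<close> only.
\<close>

definition abs_cont_on :: "real \<Rightarrow> real \<Rightarrow> (real \<Rightarrow> complex) \<Rightarrow> bool" where
  "abs_cont_on a b f \<longleftrightarrow>
    (\<forall>\<epsilon>>0. \<exists>\<delta>>0. \<forall>\<D> T. \<D> division_of T \<and> T \<subseteq> {a..b} \<and> (\<Sum>K\<in>\<D>. Sup K - Inf K) < \<delta> \<longrightarrow>
      (\<Sum>K\<in>\<D>. cmod (f (Sup K) - f (Inf K))) < \<epsilon>)"

text \<open>
  The \<open>j\<close>-th derivative on \<^term>\<open>{a..b}\<close>, one-sided at the end points. Where a derivative does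
  not exist \<^const>\<open>vector_derivative\<close> returns an arbitrary value; for the top derivative of a member
  of \<open>sob_space\<close> below this happens on a null set only.
\<close>

definition deriv_n :: "real \<Rightarrow> real \<Rightarrow> nat \<Rightarrow> (real \<Rightarrow> complex) \<Rightarrow> real \<Rightarrow> complex" where
  "deriv_n a b j = ((\<lambda>f x. vector_derivative f (at x within {a..b})) ^^ j)"

definition L2_space :: "real \<Rightarrow> real \<Rightarrow> (real \<Rightarrow> complex) set" where
  "L2_space a b = {f. f \<in> borel_measurable (lebesgue_on {a..b}) \<and>
                      integrable (lebesgue_on {a..b}) (\<lambda>x. (cmod (f x))\<^sup>2)}"

definition L2_inner :: "real \<Rightarrow> real \<Rightarrow> (real \<Rightarrow> complex) \<Rightarrow> (real \<Rightarrow> complex) \<Rightarrow> complex" where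
  "L2_inner a b f g = (LINT x|lebesgue_on {a..b}. f x * cnj (g x))"

text \<open>The space \<open>V\<^sub>n\<close>: its first condition says that the derivatives of order less than \<open>n\<close> exist
  at every point of \<^term>\<open>{a..b}\<close>.\<close>

definition sob_space :: "real \<Rightarrow> real \<Rightarrow> nat \<Rightarrow> (real \<Rightarrow> complex) set" where
  "sob_space a b n = {f.
     (\<forall>j. Suc j < n \<longrightarrow> (\<forall>x\<in>{a..b}. deriv_n a b j f differentiable (at x within {a..b}))) \<and>
     (\<forall>j<n. abs_cont_on a b (deriv_n a b j f) \<and> deriv_n a b j f a = - deriv_n a b j f b) \<and>
     deriv_n a b n f \<in> L2_space a b}"

definition sob_inner ::
  "real \<Rightarrow> real \<Rightarrow> real \<Rightarrow> nat \<Rightarrow> (real \<Rightarrow> complex) \<Rightarrow> (real \<Rightarrow> complex) \<Rightarrow> complex" where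
  "sob_inner a b k n f g =
     (\<Sum>j=0..n. of_nat (n choose j) * of_real (k ^ (n - j)) *
        L2_inner a b (deriv_n a b j f) (deriv_n a b j g))"

definition inner_norm :: "('v \<Rightarrow> 'v \<Rightarrow> complex) \<Rightarrow> 'v \<Rightarrow> real" where
  "inner_norm ip f = sqrt (Re (ip f f))"

definition sob_norm :: "real \<Rightarrow> real \<Rightarrow> real \<Rightarrow> nat \<Rightarrow> (real \<Rightarrow> complex) \<Rightarrow> real" where
  "sob_norm a b k n = inner_norm (sob_inner a b k n)"

definition cfun_scale :: "complex \<Rightarrow> (real \<Rightarrow> complex) \<Rightarrow> real \<Rightarrow> complex" where
  "cfun_scale c f = (\<lambda>x. c * f x)"

interpretation cfun: vector_space cfun_scale
  by unfold_locales (auto simp: cfun_scale_def fun_eq_iff algebra_simps)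

definition complete_orthonormal_set ::
  "(real \<Rightarrow> complex) set \<Rightarrow> ((real \<Rightarrow> complex) \<Rightarrow> (real \<Rightarrow> complex) \<Rightarrow> complex) \<Rightarrow>
   (real \<Rightarrow> complex) set \<Rightarrow> bool" where
  "complete_orthonormal_set V ip E \<longleftrightarrow>
     E \<subseteq> V \<and>
     (\<forall>e\<in>E. \<forall>e'\<in>E. ip e e' = (if e = e' then 1 else 0)) \<and>
     (\<forall>f\<in>V. \<forall>\<epsilon>>0. \<exists>g\<in>cfun.span E. inner_norm ip (f - g) < \<epsilon>)"

definition freq :: "real \<Rightarrow> real \<Rightarrow> nat \<Rightarrow> real" where
  "freq a b m = (2 * real m - 1) * pi / (b - a)"

definition eigval :: "real \<Rightarrow> real \<Rightarrow> real \<Rightarrow> nat \<Rightarrow> real" where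
  "eigval a b k m = (freq a b m)\<^sup>2 + k"

definition z1 :: "real \<Rightarrow> real \<Rightarrow> nat \<Rightarrow> real \<Rightarrow> complex" where
  "z1 a b m x = of_real (sqrt (2 / (b - a)) * cos (freq a b m * x))"

definition z2 :: "real \<Rightarrow> real \<Rightarrow> nat \<Rightarrow> real \<Rightarrow> complex" where
  "z2 a b m x = of_real (sqrt (2 / (b - a)) * sin (freq a b m * x))"

definition Z1 :: "real \<Rightarrow> real \<Rightarrow> real \<Rightarrow> nat \<Rightarrow> nat \<Rightarrow> real \<Rightarrow> complex" where
  "Z1 a b k m n x = of_real (eigval a b k m powr (- real n / 2)) * z1 a b m x"

definition Z2 :: "real \<Rightarrow> real \<Rightarrow> real \<Rightarrow> nat \<Rightarrow> nat \<Rightarrow> real \<Rightarrow> complex" where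
  "Z2 a b k m n x = of_real (eigval a b k m powr (- real n / 2)) * z2 a b m x"

definition E_set :: "real \<Rightarrow> real \<Rightarrow> real \<Rightarrow> nat \<Rightarrow> (real \<Rightarrow> complex) set" where
  "E_set a b k n = {Z1 a b k m n |m. m \<ge> 1} \<union> {Z2 a b k m n |m. m \<ge> 1}"

definition coeff_A :: "real \<Rightarrow> real \<Rightarrow> real \<Rightarrow> nat \<Rightarrow> nat \<Rightarrow> (real \<Rightarrow> complex) \<Rightarrow> complex" where
  "coeff_A a b k m n f = sob_inner a b k n f (Z1 a b k m n)"

definition coeff_B :: "real \<Rightarrow> real \<Rightarrow> real \<Rightarrow> nat \<Rightarrow> nat \<Rightarrow> (real \<Rightarrow> complex) \<Rightarrow> complex" where
  "coeff_B a b k m n f = sob_inner a b k n f (Z2 a b k m n)"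

text \<open>
  The partial sums of the Fourier series relative to \<^const>\<open>E_set\<close>. The coefficients multiply the
  normalised functions \<^const>\<open>Z1\<close> and \<^const>\<open>Z2\<close>, that is, the bare cosines and sines times
  \<open>eigval a b k m powr (- real n / 2) * sqrt (2 / (b - a))\<close>. Without this factor
  the sums would not converge to \<open>f\<close>, as \<open>f = Z1 a b k 1 n\<close> shows.
\<close>

definition partial_sum ::
  "real \<Rightarrow> real \<Rightarrow> real \<Rightarrow> nat \<Rightarrow> nat \<Rightarrow> (real \<Rightarrow> complex) \<Rightarrow> real \<Rightarrow> complex" where
  "partial_sum a b k N n f x =
     (\<Sum>m=1..N. coeff_A a b k m n f * Z1 a b k m n x) +
     (\<Sum>m=1..N. coeff_B a b k m n f * Z2 a b k m n x)"

end

theory Submission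
  imports Defs
begin

text \<open>
  Integration by parts moves the derivatives of \<open>f \<in> V\<^sub>n\<close> onto the smooth semi-periodic eigenfunctions
  without boundary terms. Hence \<open>(f\<^sup>(\<^sup>j\<^sup>), z\<^sup>(\<^sup>j\<^sup>)) = \<omega>\<^sup>2\<^sup>j (f, z)\<close> for an eigenfunction \<open>z\<close> of frequency \<open>\<omega>\<close>, and
  the binomial theorem turns the inner product of \<open>V\<^sub>n\<close> into \<open>(f, z)\<^sub>n = (\<omega>\<^sup>2 + k)\<^sup>n (f, z)\<close>, which is (c).
  Parseval's identity in \<open>L\<^sup>2\<close>, applied to each derivative \<open>f\<^sup>(\<^sup>j\<^sup>)\<close> and summed with the weights
  \<open>n choose j\<close> times \<open>k\<^sup>n\<^sup>-\<^sup>j\<close>, gives (b). Applying (b) to \<open>f - S\<^sub>N\<^sub>,\<^sub>n(f)\<close>, whose coefficients are those of \<open>f\<close>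
  with index greater than \<open>N\<close>, gives (a) and completeness.

  Two ingredients need work. Since \<open>f\<^sup>(\<^sup>n\<^sup>)\<close> is a pointwise derivative, integration by parts
  requires Lebesgue's theorem that an absolutely continuous function is differentiable almost
  everywhere and is the integral of its derivative. Completeness in \<open>L\<^sup>2\<close> comes from the
  Stone-Weierstrass theorem on the circle, applied to \<open>f(x)\<close> times \<open>exp (- \<i> \<pi> x / (b - a))\<close>, which is
  periodic when \<open>f\<close> is semi-periodic.
\<close>

section \<open>Differentiability almost everywhere\<close>

text \<open>Stone-Weierstrass needs an algebra, and the exponentials built from odd multiples of
  \<open>pi / (b - a)\<close> do not form one: a product of two of them has even index. The factor
  of modulus one shifts odd indices to even ones, which are closed under products and live on the
  circle. Approximants that vanish at both end points are semi-periodic for free, and they are dense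
  among the square integrable functions.

  For odd \<open>j\<close> a coefficient of the \<open>j\<close>-th derivative is a multiple of the
  other coefficient of \<open>f\<close> at the same frequency, since differentiation exchanges
  cosines and sines. What scales by the power \<open>2 * j\<close> of the frequency is the sum of
  the two squared moduli, so Parseval's identity is organised frequency by frequency.

  A remainder differs from \<open>f\<close> by a smooth function. Hence its derivatives of order
  below \<open>n\<close> split at every point, and the top one almost everywhere.\<close>

text \<open>The set \<open>E\<close> is not assumed measurable; its size enters through the lower
  bound \<open>e\<close> on measurable sets that contain almost all of it. Closed intervals are
  balls of the line, so Vitali's theorem yields countably many disjoint ones covering
  \<open>E\<close> up to a null set, and finitely many of them already carry length
  \<open>e / 2\<close>.\<close>

lemma vitali_intervals:
  fixes E :: "real set" and Q :: "real \<Rightarrow> real \<Rightarrow> bool"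
  assumes "0 < e" and outer: "\<And>U. U \<in> lmeasurable \<Longrightarrow> negligible (E - U) \<Longrightarrow> e \<le> measure lebesgue U"
    and fine: "\<And>x \<delta>. x \<in> E \<Longrightarrow> 0 < \<delta> \<Longrightarrow> \<exists>u v. u < v \<and> u \<le> x \<and> x \<le> v \<and> v - u < \<delta> \<and> Q u v"
    and Q: "\<And>u v. Q u v \<Longrightarrow> {u..v} \<subseteq> {c..d}"
  obtains \<F> where "finite \<F>" "\<F> division_of \<Union>\<F>" "\<Union>\<F> \<subseteq> {c..d}"
    "\<And>K. K \<in> \<F> \<Longrightarrow> \<exists>u v. u < v \<and> K = {u..v} \<and> Q u v"
    "e / 2 \<le> (\<Sum>K\<in>\<F>. Sup K - Inf K)"
proof -
  define S where "S = {(u, v). u < v \<and> Q u v}"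
  define m where "m p = (fst p + snd p) / 2" for p :: "real \<times> real"
  define r where "r p = (snd p - fst p) / 2" for p :: "real \<times> real"
  have cb: "cball (m p) (r p) = {fst p..snd p}" for p
    by (auto simp: m_def r_def cball_eq_atLeastAtMost field_simps)
  obtain C where C: "countable C" "C \<subseteq> S"
     "pairwise (\<lambda>i j. disjnt (cball (m i) (r i)) (cball (m j) (r j))) C"
     "negligible (E - (\<Union>i \<in> C. cball (m i) (r i)))"
  proof (rule Vitali_covering_theorem_cballs[of S r E m])
    show "0 < r i" if "i \<in> S" for i using that by (auto simp: S_def r_def)
    show "\<exists>i. i \<in> S \<and> x \<in> cball (m i) (r i) \<and> r i < \<delta>" if x: "x \<in> E" "0 < \<delta>" for x \<delta>
    proof -
      obtain u v where "u < v \<and> u \<le> x \<and> x \<le> v \<and> v - u < \<delta> \<and> Q u v" using fine[OF x] by blast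
      then have "(u, v) \<in> S \<and> x \<in> cball (m (u,v)) (r (u,v)) \<and> r (u,v) < \<delta>"
        unfolding cb by (auto simp: S_def r_def)
      then show ?thesis by blast
    qed
  qed blast
  define I where "I p = {fst p..snd p}" for p :: "real \<times> real"
  have sub: "I p \<subseteq> {c..d}" if "p \<in> C" for p
    using that C(2) Q[of "fst p" "snd p"] by (auto simp: S_def I_def)
  have Usub: "\<Union>(I ` C) \<subseteq> {c..d}" using sub by blast
  have neg: "negligible (E - \<Union>(I ` C))" using C(4) by (simp add: cb I_def)
  have lm: "\<Union>(I ` C) \<in> lmeasurable"
  proof (rule fmeasurableI2[where A = "{c..d}"])
    show "{c..d} \<in> lmeasurable" by simp
    show "\<Union>(I ` C) \<subseteq> {c..d}" by (fact Usub)
    show "\<Union>(I ` C) \<in> sets lebesgue"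
      using C(1) by (intro sets.countable_Union) (auto simp: I_def)
  qed
  have m1: "e \<le> measure lebesgue (\<Union>(I ` C))" using outer[OF lm neg] .
  obtain D where D: "finite D" "D \<subseteq> I ` C" "measure lebesgue (\<Union>(I ` C)) - e / 2 < measure lebesgue (\<Union>D)"
  proof (rule measure_countable_Union_approachable[of "I ` C" "e / 2" "measure lebesgue {c..d}"])
    show "measure lebesgue (\<Union>D') \<le> measure lebesgue {c..d}" if "D' \<subseteq> I ` C" "finite D'" for D'
    proof (rule measure_mono_fmeasurable)
      show "\<Union>D' \<subseteq> {c..d}" using that Usub by blast
      show "\<Union>D' \<in> sets lebesgue" using that by (intro sets.finite_Union) (auto simp: I_def)
    qed simp
  qed (use C(1) \<open>0 < e\<close> in \<open>auto simp: I_def\<close>)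
  have DQ: "\<exists>u v. u < v \<and> K = {u..v} \<and> Q u v" if "K \<in> D" for K
    using that D(2) C(2) by (force simp: I_def S_def)
  have disj: "disjnt K K'" if K: "K \<in> D" "K' \<in> D" "K \<noteq> K'" for K K'
  proof -
    obtain p q where "p \<in> C" "q \<in> C" "K = I p" "K' = I q" using K D(2) by blast
    then show ?thesis using C(3) K(3) unfolding pairwise_def cb I_def by metis
  qed
  have div: "D division_of \<Union>D"
  proof (rule division_ofI)
    show "interior K \<inter> interior K' = {}" if "K \<in> D" "K' \<in> D" "K \<noteq> K'" for K K'
      using disj[OF that] interior_subset[of K] interior_subset[of K'] unfolding disjnt_def by blast
    show "\<exists>a b. K = cbox a b" if "K \<in> D" for K using DQ[OF that] by (metis box_real(2))
    show "K \<noteq> {}" if "K \<in> D" for K using DQ[OF that] by force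
  qed (use D in auto)
  show thesis
  proof
    show "finite D" "D division_of \<Union>D" "\<Union>D \<subseteq> {c..d}" using D Usub div by auto
    show "\<exists>u v. u < v \<and> K = {u..v} \<and> Q u v" if "K \<in> D" for K by (fact DQ[OF that])
    have "measure lebesgue (\<Union>D) \<le> (\<Sum>K\<in>D. measure lebesgue K)"
      by (rule measure_Union_le) (use D DQ in \<open>force+\<close>)
    also have "\<dots> = (\<Sum>K\<in>D. Sup K - Inf K)"
      by (rule sum.cong) (use DQ in \<open>fastforce+\<close>)
    finally show "e / 2 \<le> (\<Sum>K\<in>D. Sup K - Inf K)" using D(3) m1 by simp
  qed
qed

text \<open>\<open>e\<close> is a positive lower bound for the outer measure of \<open>E\<close>.
  The sets \<open>U\<close> may miss a null part of \<open>E\<close>, since a Vitali cover does no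
  better; adding that part to \<open>U\<close> does not increase the measure.\<close>

lemma not_negligible_outer:
  fixes E :: "real set"
  assumes "\<not> negligible E"
  obtains e where "0 < e" "\<And>U. U \<in> lmeasurable \<Longrightarrow> negligible (E - U) \<Longrightarrow> e \<le> measure lebesgue U"
proof -
  obtain e where e: "0 < e" "\<And>T. E \<subseteq> T \<Longrightarrow> T \<in> lmeasurable \<Longrightarrow> e \<le> measure lebesgue T"
    using assms unfolding negligible_outer by (metis not_le)
  have "e \<le> measure lebesgue U" if U: "U \<in> lmeasurable" "negligible (E - U)" for U
  proof -
    have "U \<union> (E - U) \<in> lmeasurable" 
      using fmeasurable.Un[OF U(1) negligible_imp_measurable[OF U(2)]] .
    then have "e \<le> measure lebesgue (U \<union> (E - U))" by (intro e(2)) auto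
    also have "\<dots> \<le> measure lebesgue U + measure lebesgue (E - U)"
      using U by (intro measure_Un_le) (auto simp: negligible_imp_sets)
    finally show ?thesis using U by (simp add: negligible_imp_measure0)
  qed
  then show thesis using that e(1) by blast
qed

text \<open>Tagging every interval with its left end point gives a tagged division, over which
  increments telescope.\<close>

lemma additive_division_1:
  fixes f :: "real \<Rightarrow> 'a::real_normed_vector"
  assumes "a \<le> b" "D division_of {a..b}"
  shows "(\<Sum>K\<in>D. f (Sup K) - f (Inf K)) = f b - f a"
proof -
  have K: "Inf K \<in> K \<and> K \<subseteq> {a..b} \<and> (\<exists>u v. K = cbox u v)" if K: "K \<in> D" for K
  proof -
    obtain u v where uv: "K = cbox u v" using division_ofD(4)[OF assms(2) K] by blast
    then have "Inf K \<in> K" using division_ofD(3)[OF assms(2) K] by auto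
    then show ?thesis using uv division_ofD(2)[OF assms(2) K] by blast
  qed
  have t: "((\<lambda>K. (Inf K, K)) ` D) tagged_division_of {a..b}"
  proof (rule tagged_division_ofI)
    show "finite ((\<lambda>K. (Inf K, K)) ` D)" using assms(2) by (simp add: division_of_finite)
    show "\<Union>{K. \<exists>x. (x, K) \<in> (\<lambda>K. (Inf K, K)) ` D} = {a..b}"
      using division_ofD(6)[OF assms(2)] by (auto simp: image_iff)
    show "x \<in> K" "K \<subseteq> {a..b}" "\<exists>u v. K = cbox u v" if "(x, K) \<in> (\<lambda>K. (Inf K, K)) ` D" for x K
      using that K by blast+
    show "interior K1 \<inter> interior K2 = {}"
      if "(x1, K1) \<in> (\<lambda>K. (Inf K, K)) ` D" "(x2, K2) \<in> (\<lambda>K. (Inf K, K)) ` D" "(x1, K1) \<noteq> (x2, K2)"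
      for x1 K1 x2 K2
      by (rule division_ofD(5)[OF assms(2)]) (use that in blast)+
  qed
  show ?thesis
    using additive_tagged_division_1[OF assms(1) t, of f]
    by (subst (asm) sum.reindex) (auto simp: inj_on_def)
qed

text \<open>
  Degenerate intervals may be shared by the divisions of adjacent intervals; hence the condition
  that \<open>h\<close> vanishes on them.
\<close>

lemma division_refine_glue:
  fixes q :: "real set \<Rightarrow> real set set"
  assumes D: "D division_of {c..d}" and q: "\<And>I. I \<in> D \<Longrightarrow> q I division_of I"
    and h: "\<And>x. h {x} = (0::real)"
  obtains D' where "D' division_of \<Union>D'" "\<Union>D' \<subseteq> {c..d}" "sum h D' = (\<Sum>I\<in>D. sum h (q I))"
proof -
  define q' where "q' I = {K \<in> q I. interior K \<noteq> {}}" for I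
  define D' where "D' = (\<Union>I\<in>D. q' I)"
  have fin: "finite D" "\<And>I. I \<in> D \<Longrightarrow> finite (q I)" using D q by (auto dest: division_of_finite)
  have same: "I = J" if "I \<in> D" "J \<in> D" "K \<in> q' I" "K' \<in> q' J" "interior K \<inter> interior K' \<noteq> {}" for I J K K'
  proof (rule ccontr)
    assume "I \<noteq> J"
    then have "interior I \<inter> interior J = {}" using D that by blast
    moreover have "interior K \<subseteq> interior I" "interior K' \<subseteq> interior J"
      using that q division_ofD(2) by (auto simp: q'_def intro!: interior_mono)
    ultimately show False using that by blast
  qed
  show thesis
  proof
    show "D' division_of \<Union>D'"
    proof (rule division_ofI)
      show "finite D'" using fin by (auto simp: D'_def q'_def)
      fix K assume K: "K \<in> D'"
      then obtain I where I: "I \<in> D" "K \<in> q' I" by (auto simp: D'_def)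
      show "K \<subseteq> \<Union>D'" using K by blast
      show "K \<noteq> {}" "\<exists>a b. K = cbox a b" using I division_ofD(3,4)[OF q[OF I(1)]] by (auto simp: q'_def)
      fix K' assume K': "K' \<in> D'" "K \<noteq> K'"
      then obtain J where J: "J \<in> D" "K' \<in> q' J" by (auto simp: D'_def)
      show "interior K \<inter> interior K' = {}"
      proof (rule ccontr)
        assume "interior K \<inter> interior K' \<noteq> {}"
        then have "I = J" using same I J by blast
        then show False
          using division_ofD(5)[OF q[OF I(1)], of K K'] I J K' \<open>interior K \<inter> interior K' \<noteq> {}\<close>
          by (auto simp: q'_def)
      qed
    qed simp
    show "\<Union>D' \<subseteq> {c..d}"
      using division_ofD(2)[OF D] division_ofD(2)[OF q] by (fastforce simp: D'_def q'_def)
    have "sum h D' = (\<Sum>I\<in>D. sum h (q' I))"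
      unfolding D'_def
    proof (rule sum.UNION_disjoint)
      show "\<forall>I\<in>D. \<forall>J\<in>D. I \<noteq> J \<longrightarrow> q' I \<inter> q' J = {}"
      proof (intro ballI impI equals0I)
        fix I J K assume "I \<in> D" "J \<in> D" "I \<noteq> J" "K \<in> q' I \<inter> q' J"
        then show False using same[of I J K K] by (auto simp: q'_def)
      qed
    qed (use fin in \<open>auto simp: q'_def\<close>)
    also have "\<dots> = (\<Sum>I\<in>D. sum h (q I))"
    proof (rule sum.cong[OF refl])
      fix I assume I: "I \<in> D"
      show "sum h (q' I) = sum h (q I)"
      proof (rule sum.mono_neutral_left)
        show "\<forall>K\<in>q I - q' I. h K = 0"
        proof
          fix K assume K: "K \<in> q I - q' I"
          then obtain u v where "K = cbox u v" "K \<noteq> {}" using division_ofD(3,4)[OF q[OF I]] by blast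
          moreover have "interior K = {}" using K by (auto simp: q'_def)
          ultimately have "K = {u}" by auto
          then show "h K = 0" by (simp add: h)
        qed
      qed (use fin I in \<open>auto simp: q'_def\<close>)
    qed
    finally show "sum h D' = (\<Sum>I\<in>D. sum h (q I))" .
  qed
qed

text \<open>The signed increments \<open>s * \<Delta> K\<close> over the division add up to
  \<open>\<bar>g v - g u\<bar>\<close>. On an interval of \<open>F\<close> the absolute value of the
  increment exceeds the signed one by at least \<open>- 2 * s * \<Delta> K\<close>, hence by at
  least \<open>2 * r\<close> times the length; elsewhere it is no smaller.\<close>

lemma variation_opposite_slopes:
  fixes g :: "real \<Rightarrow> real"
  assumes I: "u \<le> v" and F: "F division_of \<Union>F" "\<Union>F \<subseteq> {u..v}"
    and s: "\<bar>s\<bar> = 1" "s * (g v - g u) \<ge> 0"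
    and slope: "\<And>K. K \<in> F \<Longrightarrow> r * (Sup K - Inf K) \<le> - s * (g (Sup K) - g (Inf K))"
  obtains q where "q division_of {u..v}"
    "\<bar>g v - g u\<bar> + 2 * r * (\<Sum>K\<in>F. Sup K - Inf K) \<le> (\<Sum>K\<in>q. \<bar>g (Sup K) - g (Inf K)\<bar>)"
proof -
  obtain q where q: "F \<subseteq> q" "q division_of {u..v}"
    using partial_division_extend_interval[of F u v] F by auto
  have fin: "finite q" using q by (auto dest: division_of_finite)
  define \<Delta> where "\<Delta> K = g (Sup K) - g (Inf K)" for K :: "real set"
  have s1: "s * x \<le> \<bar>x\<bar>" "- s * x \<le> \<bar>x\<bar>" for x
    using abs_ge_self[of "s * x"] abs_ge_minus_self[of "s * x"] s(1) by (simp_all add: abs_mult)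
  have "\<bar>g v - g u\<bar> = s * (g v - g u)" using s by (metis abs_mult abs_of_nonneg mult_1)
  also have "\<dots> = (\<Sum>K\<in>q. s * \<Delta> K)"
    using additive_division_1[OF I q(2), of g] by (simp add: \<Delta>_def flip: sum_distrib_left)
  also have "\<dots> = (\<Sum>K\<in>q - F. s * \<Delta> K) + (\<Sum>K\<in>F. s * \<Delta> K)"
    using q(1) fin by (simp add: sum.subset_diff)
  also have "\<dots> \<le> (\<Sum>K\<in>q - F. \<bar>\<Delta> K\<bar>) + (\<Sum>K\<in>F. \<bar>\<Delta> K\<bar> - 2 * r * (Sup K - Inf K))"
  proof (intro add_mono sum_mono)
    fix K assume "K \<in> F"
    then show "s * \<Delta> K \<le> \<bar>\<Delta> K\<bar> - 2 * r * (Sup K - Inf K)"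
      using slope[of K] s1(2)[of "\<Delta> K"] by (simp add: \<Delta>_def)
  qed (rule s1)
  also have "\<dots> = (\<Sum>K\<in>q. \<bar>\<Delta> K\<bar>) - 2 * r * (\<Sum>K\<in>F. Sup K - Inf K)"
    using q(1) fin by (simp add: sum.subset_diff sum_subtractf[of "\<lambda>K. \<bar>\<Delta> K\<bar>"] sum_distrib_left)
  finally show thesis using that[OF q(2)] by (simp add: \<Delta>_def)
qed

text \<open>
  Austin's argument: take a division whose variation sum is almost the supremum. On each of its
  intervals, cover the exceptional points by small disjoint intervals over which \<open>g\<close> moves in the
  direction opposite to its increment. Refining the division by these raises the variation sum by
  at least \<open>2r\<close> times their total length, which is impossible unless the set is negligible.
\<close>

lemma negligible_two_slopes:
  fixes g :: "real \<Rightarrow> real"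
  assumes "c < d" "0 < r"
    and bv: "\<And>D. D division_of \<Union>D \<Longrightarrow> \<Union>D \<subseteq> {c..d} \<Longrightarrow> (\<Sum>K\<in>D. \<bar>g (Sup K) - g (Inf K)\<bar>) \<le> B"
    and E: "E \<subseteq> {c<..<d}"
    and up: "\<And>x \<delta>. x \<in> E \<Longrightarrow> 0 < \<delta> \<Longrightarrow> \<exists>u v. u < v \<and> u \<le> x \<and> x \<le> v \<and> v - u < \<delta> \<and> r * (v - u) \<le> g v - g u"
    and down: "\<And>x \<delta>. x \<in> E \<Longrightarrow> 0 < \<delta> \<Longrightarrow> \<exists>u v. u < v \<and> u \<le> x \<and> x \<le> v \<and> v - u < \<delta> \<and> r * (v - u) \<le> - (g v - g u)"
  shows "negligible E"
proof (rule ccontr)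
  assume "\<not> negligible E"
  then obtain e where e: "0 < e" "\<And>U. U \<in> lmeasurable \<Longrightarrow> negligible (E - U) \<Longrightarrow> e \<le> measure lebesgue U"
    by (rule not_negligible_outer) blast
  define \<Delta> where "\<Delta> K = g (Sup K) - g (Inf K)" for K :: "real set"
  define VV where "VV = {(\<Sum>K\<in>D. \<bar>\<Delta> K\<bar>) |D. D division_of \<Union>D \<and> \<Union>D \<subseteq> {c..d}}"
  have bdd: "bdd_above VV" using bv unfolding bdd_above_def VV_def \<Delta>_def by blast
  have "0 \<in> VV" unfolding VV_def by (rule CollectI, rule exI[of _ "{}"]) auto
  \<comment> \<open>The slack \<open>r * e / 2\<close> is half of \<open>2 * r * (e / 2)\<close>,
    the gain obtained from intervals of total length at least \<open>e / 2\<close>.\<close>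
  then obtain y where "y \<in> VV" "Sup VV - r * e / 2 < y"
    using less_cSup_iff[of VV "Sup VV - r * e / 2"] bdd e(1) \<open>0 < r\<close> by auto
  then obtain D0 where D0: "D0 division_of \<Union>D0" "\<Union>D0 \<subseteq> {c..d}" "Sup VV - r * e / 2 < (\<Sum>K\<in>D0. \<bar>\<Delta> K\<bar>)"
    by (auto simp: VV_def)
  obtain D where D: "D0 \<subseteq> D" "D division_of {c..d}"
    using partial_division_extend_interval[of D0 c d] D0 by auto
  have finD: "finite D" using D by (auto dest: division_of_finite)
  have nearopt: "Sup VV - r * e / 2 < (\<Sum>K\<in>D. \<bar>\<Delta> K\<bar>)"
    using D0(3) sum_mono2[OF finD D(1), of "\<lambda>K. \<bar>\<Delta> K\<bar>"] by auto
  have DI: "\<exists>u v. u \<le> v \<and> I = {u..v}" if "I \<in> D" for I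
    using division_ofD(3,4)[OF D(2) that] by force
  define s where "s I = (if 0 \<le> \<Delta> I then 1 else -1 :: real)" for I
  define Q where "Q u v \<longleftrightarrow> (\<exists>I\<in>D. {u..v} \<subseteq> I \<and> r * (v - u) \<le> - s I * (g v - g u))" for u v
  \<comment> \<open>End points of the division are removed so that every remaining point is interior
    to its interval and small intervals around it stay inside. They are finite in number, so the
    bound \<open>e\<close> survives.\<close>
  define P where "P = Inf ` D \<union> Sup ` D"
  have "finite P" using finD by (simp add: P_def)
  have outer: "e \<le> measure lebesgue U" if U: "U \<in> lmeasurable" "negligible (E - P - U)" for U
  proof (rule e(2)[OF U(1)])
    have "negligible ((E - P - U) \<union> P)" using U(2) \<open>finite P\<close> by (simp add: negligible_finite)
    then show "negligible (E - U)" by (rule negligible_subset) auto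
  qed
  have cover: "\<exists>u v. u < v \<and> u \<le> x \<and> x \<le> v \<and> v - u < \<delta> \<and> Q u v" if x: "x \<in> E - P" "0 < \<delta>" for x \<delta>
  proof -
    have "x \<in> {c..d}" using x E by auto
    then obtain I where I: "I \<in> D" "x \<in> I" using D(2) by blast
    then obtain l u where lu: "l \<le> u" "I = {l..u}" using DI by blast
    then have "l = Inf I" "u = Sup I" by auto
    then have "l \<in> P" "u \<in> P" using I(1) by (auto simp: P_def)
    then have "l \<noteq> x" "x \<noteq> u" using x by auto
    then have "l < x" "x < u" using I(2) lu by auto
    define \<eta> where "\<eta> = Min {\<delta>, x - l, u - x}"
    have \<eta>: "0 < \<eta>" "\<eta> \<le> \<delta>" "\<eta> \<le> x - l" "\<eta> \<le> u - x"
      using \<open>l < x\<close> \<open>x < u\<close> x by (auto simp: \<eta>_def)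
    have xE: "x \<in> E" using x by blast
    have "\<exists>p q. p < q \<and> p \<le> x \<and> x \<le> q \<and> q - p < \<eta> \<and> r * (q - p) \<le> - s I * (g q - g p)"
      using up[OF xE \<eta>(1)] down[OF xE \<eta>(1)] by (cases "0 \<le> \<Delta> I") (auto simp: s_def)
    then obtain p q where pq: "p < q" "p \<le> x" "x \<le> q" "q - p < \<eta>" "r * (q - p) \<le> - s I * (g q - g p)"
      by blast
    moreover have "{p..q} \<subseteq> I" using pq \<eta> by (auto simp: lu)
    ultimately have "Q p q" using I(1) by (auto simp: Q_def)
    then show ?thesis using pq \<eta> by (intro exI[of _ p] exI[of _ q]) auto
  qed
  have Qsub: "{u..v} \<subseteq> {c..d}" if "Q u v" for u v
    using that division_ofD(2)[OF D(2)] unfolding Q_def by blast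
  obtain F where F: "finite F" "F division_of \<Union>F" "\<Union>F \<subseteq> {c..d}"
    "\<And>K. K \<in> F \<Longrightarrow> \<exists>u v. u < v \<and> K = {u..v} \<and> Q u v"
    "e / 2 \<le> (\<Sum>K\<in>F. Sup K - Inf K)"
    by (rule vitali_intervals[OF e(1) outer cover Qsub]) blast+
  have "\<exists>I. I \<in> D \<and> K \<subseteq> I \<and> r * (Sup K - Inf K) \<le> - s I * \<Delta> K" if "K \<in> F" for K
    using F(4)[OF that] by (fastforce simp: Q_def \<Delta>_def)
  then obtain \<iota> where \<iota>: "\<And>K. K \<in> F \<Longrightarrow> \<iota> K \<in> D" "\<And>K. K \<in> F \<Longrightarrow> K \<subseteq> \<iota> K"
    "\<And>K. K \<in> F \<Longrightarrow> r * (Sup K - Inf K) \<le> - s (\<iota> K) * \<Delta> K" by metis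
  define G where "G I = {K \<in> F. \<iota> K = I}" for I
  have "\<exists>q. q division_of I \<and> \<bar>\<Delta> I\<bar> + 2 * r * (\<Sum>K\<in>G I. Sup K - Inf K) \<le> (\<Sum>K\<in>q. \<bar>\<Delta> K\<bar>)"
    if I: "I \<in> D" for I
  proof -
    obtain l u where lu: "l \<le> u" "I = {l..u}" using DI I by blast
    have "G I division_of \<Union>(G I)"
      using F(2) by (rule division_of_subset) (auto simp: G_def)
    moreover have "\<Union>(G I) \<subseteq> {l..u}" using \<iota>(2) by (auto simp: G_def lu)
    moreover have "\<bar>s I\<bar> = 1" by (simp add: s_def)
    moreover have "0 \<le> s I * (g u - g l)" using lu by (auto simp: s_def \<Delta>_def)
    moreover have "r * (Sup K - Inf K) \<le> - s I * (g (Sup K) - g (Inf K))" if "K \<in> G I" for K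
      using \<iota>(3)[of K] that by (simp add: G_def \<Delta>_def)
    ultimately obtain q where "q division_of {l..u}"
      "\<bar>g u - g l\<bar> + 2 * r * (\<Sum>K\<in>G I. Sup K - Inf K) \<le> (\<Sum>K\<in>q. \<bar>g (Sup K) - g (Inf K)\<bar>)"
      using variation_opposite_slopes[OF lu(1)] by blast
    then show ?thesis using lu by (auto simp: \<Delta>_def)
  qed
  then obtain q where q: "\<And>I. I \<in> D \<Longrightarrow> q I division_of I"
    "\<And>I. I \<in> D \<Longrightarrow> \<bar>\<Delta> I\<bar> + 2 * r * (\<Sum>K\<in>G I. Sup K - Inf K) \<le> (\<Sum>K\<in>q I. \<bar>\<Delta> K\<bar>)" by metis
  have "\<bar>\<Delta> {x}\<bar> = 0" for x by (simp add: \<Delta>_def)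
  then obtain D' where D': "D' division_of \<Union>D'" "\<Union>D' \<subseteq> {c..d}"
    "(\<Sum>K\<in>D'. \<bar>\<Delta> K\<bar>) = (\<Sum>I\<in>D. \<Sum>K\<in>q I. \<bar>\<Delta> K\<bar>)"
    using division_refine_glue[OF D(2) q(1), of "\<lambda>K. \<bar>\<Delta> K\<bar>"] by blast
  have "Sup VV - r * e / 2 + 2 * r * (e / 2) < (\<Sum>I\<in>D. \<bar>\<Delta> I\<bar>) + 2 * r * (\<Sum>K\<in>F. Sup K - Inf K)"
    using nearopt F(5) \<open>0 < r\<close> by (intro add_less_le_mono mult_left_mono) auto
  also have "(\<Sum>K\<in>F. Sup K - Inf K) = (\<Sum>I\<in>D. \<Sum>K\<in>G I. Sup K - Inf K)"
    unfolding G_def by (rule sum.group[symmetric]) (use F(1) finD \<iota>(1) in auto)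
  also have "(\<Sum>I\<in>D. \<bar>\<Delta> I\<bar>) + 2 * r * (\<Sum>I\<in>D. \<Sum>K\<in>G I. Sup K - Inf K)
      = (\<Sum>I\<in>D. \<bar>\<Delta> I\<bar> + 2 * r * (\<Sum>K\<in>G I. Sup K - Inf K))"
    by (simp add: sum.distrib sum_distrib_left)
  also have "\<dots> \<le> (\<Sum>K\<in>D'. \<bar>\<Delta> K\<bar>)" unfolding D'(3) by (intro sum_mono q)
  also have "\<dots> \<le> Sup VV" 
    using D'(1,2) by (intro cSup_upper bdd) (auto simp only: VV_def)
  finally show False using mult_pos_pos[OF e(1) \<open>0 < r\<close>] by (simp add: field_simps)
qed

text \<open>Intervals of total length at least \<open>e / 2\<close> on which the slope is at least
  \<open>M\<close> in absolute value produce variation at least \<open>M * (e / 2)\<close>. The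
  choice of \<open>M\<close> makes this \<open>\<bar>B\<bar> + 1\<close>, more than \<open>B\<close>
  allows.\<close>

lemma negligible_unbounded_slopes:
  fixes g :: "real \<Rightarrow> real"
  assumes bv: "\<And>D. D division_of \<Union>D \<Longrightarrow> \<Union>D \<subseteq> {c..d} \<Longrightarrow> (\<Sum>K\<in>D. \<bar>g (Sup K) - g (Inf K)\<bar>) \<le> B"
    and E: "E \<subseteq> {c<..<d}"
    and unb: "\<And>x \<delta> M. x \<in> E \<Longrightarrow> 0 < \<delta> \<Longrightarrow> \<exists>u v. u < v \<and> u \<le> x \<and> x \<le> v \<and> v - u < \<delta> \<and> M * (v - u) \<le> \<bar>g v - g u\<bar>"
  shows "negligible E"
proof (rule ccontr)
  assume "\<not> negligible E"
  then obtain e where e: "0 < e" "\<And>U. U \<in> lmeasurable \<Longrightarrow> negligible (E - U) \<Longrightarrow> e \<le> measure lebesgue U"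
    by (rule not_negligible_outer) blast
  define M where "M = 2 * (\<bar>B\<bar> + 1) / e"
  define Q where "Q u v \<longleftrightarrow> {u..v} \<subseteq> {c..d} \<and> M * (v - u) \<le> \<bar>g v - g u\<bar>" for u v
  have cover: "\<exists>u v. u < v \<and> u \<le> x \<and> x \<le> v \<and> v - u < \<delta> \<and> Q u v" if x: "x \<in> E" "0 < \<delta>" for x \<delta>
  proof -
    have "0 < Min {\<delta>, x - c, d - x}" using x E by auto
    from unb[OF x(1) this, of M] obtain u v where "u < v" "u \<le> x" "x \<le> v" "v - u < Min {\<delta>, x - c, d - x}"
       "M * (v - u) \<le> \<bar>g v - g u\<bar>" by blast
    then show ?thesis by (intro exI[of _ u] exI[of _ v]) (auto simp: Q_def)
  qed
  obtain F where F: "finite F" "F division_of \<Union>F" "\<Union>F \<subseteq> {c..d}"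
    "\<And>K. K \<in> F \<Longrightarrow> \<exists>u v. u < v \<and> K = {u..v} \<and> Q u v"
    "e / 2 \<le> (\<Sum>K\<in>F. Sup K - Inf K)"
    by (rule vitali_intervals[OF e(1) e(2) cover, where c = c and d = d]) (auto simp: Q_def)
  have "\<bar>B\<bar> + 1 = M * (e / 2)" using e(1) by (simp add: M_def)
  also have "\<dots> \<le> M * (\<Sum>K\<in>F. Sup K - Inf K)"
    using F(5) e(1) by (intro mult_left_mono) (auto simp: M_def)
  also have "\<dots> \<le> (\<Sum>K\<in>F. \<bar>g (Sup K) - g (Inf K)\<bar>)"
    unfolding sum_distrib_left
  proof (rule sum_mono)
    fix K assume "K \<in> F"
    from F(4)[OF this] show "M * (Sup K - Inf K) \<le> \<bar>g (Sup K) - g (Inf K)\<bar>" by (auto simp: Q_def)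
  qed
  also have "\<dots> \<le> B" by (rule bv[OF F(2,3)])
  finally show False by linarith
qed

section \<open>Difference quotients without a limit, and functions of bounded variation\<close>

text \<open>Lower and upper limits in the extended reals decide the case. If they agree, their
  common value is infinite, because a finite limit is excluded; otherwise there is room for two
  numbers between them. These are taken rational so that only countably many pairs occur
  later.\<close>

lemma limit_or_two_values_or_unbounded:
  fixes Q :: "'a \<Rightarrow> real"
  assumes "F \<noteq> bot" and nolim: "\<And>l. \<not> (Q \<longlongrightarrow> l) F"
  obtains (two) p q where "p \<in> \<rat>" "q \<in> \<rat>" "p < q" "\<exists>\<^sub>F y in F. Q y < p" "\<exists>\<^sub>F y in F. q < Q y"
    | (unbounded) "\<And>M. \<exists>\<^sub>F y in F. M < \<bar>Q y\<bar>"
proof -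
  define L where "L = Liminf F (\<lambda>y. ereal (Q y))"
  define U where "U = Limsup F (\<lambda>y. ereal (Q y))"
  have "L \<le> U" unfolding L_def U_def using assms(1) by (intro Liminf_le_Limsup)
  show thesis
  proof (cases "L = U")
    case True
    then have lim: "((\<lambda>y. ereal (Q y)) \<longlongrightarrow> L) F"
      using tendsto_iff_Liminf_eq_Limsup[OF assms(1)] by (metis L_def U_def)
    have "L \<noteq> ereal l" for l using lim nolim[of l] by auto
    then consider "L = \<infinity>" | "L = - \<infinity>" by (cases L) auto
    then have "\<exists>\<^sub>F y in F. M < \<bar>Q y\<bar>" for M
    proof cases
      case 1
      then have "\<forall>\<^sub>F y in F. ereal M < ereal (Q y)" using lim by (simp only: tendsto_PInfty)
      then have "\<forall>\<^sub>F y in F. M < Q y" by simp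
      then have "\<forall>\<^sub>F y in F. M < \<bar>Q y\<bar>" by eventually_elim auto
      then show ?thesis using assms(1) by (rule eventually_frequently[rotated])
    next
      case 2
      then have "\<forall>\<^sub>F y in F. ereal (Q y) < ereal (- M)" using lim by (simp only: tendsto_MInfty)
      then have "\<forall>\<^sub>F y in F. Q y < - M" by simp
      then have "\<forall>\<^sub>F y in F. M < \<bar>Q y\<bar>" by eventually_elim auto
      then show ?thesis using assms(1) by (rule eventually_frequently[rotated])
    qed
    then show thesis using unbounded by blast
  next
    case False
    then have "L < U" using \<open>L \<le> U\<close> by simp
    \<comment> \<open>The choices arrange \<open>L < w < p < x < q < y < U\<close>, which keeps the
      rationals \<open>p < q\<close> strictly between the two limits.\<close>
    then obtain x where x: "L < ereal x" "ereal x < U" using ereal_dense2 by blast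
    from ereal_dense2[OF x(2)] obtain y where y: "ereal x < ereal y" "ereal y < U" by blast
    from ereal_dense2[OF x(1)] obtain w where w: "L < ereal w" "ereal w < ereal x" by blast
    obtain p where p: "p \<in> \<rat>" "w < p" "p < x" using Rats_dense_in_real[of w x] w by auto
    obtain q where q: "q \<in> \<rat>" "x < q" "q < y" using Rats_dense_in_real[of x y] y by auto
    have "\<not> ereal p \<le> L" using w p by (metis ereal_less_eq(3) less_le_not_le order.trans)
    then obtain p' where "p' < ereal p" "\<not> (\<forall>\<^sub>F y in F. p' < ereal (Q y))"
      unfolding L_def le_Liminf_iff by blast
    then have "\<exists>\<^sub>F y in F. \<not> p' < ereal (Q y)" by (simp add: frequently_def)
    then have f1: "\<exists>\<^sub>F y in F. Q y < p"
      by (rule frequently_elim1) (use \<open>p' < ereal p\<close> in \<open>auto simp: not_less dest: le_less_trans\<close>)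
    have "\<not> U \<le> ereal q" using y q by (metis ereal_less_eq(3) less_le_not_le order.trans)
    then obtain q' where "ereal q < q'" "\<not> (\<forall>\<^sub>F y in F. ereal (Q y) < q')"
      unfolding U_def Limsup_le_iff by blast
    then have "\<exists>\<^sub>F y in F. \<not> ereal (Q y) < q'" by (simp add: frequently_def)
    then have f2: "\<exists>\<^sub>F y in F. q < Q y"
      by (rule frequently_elim1) (use \<open>ereal q < q'\<close> in \<open>auto simp: not_less dest: less_le_trans\<close>)
    show thesis using two[OF p(1) q(1) _ f1 f2] p q by simp
  qed
qed

text \<open>A difference quotient is symmetric in its two points, so a point \<open>y\<close> on
  either side of \<open>x\<close> gives an interval with \<open>x\<close> as an end point. This is
  the form that fine covers require.\<close>

lemma frequently_slope_straddle:
  fixes g :: "real \<Rightarrow> real"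
  assumes "\<exists>\<^sub>F y in at x. P ((g y - g x) / (y - x))" "0 < \<delta>"
  obtains u v where "u < v" "u \<le> x" "x \<le> v" "v - u < \<delta>" "P ((g v - g u) / (v - u))"
proof -
  obtain y where y: "y \<noteq> x" "dist y x < \<delta>" "P ((g y - g x) / (y - x))"
    using assms unfolding frequently_at by blast
  show thesis
  proof (cases "y < x")
    case True
    moreover have "(g y - g x) / (y - x) = (g x - g y) / (x - y)"
      using y(1) by (simp add: field_simps)
    ultimately show thesis using y by (intro that[of y x]) (auto simp: dist_real_def)
  next
    case False
    then show thesis using y by (intro that[of x y]) (auto simp: dist_real_def)
  qed
qed

lemma sum_lengths_le:
  fixes c d :: real
  assumes "c \<le> d" "D division_of \<Union>D" "\<Union>D \<subseteq> {c..d}"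
  shows "(\<Sum>K\<in>D. Sup K - Inf K) \<le> d - c"
    and "\<And>K. K \<in> D \<Longrightarrow> Inf K \<le> Sup K"
proof -
  have nn: "Inf K \<le> Sup K" if "E division_of S" "K \<in> E" for K E and S :: "real set"
    using division_ofD(3,4)[OF that] by force
  obtain q where q: "D \<subseteq> q" "q division_of {c..d}"
    using partial_division_extend_interval[of D c d] assms by auto
  have "(\<Sum>K\<in>D. Sup K - Inf K) \<le> (\<Sum>K\<in>q. Sup K - Inf K)"
    using q nn[OF q(2)] by (intro sum_mono2) (auto dest: division_of_finite)
  then show "(\<Sum>K\<in>D. Sup K - Inf K) \<le> d - c"
    using additive_division_1[OF assms(1) q(2), of "\<lambda>x. x"] by simp
  show "\<And>K. K \<in> D \<Longrightarrow> Inf K \<le> Sup K" using nn assms(2) by blast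
qed

text \<open>If the difference quotient at \<open>x\<close> has no limit, then \<open>x\<close> lies
  in \<open>E'\<close> or in \<open>E p q\<close> for some rationals \<open>p < q\<close>. These are
  countably many sets, each of them null by one of the two covering lemmas.\<close>

lemma bounded_variation_differentiable_ae:
  fixes g :: "real \<Rightarrow> real"
  assumes "c < d"
    and bv: "\<And>D. D division_of \<Union>D \<Longrightarrow> \<Union>D \<subseteq> {c..d} \<Longrightarrow> (\<Sum>K\<in>D. \<bar>g (Sup K) - g (Inf K)\<bar>) \<le> B"
  shows "negligible {x \<in> {c<..<d}. \<not> g differentiable at x}"
proof -
  define Q where "Q x y = (g y - g x) / (y - x)" for x y
  define E where "E p q = {x \<in> {c<..<d}. (\<exists>\<^sub>F y in at x. Q x y < p) \<and> (\<exists>\<^sub>F y in at x. q < Q x y)}" for p q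
  define E' where "E' = {x \<in> {c<..<d}. \<forall>M. \<exists>\<^sub>F y in at x. M < \<bar>Q x y\<bar>}"
  have neg: "negligible (E p q)" if "p < q" for p q
  proof (rule negligible_two_slopes[OF \<open>c < d\<close>])
    \<comment> \<open>Subtracting the line of slope \<open>m\<close> makes the two slopes opposite.\<close>
    define m where "m = (p + q) / 2"
    define h where "h x = g x - m * x" for x
    show "0 < (q - p) / 2" using that by simp
    show "(\<Sum>K\<in>D. \<bar>h (Sup K) - h (Inf K)\<bar>) \<le> B + \<bar>m\<bar> * (d - c)"
      if D: "D division_of \<Union>D" "\<Union>D \<subseteq> {c..d}" for D
    proof -
      note l = sum_lengths_le[OF less_imp_le[OF \<open>c < d\<close>] D]
      have "(\<Sum>K\<in>D. \<bar>h (Sup K) - h (Inf K)\<bar>) \<le> (\<Sum>K\<in>D. \<bar>g (Sup K) - g (Inf K)\<bar> + \<bar>m\<bar> * (Sup K - Inf K))"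
      proof (rule sum_mono)
        fix K assume "K \<in> D"
        then have "Inf K \<le> Sup K" by (rule l)
        have "h (Sup K) - h (Inf K) = (g (Sup K) - g (Inf K)) - m * (Sup K - Inf K)"
          by (simp add: h_def algebra_simps)
        also have "\<bar>\<dots>\<bar> \<le> \<bar>g (Sup K) - g (Inf K)\<bar> + \<bar>m * (Sup K - Inf K)\<bar>" by simp
        also have "\<bar>m * (Sup K - Inf K)\<bar> = \<bar>m\<bar> * (Sup K - Inf K)"
          using \<open>Inf K \<le> Sup K\<close> by (simp add: abs_mult)
        finally show "\<bar>h (Sup K) - h (Inf K)\<bar> \<le> \<bar>g (Sup K) - g (Inf K)\<bar> + \<bar>m\<bar> * (Sup K - Inf K)" .
      qed
      also have "\<dots> = (\<Sum>K\<in>D. \<bar>g (Sup K) - g (Inf K)\<bar>) + \<bar>m\<bar> * (\<Sum>K\<in>D. Sup K - Inf K)"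
        by (simp add: sum.distrib sum_distrib_left)
      also have "\<dots> \<le> B + \<bar>m\<bar> * (d - c)"
        by (intro add_mono bv[OF D] mult_left_mono l) simp
      finally show ?thesis .
    qed
    show "E p q \<subseteq> {c<..<d}" by (auto simp: E_def)
    show "\<exists>u v. u < v \<and> u \<le> x \<and> x \<le> v \<and> v - u < \<delta> \<and> (q - p) / 2 * (v - u) \<le> h v - h u"
      if x: "x \<in> E p q" "0 < \<delta>" for x \<delta>
    proof -
      obtain u v where uv: "u < v" "u \<le> x" "x \<le> v" "v - u < \<delta>" "q < (g v - g u) / (v - u)"
        using x frequently_slope_straddle[of "\<lambda>t. q < t" g x \<delta>] unfolding E_def Q_def by blast
      then have "q * (v - u) < g v - g u" by (simp add: field_simps)
      then have "(q - p) / 2 * (v - u) \<le> h v - h u" by (simp add: h_def m_def field_simps)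
      then show ?thesis using uv by blast
    qed
    show "\<exists>u v. u < v \<and> u \<le> x \<and> x \<le> v \<and> v - u < \<delta> \<and> (q - p) / 2 * (v - u) \<le> - (h v - h u)"
      if x: "x \<in> E p q" "0 < \<delta>" for x \<delta>
    proof -
      obtain u v where uv: "u < v" "u \<le> x" "x \<le> v" "v - u < \<delta>" "(g v - g u) / (v - u) < p"
        using x frequently_slope_straddle[of "\<lambda>t. t < p" g x \<delta>] unfolding E_def Q_def by blast
      then have "g v - g u < p * (v - u)" by (simp add: field_simps)
      then have "(q - p) / 2 * (v - u) \<le> - (h v - h u)" by (simp add: h_def m_def field_simps)
      then show ?thesis using uv by blast
    qed
  qed
  have neg': "negligible E'"
  proof (rule negligible_unbounded_slopes[OF bv])
    show "E' \<subseteq> {c<..<d}" by (auto simp: E'_def)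
    show "\<exists>u v. u < v \<and> u \<le> x \<and> x \<le> v \<and> v - u < \<delta> \<and> M * (v - u) \<le> \<bar>g v - g u\<bar>"
      if x: "x \<in> E'" "0 < \<delta>" for x \<delta> M
    proof -
      obtain u v where uv: "u < v" "u \<le> x" "x \<le> v" "v - u < \<delta>" "M < \<bar>(g v - g u) / (v - u)\<bar>"
        using x frequently_slope_straddle[of "\<lambda>t. M < \<bar>t\<bar>" g x \<delta>] unfolding E'_def Q_def by blast
      then have "M * (v - u) \<le> \<bar>g v - g u\<bar>" by (simp add: field_simps)
      then show ?thesis using uv by blast
    qed
  qed
  have "negligible (\<Union>i \<in> {(p, q). p \<in> \<rat> \<and> q \<in> \<rat> \<and> p < q}. E (fst i) (snd i))"
  proof (rule negligible_countable_Union)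
    have "countable (\<rat> \<times> \<rat> :: (real \<times> real) set)" by (intro countable_SIGMA countable_rat)
    then have "countable {(p, q). p \<in> \<rat> \<and> q \<in> \<rat> \<and> (p::real) < q}"
      by (rule countable_subset[rotated]) auto
    then show "countable ((\<lambda>i. E (fst i) (snd i)) ` {(p, q). p \<in> \<rat> \<and> q \<in> \<rat> \<and> p < q})" by simp
  qed (use neg in auto)
  then have "negligible ((\<Union>i \<in> {(p, q). p \<in> \<rat> \<and> q \<in> \<rat> \<and> p < q}. E (fst i) (snd i)) \<union> E')"
    using neg' by simp
  then show ?thesis
  proof (rule negligible_subset, intro subsetI)
    fix x assume "x \<in> {x \<in> {c<..<d}. \<not> g differentiable at x}"
    then have x: "x \<in> {c<..<d}" "\<not> g differentiable at x" by auto
    have nolim: "\<not> (Q x \<longlongrightarrow> l) (at x)" for l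
    proof
      assume "(Q x \<longlongrightarrow> l) (at x)"
      then have "(g has_field_derivative l) (at x)" by (simp add: Q_def[abs_def] has_field_derivative_iff)
      then show False using x(2) by (auto simp: real_differentiable_def)
    qed
    show "x \<in> (\<Union>i \<in> {(p, q). p \<in> \<rat> \<and> q \<in> \<rat> \<and> p < q}. E (fst i) (snd i)) \<union> E'"
    proof (rule limit_or_two_values_or_unbounded[OF at_neq_bot nolim])
      fix p q assume "p \<in> \<rat>" "q \<in> \<rat>" "p < q" "\<exists>\<^sub>F y in at x. Q x y < p" "\<exists>\<^sub>F y in at x. q < Q x y"
      then show "x \<in> (\<Union>i \<in> {(p, q). p \<in> \<rat> \<and> q \<in> \<rat> \<and> p < q}. E (fst i) (snd i)) \<union> E'"
        using x by (intro UnI1 UN_I[of "(p, q)"]) (auto simp: E_def)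
    next
      assume "\<And>M. \<exists>\<^sub>F y in at x. M < \<bar>Q x y\<bar>"
      then show "x \<in> (\<Union>i \<in> {(p, q). p \<in> \<rat> \<and> q \<in> \<rat> \<and> p < q}. E (fst i) (snd i)) \<union> E'"
        using x by (auto simp: E'_def)
    qed
  qed
qed

lemma abs_cont_onD:
  assumes "abs_cont_on a b f" "0 < \<epsilon>"
  obtains \<delta> where "0 < \<delta>" "\<And>D. D division_of \<Union>D \<Longrightarrow> \<Union>D \<subseteq> {a..b} \<Longrightarrow>
    (\<Sum>K\<in>D. Sup K - Inf K) < \<delta> \<Longrightarrow> (\<Sum>K\<in>D. cmod (f (Sup K) - f (Inf K))) < \<epsilon>"
proof -
  obtain \<delta> where "0 < \<delta>" and \<delta>: "\<forall>\<D> T. \<D> division_of T \<and> T \<subseteq> {a..b} \<and> (\<Sum>K\<in>\<D>. Sup K - Inf K) < \<delta> \<longrightarrow>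
      (\<Sum>K\<in>\<D>. cmod (f (Sup K) - f (Inf K))) < \<epsilon>"
    using assms(1)[unfolded abs_cont_on_def, rule_format, OF assms(2)] by blast
  show thesis by (rule that[OF \<open>0 < \<delta>\<close> \<delta>[rule_format]]) (intro conjI)
qed

text \<open>With \<open>\<delta>\<close> belonging to the bound 1, the variation is below 1 on every
  subinterval shorter than \<open>\<delta>\<close>. Being null is a local property, so bounded
  variation on short intervals is enough. The real theorem is applied to both components, and the
  end points join the null set because differentiability at interior points is two-sided.\<close>

lemma abs_cont_on_differentiable_ae:
  assumes ac: "abs_cont_on a b f"
  shows "negligible {x \<in> {a..b}. \<not> f differentiable at x within {a..b}}"
proof -
  obtain \<delta> where \<delta>: "0 < \<delta>" "\<And>D. D division_of \<Union>D \<Longrightarrow> \<Union>D \<subseteq> {a..b} \<Longrightarrow>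
    (\<Sum>K\<in>D. Sup K - Inf K) < \<delta> \<Longrightarrow> (\<Sum>K\<in>D. cmod (f (Sup K) - f (Inf K))) < 1"
    by (rule abs_cont_onD[OF ac zero_less_one]) blast
  define N where "N = {x \<in> {a<..<b}. \<not> f differentiable at x}"
  have "\<exists>U. openin (top_of_set N) U \<and> x \<in> U \<and> negligible U" if x: "x \<in> N" for x
  proof -
    define c where "c = max a (x - \<delta> / 3)"
    define d where "d = min b (x + \<delta> / 3)"
    have cd: "c < x" "x < d" "d - c < \<delta>" "{c..d} \<subseteq> {a..b}"
      using x \<delta>(1) by (auto simp: c_def d_def N_def max_def min_def)
    have bv: "(\<Sum>K\<in>D. cmod (f (Sup K) - f (Inf K))) < 1" if D: "D division_of \<Union>D" "\<Union>D \<subseteq> {c..d}" for D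

    proof (rule \<delta>(2)[OF D(1)])
      show "\<Union>D \<subseteq> {a..b}" using D(2) cd(4) by blast
      show "(\<Sum>K\<in>D. Sup K - Inf K) < \<delta>" using sum_lengths_le(1)[OF _ D] cd by linarith
    qed
    have comp: "negligible {x \<in> {c<..<d}. \<not> (\<lambda>x. f x \<bullet> i) differentiable at x}" if i: "i \<in> Basis" for i
    proof (rule bounded_variation_differentiable_ae)
      fix D assume D: "D division_of \<Union>D" "\<Union>D \<subseteq> {c..d}"
      have "(\<Sum>K\<in>D. \<bar>f (Sup K) \<bullet> i - f (Inf K) \<bullet> i\<bar>) \<le> (\<Sum>K\<in>D. cmod (f (Sup K) - f (Inf K)))"
        using i by (intro sum_mono) (metis Basis_le_norm inner_diff_left)
      then show "(\<Sum>K\<in>D. \<bar>f (Sup K) \<bullet> i - f (Inf K) \<bullet> i\<bar>) \<le> 1" using bv[OF D] by linarith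
    qed (use cd in simp)
    have "N \<inter> {c<..<d} \<subseteq> (\<Union>i\<in>Basis. {x \<in> {c<..<d}. \<not> (\<lambda>x. f x \<bullet> i) differentiable at x})"
      using differentiable_componentwise_within[of f _ UNIV] by (auto simp: N_def)
    moreover have "negligible (\<Union>i\<in>Basis::complex set. {x \<in> {c<..<d}. \<not> (\<lambda>x. f x \<bullet> i) differentiable at x})"
      using comp by (intro negligible_Union) auto
    ultimately have "negligible (N \<inter> {c<..<d})" by (rule negligible_subset[rotated])
    moreover have "openin (top_of_set N) (N \<inter> {c<..<d})" by (intro openin_open_Int) simp
    ultimately show ?thesis using x cd by (intro exI[of _ "N \<inter> {c<..<d}"]) auto
  qed
  then have "negligible N" using locally_negligible_alt by blast
  then have "negligible (N \<union> {a, b})" by simp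
  then show ?thesis
  proof (rule negligible_subset, intro subsetI)
    fix x assume "x \<in> {x \<in> {a..b}. \<not> f differentiable at x within {a..b}}"
    then show "x \<in> N \<union> {a, b}" using differentiable_at_withinI[of f x "{a..b}"] by (force simp: N_def)
  qed
qed

section \<open>Absolutely continuous functions\<close>

lemma measure_Union_division:
  fixes D :: "real set set"
  assumes D: "D division_of S"
  shows "S \<in> lmeasurable" "measure lebesgue S = (\<Sum>K\<in>D. Sup K - Inf K)"
proof -
  have fin: "finite D" using D by (rule division_of_finite)
  have K: "\<exists>u v. u \<le> v \<and> K = {u..v}" if "K \<in> D" for K
    using division_ofD(3,4)[OF D that] by force
  have S: "S = \<Union>D" using D by auto
  have lm: "K \<in> lmeasurable" if "K \<in> D" for K using K[OF that] by auto
  show "S \<in> lmeasurable" unfolding S using fin lm by (intro fmeasurable.finite_Union) auto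
  have "measure lebesgue (\<Union>D) = (\<Sum>K\<in>D. measure lebesgue K)"
  proof (rule measure_negligible_finite_Union[OF fin lm])
    show "pairwise (\<lambda>K L. negligible (K \<inter> L)) D"
    proof (rule pairwiseI)
      fix K L assume KL: "K \<in> D" "L \<in> D" "K \<noteq> L"
      then obtain u v u' v' where uv: "K = {u..v}" "L = {u'..v'}" using K by meson
      have "interior K \<inter> interior L = {}" using KL D by blast
      then have "K \<inter> L \<subseteq> {u, v, u', v'}" using uv by fastforce
      then show "negligible (K \<inter> L)" by (rule negligible_subset[rotated]) (simp add: negligible_finite)
    qed
  qed
  also have "\<dots> = (\<Sum>K\<in>D. Sup K - Inf K)"
  proof (rule sum.cong[OF refl])
    fix L assume "L \<in> D"
    from K[OF this] show "measure lebesgue L = Sup L - Inf L" by auto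
  qed
  finally show "measure lebesgue S = (\<Sum>K\<in>D. Sup K - Inf K)" by (simp add: S)
qed

text \<open>
  The gauge is the usual one at points of differentiability. Intervals tagged in \<open>N\<close> are
  confined to an open set of small measure, where absolute continuity controls the increments.
\<close>

lemma abs_cont_on_fundamental_theorem:
  fixes f f' :: "real \<Rightarrow> complex"
  assumes "a \<le> b" and ac: "abs_cont_on a b f" and N: "negligible N"
    and deriv: "\<And>x. x \<in> {a..b} - N \<Longrightarrow> (f has_vector_derivative f' x) (at x within {a..b})"
  shows "(f' has_integral (f b - f a)) {a..b}"
proof -
  \<comment> \<open>Setting the integrand to 0 on \<open>N\<close> leaves the integral alone and
    removes its values from the Riemann sums over intervals tagged in \<open>N\<close>; only
    increments of \<open>f\<close> remain there.\<close>
  define h where "h x = (if x \<in> N then 0 else f' x)" for x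
  have "(h has_integral (f b - f a)) (cbox a b)"
    unfolding has_integral
  proof (intro allI impI)
    fix e :: real assume "0 < e"
    \<comment> \<open>The summand 1 keeps the denominator positive for \<open>a = b\<close> and
      makes \<open>e1 * (b - a)\<close> strictly smaller than \<open>e / 2\<close>.\<close>
    define e1 where "e1 = e / (2 * (b - a + 1))"
    have e1: "0 < e1" "e1 * (b - a) < e / 2"
      using \<open>0 < e\<close> \<open>a \<le> b\<close> by (auto simp: e1_def field_simps)
    obtain \<delta> where \<delta>: "0 < \<delta>" "\<And>D. D division_of \<Union>D \<Longrightarrow> \<Union>D \<subseteq> {a..b} \<Longrightarrow>
      (\<Sum>K\<in>D. Sup K - Inf K) < \<delta> \<Longrightarrow> (\<Sum>K\<in>D. cmod (f (Sup K) - f (Inf K))) < e / 2"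
      by (rule abs_cont_onD[OF ac half_gt_zero[OF \<open>0 < e\<close>]]) blast
    obtain U where U: "open U" "N \<subseteq> U" "U \<in> lmeasurable" "measure lebesgue U < \<delta>"
    proof -
      have "N \<in> lmeasurable" using N by (rule negligible_imp_measurable)
      then obtain T where "open T" "N \<subseteq> T" "(T - N) \<in> lmeasurable" "emeasure lebesgue (T - N) < ennreal \<delta>"
        using sets_lebesgue_outer_open[of N \<delta>] \<delta>(1) fmeasurableD by blast
      moreover from this have "T = N \<union> (T - N)" by blast
      ultimately have "T \<in> lmeasurable" using \<open>N \<in> lmeasurable\<close> by (metis fmeasurable.Un)
      have "measure lebesgue T \<le> measure lebesgue N + measure lebesgue (T - N)"
        using \<open>T = _\<close> \<open>N \<in> lmeasurable\<close> \<open>T - N \<in> lmeasurable\<close>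
        by (metis fmeasurableD measure_Un_le)
      also have "\<dots> < \<delta>"
        using N \<open>emeasure _ _ < _\<close> \<open>T - N \<in> lmeasurable\<close> \<delta>(1)
        by (simp add: negligible_imp_measure0 emeasure_eq_measure2 ennreal_less_iff)
      finally show thesis using that \<open>open T\<close> \<open>N \<subseteq> T\<close> \<open>T \<in> lmeasurable\<close> by blast
    qed
    have "\<exists>r>0. (x \<in> N \<longrightarrow> ball x r \<subseteq> U) \<and> (x \<in> {a..b} - N \<longrightarrow>
         (\<forall>y\<in>{a..b}. norm (y-x) < r \<longrightarrow> norm (f y - f x - (y-x) *\<^sub>R f' x) \<le> e1 * norm (y-x)))" for x
    proof (cases "x \<in> N")
      case True
      then show ?thesis using U by (metis DiffD2 open_contains_ball subsetD)
    next
      case False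
      then show ?thesis
        using deriv[of x] e1(1) unfolding has_vector_derivative_def has_derivative_within_alt
        by (cases "x \<in> {a..b}") (auto intro: exI[of _ 1])
    qed
    then obtain r where r: "\<And>x. 0 < r x" "\<And>x. x \<in> N \<Longrightarrow> ball x (r x) \<subseteq> U"
      "\<And>x y. x \<in> {a..b} - N \<Longrightarrow> y \<in> {a..b} \<Longrightarrow> norm (y-x) < r x \<Longrightarrow>
          norm (f y - f x - (y-x) *\<^sub>R f' x) \<le> e1 * norm (y-x)" by metis
    show "\<exists>\<gamma>. gauge \<gamma> \<and> (\<forall>p. p tagged_division_of cbox a b \<and> \<gamma> fine p \<longrightarrow>
        norm ((\<Sum>(x, K)\<in>p. measure lborel K *\<^sub>R h x) - (f b - f a)) < e)"
    proof (intro exI conjI allI impI)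
      show "gauge (\<lambda>x. ball x (r x))" using r(1) by (rule gauge_ball_dependent[rule_format])
      fix p assume p: "p tagged_division_of cbox a b \<and> (\<lambda>x. ball x (r x)) fine p"
      then have ptag: "p tagged_division_of {a..b}" and fine: "\<And>x K. (x, K) \<in> p \<Longrightarrow> K \<subseteq> ball x (r x)"
        by auto
      have finp: "finite p" using ptag by (rule tagged_division_of_finite)
      define pN where "pN = {xK \<in> p. fst xK \<in> N}"
      define t where "t xK = (case xK of (x, K) \<Rightarrow> measure lborel K *\<^sub>R h x - (f (Sup K) - f (Inf K)))" for xK
      have K: "\<exists>u v. u \<le> x \<and> x \<le> v \<and> K = {u..v} \<and> {u..v} \<subseteq> {a..b}" if "(x, K) \<in> p" for x K
        using tagged_division_ofD(2,3,4)[OF ptag that] by force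
      have good: "norm (t (x, K)) \<le> e1 * (Sup K - Inf K)" if xK: "(x, K) \<in> p - pN" for x K
      proof -
        obtain u v where uv: "u \<le> x" "x \<le> v" "K = {u..v}" "{u..v} \<subseteq> {a..b}" using K xK by blast
        have "x \<notin> N" using xK by (auto simp: pN_def)
        \<comment> \<open>Splitting the increment at the tag \<open>x\<close> gives two errors of
          linear approximation at \<open>x\<close>. As \<open>u \<le> x \<le> v\<close>, the two
          distances add up to the length of \<open>K\<close>.\<close>
        have "norm (t (x, K)) = norm ((f u - f x - (u - x) *\<^sub>R f' x) - (f v - f x - (v - x) *\<^sub>R f' x))"
          using uv \<open>x \<notin> N\<close> by (simp add: t_def h_def algebra_simps)
        also have "\<dots> \<le> norm (f u - f x - (u - x) *\<^sub>R f' x) + norm (f v - f x - (v - x) *\<^sub>R f' x)"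
          by (rule norm_triangle_ineq4)
        also have "\<dots> \<le> e1 * norm (u - x) + e1 * norm (v - x)"
        proof -
          have "u \<in> ball x (r x)" "v \<in> ball x (r x)" 
            using subsetD[OF fine[of x K]] xK uv by (simp_all add: subset_iff)
          then show ?thesis
            using uv \<open>x \<notin> N\<close> by (intro add_mono r(3)) (auto simp: dist_real_def)
        qed
        also have "\<dots> = e1 * (Sup K - Inf K)" using uv by (simp add: algebra_simps)
        finally show ?thesis .
      qed
      have "norm (sum t (p - pN)) \<le> (\<Sum>xK\<in>p - pN. e1 * (Sup (snd xK) - Inf (snd xK)))"
        by (rule sum_norm_le) (use good in auto)
      also have "\<dots> \<le> (\<Sum>xK\<in>p. e1 * (Sup (snd xK) - Inf (snd xK)))"
        using finp K e1(1) by (intro sum_mono2) fastforce+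
      also have "\<dots> = e1 * (b - a)"
        using additive_tagged_division_1[OF \<open>a \<le> b\<close> ptag, of "\<lambda>x. x"]
        by (simp add: sum_distrib_left[symmetric] case_prod_unfold)
      finally have s1: "norm (sum t (p - pN)) < e / 2" using e1(2) by simp
      have tp: "pN tagged_division_of \<Union>(snd ` pN)"
        by (rule tagged_partial_division_of_Union_self[OF tagged_partial_division_subset])
          (use ptag in \<open>auto simp: pN_def tagged_division_of_def\<close>)
      define D where "D = snd ` pN"
      have D: "D division_of \<Union>D" unfolding D_def using tp by (rule division_of_tagged_division)
      have Dsub: "\<Union>D \<subseteq> {a..b}" using K by (fastforce simp: D_def pN_def)
      have DU: "\<Union>D \<subseteq> U" using fine r(2) by (fastforce simp: D_def pN_def)
      have len: "(\<Sum>K\<in>D. Sup K - Inf K) < \<delta>"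
      proof -
        have "(\<Sum>K\<in>D. Sup K - Inf K) = measure lebesgue (\<Union>D)"
          using measure_Union_division[OF D] by simp
        also have "\<dots> \<le> measure lebesgue U"
          using measure_Union_division(1)[OF D] by (intro measure_mono_fmeasurable DU U(3) fmeasurableD)
        finally show ?thesis using U(4) by simp
      qed
      \<comment> \<open>Different tags may share a degenerate interval, so the passage from tagged
        intervals to the set \<open>D\<close> asks for a summand that vanishes whenever the interior
        is empty. The empty interval, with its unspecified \<open>Sup\<close> and
        \<open>Inf\<close>, is set to 0 by hand.\<close>
      define w where "w K = (if K = {} then 0 else norm (f (Sup K) - f (Inf K)))" for K :: "real set"
      have "norm (sum t pN) \<le> (\<Sum>(x, K)\<in>pN. w K)"
        by (rule sum_norm_le) (use K in \<open>fastforce simp: t_def h_def pN_def w_def norm_minus_commute\<close>)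
      also have "\<dots> = sum w D"
        unfolding D_def
      proof (rule sum.over_tagged_division_lemma[OF tp])
        fix u v :: real assume "box u v = {}"
        then show "w (cbox u v) = 0" by (cases "u = v") (auto simp: w_def)
      qed
      also have "\<dots> = (\<Sum>K\<in>D. norm (f (Sup K) - f (Inf K)))"
        using division_ofD(3)[OF D] by (intro sum.cong) (auto simp: w_def)
      also have "\<dots> < e / 2" by (rule \<delta>(2)[OF D Dsub len])
      finally have s2: "norm (sum t pN) < e / 2" .
      have "(\<Sum>(x, K)\<in>p. measure lborel K *\<^sub>R h x) - (f b - f a) = sum t p"
        using additive_tagged_division_1[OF \<open>a \<le> b\<close> ptag, of f]
        by (simp add: t_def case_prod_unfold sum_subtractf)
      also have "\<dots> = sum t (p - pN) + sum t pN" using finp by (intro sum.subset_diff) (auto simp: pN_def)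
      also have "norm \<dots> < e" using s1 s2 norm_triangle_ineq[of "sum t (p - pN)" "sum t pN"] by linarith
      finally show "norm ((\<Sum>(x, K)\<in>p. measure lborel K *\<^sub>R h x) - (f b - f a)) < e" .
    qed
  qed
  then show ?thesis
    by (intro has_integral_spike[OF N, of _ f' h]) (auto simp: h_def)
qed

lemma abs_cont_on_continuous:
  assumes "abs_cont_on a b f"
  shows "continuous_on {a..b} f"
  unfolding continuous_on_iff
proof (intro ballI allI impI)
  fix x \<epsilon> :: real assume x: "x \<in> {a..b}" and "0 < \<epsilon>"
  obtain \<delta> where \<delta>: "0 < \<delta>" "\<And>D. D division_of \<Union>D \<Longrightarrow> \<Union>D \<subseteq> {a..b} \<Longrightarrow>
    (\<Sum>K\<in>D. Sup K - Inf K) < \<delta> \<Longrightarrow> (\<Sum>K\<in>D. cmod (f (Sup K) - f (Inf K))) < \<epsilon>"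
    by (rule abs_cont_onD[OF assms \<open>0 < \<epsilon>\<close>]) blast
  have "dist (f y) (f x) < \<epsilon>" if y: "y \<in> {a..b}" "dist y x < \<delta>" for y
  proof -
    define u where "u = min x y"
    define v where "v = max x y"
    have uv: "u \<le> v" "{u..v} \<subseteq> {a..b}" "v - u < \<delta>"
      using x y by (auto simp: u_def v_def dist_real_def)
    then have "(\<Sum>K\<in>{{u..v}}. cmod (f (Sup K) - f (Inf K))) < \<epsilon>"
      using division_of_self[of u v] by (intro \<delta>(2)) auto
    then show ?thesis
      using uv(1) by (auto simp: u_def v_def min_def max_def dist_norm norm_minus_commute split: if_splits)
  qed
  then show "\<exists>d>0. \<forall>y\<in>{a..b}. dist y x < d \<longrightarrow> dist (f y) (f x) < \<epsilon>" using \<delta>(1) by blast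
qed

lemma division_member_endpoints:
  fixes T :: "real set"
  assumes "D division_of T" "K \<in> D"
  shows "Inf K \<le> Sup K" "Inf K \<in> T" "Sup K \<in> T"
proof -
  obtain u v where uv: "K = cbox u v" using division_ofD(4)[OF assms] by blast
  then have "u \<le> v" using division_ofD(3)[OF assms] by auto
  then show "Inf K \<le> Sup K" "Inf K \<in> T" "Sup K \<in> T" using uv division_ofD(2)[OF assms] by auto
qed

text \<open>Absolute continuity only sees increments, so a bound on increments transfers it. This
  serves differences, products, functions that agree on the interval and, with the identity map for
  comparison, continuously differentiable functions.\<close>

lemma abs_cont_on_dominated:
  assumes f: "abs_cont_on a b f" and g: "abs_cont_on a b g"
    and h: "\<And>u v. u \<in> {a..b} \<Longrightarrow> v \<in> {a..b} \<Longrightarrow> cmod (h v - h u) \<le> C * (cmod (f v - f u) + cmod (g v - g u))"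
  shows "abs_cont_on a b h"
  unfolding abs_cont_on_def
proof (intro allI impI)
  fix \<epsilon> :: real assume "0 < \<epsilon>"
  define \<eta> where "\<eta> = \<epsilon> / (2 * (\<bar>C\<bar> + 1))"
  have \<eta>: "0 < \<eta>" using \<open>0 < \<epsilon>\<close> by (simp add: \<eta>_def)
  obtain \<delta>1 where \<delta>1: "0 < \<delta>1" "\<And>D. D division_of \<Union>D \<Longrightarrow> \<Union>D \<subseteq> {a..b} \<Longrightarrow>
    (\<Sum>K\<in>D. Sup K - Inf K) < \<delta>1 \<Longrightarrow> (\<Sum>K\<in>D. cmod (f (Sup K) - f (Inf K))) < \<eta>"
    by (rule abs_cont_onD[OF f \<eta>]) blast
  obtain \<delta>2 where \<delta>2: "0 < \<delta>2" "\<And>D. D division_of \<Union>D \<Longrightarrow> \<Union>D \<subseteq> {a..b} \<Longrightarrow>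
    (\<Sum>K\<in>D. Sup K - Inf K) < \<delta>2 \<Longrightarrow> (\<Sum>K\<in>D. cmod (g (Sup K) - g (Inf K))) < \<eta>"
    by (rule abs_cont_onD[OF g \<eta>]) blast
  have "(\<Sum>K\<in>D. cmod (h (Sup K) - h (Inf K))) < \<epsilon>"
    if D: "D division_of T \<and> T \<subseteq> {a..b} \<and> (\<Sum>K\<in>D. Sup K - Inf K) < min \<delta>1 \<delta>2" for D T
  proof -
    have T: "T = \<Union>D" using D by blast
    have ends: "Sup K \<in> {a..b} \<and> Inf K \<in> {a..b}" if "K \<in> D" for K
      using D division_member_endpoints(2,3)[of D T, OF _ that] by blast
    define F where "F = (\<Sum>K\<in>D. cmod (f (Sup K) - f (Inf K)))"
    define G where "G = (\<Sum>K\<in>D. cmod (g (Sup K) - g (Inf K)))"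
    have FG: "F < \<eta>" "G < \<eta>" "0 \<le> F" "0 \<le> G"
      using \<delta>1(2)[of D] \<delta>2(2)[of D] D T by (auto simp: F_def G_def intro: sum_nonneg)
    have "(\<Sum>K\<in>D. cmod (h (Sup K) - h (Inf K))) \<le>
        (\<Sum>K\<in>D. C * (cmod (f (Sup K) - f (Inf K)) + cmod (g (Sup K) - g (Inf K))))"
      using ends by (intro sum_mono h) auto
    also have "\<dots> = C * (F + G)" by (simp add: F_def G_def sum.distrib flip: sum_distrib_left)
    also have "\<dots> \<le> (\<bar>C\<bar> + 1) * (F + G)" using FG by (intro mult_right_mono) auto
    also have "\<dots> < (\<bar>C\<bar> + 1) * (\<eta> + \<eta>)" using FG by (intro mult_strict_left_mono) auto
    also have "\<dots> = \<epsilon>" by (simp add: \<eta>_def divide_simps add_nonneg_eq_0_iff)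
    finally show ?thesis .
  qed
  then show "\<exists>\<delta>>0. \<forall>D T. D division_of T \<and> T \<subseteq> {a..b} \<and> (\<Sum>K\<in>D. Sup K - Inf K) < \<delta> \<longrightarrow>
      (\<Sum>K\<in>D. cmod (h (Sup K) - h (Inf K))) < \<epsilon>" using \<delta>1(1) \<delta>2(1) by (intro exI[of _ "min \<delta>1 \<delta>2"]) auto
qed

lemma abs_cont_on_cong:
  assumes "abs_cont_on a b f" "\<And>x. x \<in> {a..b} \<Longrightarrow> g x = f x"
  shows "abs_cont_on a b g"
  by (rule abs_cont_on_dominated[OF assms(1,1), of _ 1]) (simp add: assms(2))

lemma abs_cont_on_of_real: "abs_cont_on a b complex_of_real"
  unfolding abs_cont_on_def
proof (intro allI impI)
  fix \<epsilon> :: real assume "0 < \<epsilon>"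
  have "(\<Sum>K\<in>D. cmod (complex_of_real (Sup K) - complex_of_real (Inf K))) = (\<Sum>K\<in>D. Sup K - Inf K)"
    if D: "D division_of T" for D and T :: "real set"
  proof (rule sum.cong[OF refl])
    fix K assume "K \<in> D"
    then have "Inf K \<le> Sup K" by (rule division_member_endpoints(1)[OF D])
    then show "cmod (complex_of_real (Sup K) - complex_of_real (Inf K)) = Sup K - Inf K"
      by (metis abs_of_nonneg diff_ge_0_iff_ge norm_of_real of_real_diff)
  qed
  then show "\<exists>\<delta>>0. \<forall>D T. D division_of T \<and> T \<subseteq> {a..b} \<and> (\<Sum>K\<in>D. Sup K - Inf K) < \<delta> \<longrightarrow>
      (\<Sum>K\<in>D. cmod (complex_of_real (Sup K) - complex_of_real (Inf K))) < \<epsilon>"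
    using \<open>0 < \<epsilon>\<close> by (intro exI[of _ \<epsilon>]) auto
qed

lemma abs_cont_on_C1:
  assumes "\<And>x. x \<in> {a..b} \<Longrightarrow> (w has_vector_derivative w' x) (at x within {a..b})" "continuous_on {a..b} w'"
  shows "abs_cont_on a b w"
proof -
  obtain B where B: "\<And>x. x \<in> {a..b} \<Longrightarrow> cmod (w' x) \<le> B"
    using compact_imp_bounded[OF compact_continuous_image[OF assms(2) compact_Icc]]
    unfolding bounded_iff by (metis imageI)
  have "cmod (w v - w u) \<le> B * (cmod (complex_of_real v - complex_of_real u) + cmod (complex_of_real v - complex_of_real u))"
    if uv: "u \<in> {a..b}" "v \<in> {a..b}" for u v
  proof -
    have "0 \<le> B" using B[OF uv(1)] norm_ge_zero order_trans by blast
    have "cmod (w v - w u) \<le> B * norm (v - u)"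
    proof (rule differentiable_bound[OF convex_real_interval(5)[of a b]])
      show "(w has_derivative (\<lambda>h. h *\<^sub>R w' x)) (at x within {a..b})" if "x \<in> {a..b}" for x
        using assms(1)[OF that] by (simp add: has_vector_derivative_def)
      show "onorm (\<lambda>h. h *\<^sub>R w' x) \<le> B" if "x \<in> {a..b}" for x
        using B[OF that] by (intro onorm_le) (auto simp: mult.commute[of B] intro!: mult_left_mono)
    qed (use uv in auto)
    also have "\<dots> = B * cmod (complex_of_real v - complex_of_real u)" by (metis norm_of_real of_real_diff real_norm_def)
    also have "\<dots> \<le> B * (cmod (complex_of_real v - complex_of_real u) + cmod (complex_of_real v - complex_of_real u))"
      using \<open>0 \<le> B\<close> by (intro mult_left_mono) auto
    finally show ?thesis .
  qed
  then show ?thesis by (rule abs_cont_on_dominated[OF abs_cont_on_of_real abs_cont_on_of_real])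
qed

lemma abs_cont_on_diff:
  assumes "abs_cont_on a b f" "abs_cont_on a b g"
  shows "abs_cont_on a b (\<lambda>x. f x - g x)"
proof (rule abs_cont_on_dominated[OF assms, of _ 1])
  fix u v
  have "f v - g v - (f u - g u) = (f v - f u) - (g v - g u)" by simp
  then show "cmod (f v - g v - (f u - g u)) \<le> 1 * (cmod (f v - f u) + cmod (g v - g u))"
    by (metis mult_1 norm_triangle_ineq4)
qed

lemma abs_cont_on_mult:
  assumes f: "abs_cont_on a b f" and g: "abs_cont_on a b g"
  shows "abs_cont_on a b (\<lambda>x. f x * g x)"
proof -
  have "bounded (f ` {a..b} \<union> g ` {a..b})"
    using f g by (auto intro!: compact_imp_bounded compact_continuous_image abs_cont_on_continuous)
  then obtain B where "\<And>x. x \<in> f ` {a..b} \<union> g ` {a..b} \<Longrightarrow> cmod x \<le> B" unfolding bounded_iff by blast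
  then have B: "\<And>x. x \<in> {a..b} \<Longrightarrow> cmod (f x) \<le> B" "\<And>x. x \<in> {a..b} \<Longrightarrow> cmod (g x) \<le> B" by auto
  show ?thesis
  proof (rule abs_cont_on_dominated[OF f g, of _ B])
    fix u v assume uv: "u \<in> {a..b}" "v \<in> {a..b}"
    have "f v * g v - f u * g u = (f v - f u) * g v + f u * (g v - g u)" by (simp add: algebra_simps)
    also have "cmod \<dots> \<le> cmod (f v - f u) * cmod (g v) + cmod (f u) * cmod (g v - g u)"
      by (metis norm_mult norm_triangle_ineq)
    also have "\<dots> \<le> cmod (f v - f u) * B + B * cmod (g v - g u)"
      using B uv by (intro add_mono mult_left_mono mult_right_mono) auto
    finally show "cmod (f v * g v - f u * g u) \<le> B * (cmod (f v - f u) + cmod (g v - g u))"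
      by (simp add: algebra_simps)
  qed
qed

section \<open>Square integrable functions\<close>

lemma finite_measure_lebesgue_on_Icc: "finite_measure (lebesgue_on {a..b::real})"
  by (rule finite_measure_lebesgue_on) simp

lemma L2_mult_integrable:
  assumes "f \<in> L2_space a b" "g \<in> L2_space a b"
  shows "integrable (lebesgue_on {a..b}) (\<lambda>x. f x * cnj (g x))"
proof (rule Bochner_Integration.integrable_bound)
  show "integrable (lebesgue_on {a..b}) (\<lambda>x. (cmod (f x))\<^sup>2 + (cmod (g x))\<^sup>2)"
    using assms by (auto simp: L2_space_def)
  show "(\<lambda>x. f x * cnj (g x)) \<in> borel_measurable (lebesgue_on {a..b})"
    using assms by (auto simp: L2_space_def intro!: borel_measurable_times borel_measurable_continuous_on[OF continuous_on_cnj[OF continuous_on_id]])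
  have "norm (f x * cnj (g x)) \<le> norm ((cmod (f x))\<^sup>2 + (cmod (g x))\<^sup>2)" for x
  proof -
    have "2 * (cmod (f x) * cmod (g x)) \<le> (cmod (f x))\<^sup>2 + (cmod (g x))\<^sup>2"
      using sum_squares_bound[of "cmod (f x)" "cmod (g x)"] by simp
    moreover have "0 \<le> cmod (f x) * cmod (g x)" by simp
    ultimately have "cmod (f x) * cmod (g x) \<le> (cmod (f x))\<^sup>2 + (cmod (g x))\<^sup>2" by linarith
    then show ?thesis by (simp add: norm_mult)
  qed
  then show "AE x in lebesgue_on {a..b}. norm (f x * cnj (g x)) \<le> norm ((cmod (f x))\<^sup>2 + (cmod (g x))\<^sup>2)"
    by simp
qed

lemma L2_bounded:
  assumes "f \<in> borel_measurable (lebesgue_on {a..b})" "\<And>x. x \<in> {a..b} \<Longrightarrow> cmod (f x) \<le> B"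
  shows "f \<in> L2_space a b"
proof -
  interpret finite_measure "lebesgue_on {a..b}" by (rule finite_measure_lebesgue_on_Icc)
  have "integrable (lebesgue_on {a..b}) (\<lambda>x. (cmod (f x))\<^sup>2)"
  proof (rule integrable_const_bound[where B = "B\<^sup>2"])
    show "AE x in lebesgue_on {a..b}. norm ((cmod (f x))\<^sup>2) \<le> B\<^sup>2"
      using assms(2) by (intro AE_I2) (auto intro!: power_mono)
  qed (use assms(1) in measurable)
  then show ?thesis using assms(1) by (simp add: L2_space_def)
qed

lemma L2_continuous:
  assumes "continuous_on {a..b} f"
  shows "f \<in> L2_space a b"
proof -
  obtain B where "\<And>x. x \<in> {a..b} \<Longrightarrow> cmod (f x) \<le> B"
    using compact_imp_bounded[OF compact_continuous_image[OF assms compact_Icc]]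
    unfolding bounded_iff by (metis imageI)
  then show ?thesis
    by (intro L2_bounded[where B = B] continuous_imp_measurable_on_sets_lebesgue assms) auto
qed

lemma L2_diff:
  assumes "f \<in> L2_space a b" "g \<in> L2_space a b"
  shows "(\<lambda>x. f x - g x) \<in> L2_space a b"
proof -
  have m: "(\<lambda>x. f x - g x) \<in> borel_measurable (lebesgue_on {a..b})"
    using assms by (auto simp: L2_space_def)
  have "integrable (lebesgue_on {a..b}) (\<lambda>x. (cmod (f x - g x))\<^sup>2)"
  proof (rule Bochner_Integration.integrable_bound)
    show "integrable (lebesgue_on {a..b}) (\<lambda>x. 2 * ((cmod (f x))\<^sup>2 + (cmod (g x))\<^sup>2))"
      using assms by (auto simp: L2_space_def)
    have "norm ((cmod (f x - g x))\<^sup>2) \<le> norm (2 * ((cmod (f x))\<^sup>2 + (cmod (g x))\<^sup>2))" for x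
    proof -
      have "(cmod (f x - g x))\<^sup>2 \<le> (cmod (f x) + cmod (g x))\<^sup>2"
        by (intro power_mono norm_triangle_ineq4) simp
      also have "\<dots> \<le> 2 * ((cmod (f x))\<^sup>2 + (cmod (g x))\<^sup>2)"
        using sum_squares_bound[of "cmod (f x)" "cmod (g x)"] by (simp add: power2_sum)
      finally show ?thesis by simp
    qed
    then show "AE x in lebesgue_on {a..b}. norm ((cmod (f x - g x))\<^sup>2) \<le> norm (2 * ((cmod (f x))\<^sup>2 + (cmod (g x))\<^sup>2))"
      by simp
  qed (use m in measurable)
  then show ?thesis using m by (simp add: L2_space_def)
qed

lemma L2_scale:
  assumes "f \<in> L2_space a b"
  shows "(\<lambda>x. c * f x) \<in> L2_space a b"
  using assms by (auto simp: L2_space_def norm_mult power_mult_distrib)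

lemma L2_add:
  assumes "f \<in> L2_space a b" "g \<in> L2_space a b"
  shows "(\<lambda>x. f x + g x) \<in> L2_space a b"
  using L2_diff[OF assms(1) L2_scale[OF assms(2), of "-1"]] by simp

lemma L2_sum:
  assumes "\<And>i. i \<in> I \<Longrightarrow> f i \<in> L2_space a b"
  shows "(\<lambda>x. \<Sum>i\<in>I. f i x) \<in> L2_space a b"
  using assms
  by (induction I rule: infinite_finite_induct)
    (auto intro: L2_add L2_continuous[OF continuous_on_const])

lemma AE_lebesgue_onI:
  assumes "negligible N" "S \<in> sets lebesgue" "\<And>x. x \<in> S - N \<Longrightarrow> P x"
  shows "AE x in lebesgue_on S. P x"
proof -
  have "AE x in lebesgue. x \<notin> N"
    using assms(1) by (simp add: AE_not_in negligible_iff_null_sets)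
  then have "AE x in lebesgue. x \<in> S \<longrightarrow> P x" by eventually_elim (use assms(3) in auto)
  then show ?thesis using assms(2) by (subst AE_restrict_space_iff) auto
qed

text \<open>Top derivatives are identified only off a null set, on which
  \<open>vector_derivative\<close> may return anything. Lebesgue measurability and integrability
  survive changes on null sets.\<close>

lemma L2_cong_ae:
  assumes "f \<in> L2_space a b" "negligible N" "\<And>x. x \<in> {a..b} - N \<Longrightarrow> g x = f x"
  shows "g \<in> L2_space a b"
proof -
  have ae: "AE x in lebesgue_on {a..b}. f x = g x"
    using assms by (intro AE_lebesgue_onI[of N]) auto
  have g: "g \<in> borel_measurable (lebesgue_on {a..b})"
    using measurable_on_spike[of f "{a..b}" N g] assms
    by (simp add: measurable_on_iff_borel_measurable L2_space_def)
  have "integrable (lebesgue_on {a..b}) (\<lambda>x. (cmod (g x))\<^sup>2)"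
  proof (rule integrable_cong_AE_imp)
    show "integrable (lebesgue_on {a..b}) (\<lambda>x. (cmod (f x))\<^sup>2)" using assms by (simp add: L2_space_def)
    show "AE x in lebesgue_on {a..b}. (cmod (f x))\<^sup>2 = (cmod (g x))\<^sup>2" using ae by eventually_elim simp
  qed (use g in measurable)
  then show ?thesis using g by (simp add: L2_space_def)
qed

lemma L2_inner_cong:
  assumes "\<And>x. x \<in> {a..b} \<Longrightarrow> f x = f' x" "\<And>x. x \<in> {a..b} \<Longrightarrow> g x = g' x"
  shows "L2_inner a b f g = L2_inner a b f' g'"
  unfolding L2_inner_def by (rule Bochner_Integration.integral_cong) (use assms in auto)

lemma L2_inner_cnj: "L2_inner a b g f = cnj (L2_inner a b f g)"
  unfolding L2_inner_def Bochner_Integration.integral_cnj[symmetric] by (simp add: mult.commute)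

lemma L2_inner_scale_left: "L2_inner a b (\<lambda>x. c * f x) g = c * L2_inner a b f g"
  by (simp add: L2_inner_def mult.assoc)

lemma L2_inner_scale_right: "L2_inner a b f (\<lambda>x. c * g x) = cnj c * L2_inner a b f g"
  using L2_inner_scale_left[of a b c g f] L2_inner_cnj by (metis complex_cnj_mult)

lemma L2_inner_diff_left:
  assumes "f \<in> L2_space a b" "g \<in> L2_space a b" "h \<in> L2_space a b"
  shows "L2_inner a b (\<lambda>x. f x - g x) h = L2_inner a b f h - L2_inner a b g h"
  using L2_mult_integrable[OF assms(1,3)] L2_mult_integrable[OF assms(2,3)]
  by (simp add: L2_inner_def left_diff_distrib)

lemma L2_inner_diff_right:
  assumes "f \<in> L2_space a b" "g \<in> L2_space a b" "h \<in> L2_space a b"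
  shows "L2_inner a b h (\<lambda>x. f x - g x) = L2_inner a b h f - L2_inner a b h g"
  using L2_inner_diff_left[OF assms] L2_inner_cnj by (metis complex_cnj_diff)

lemma L2_inner_sum_left:
  assumes "\<And>i. i \<in> I \<Longrightarrow> f i \<in> L2_space a b" "h \<in> L2_space a b"
  shows "L2_inner a b (\<lambda>x. \<Sum>i\<in>I. f i x) h = (\<Sum>i\<in>I. L2_inner a b (f i) h)"
  using L2_mult_integrable[OF assms(1) assms(2)]
  by (simp add: L2_inner_def sum_distrib_right)

lemma L2_inner_sum_right:
  assumes "\<And>i. i \<in> I \<Longrightarrow> f i \<in> L2_space a b" "h \<in> L2_space a b"
  shows "L2_inner a b h (\<lambda>x. \<Sum>i\<in>I. f i x) = (\<Sum>i\<in>I. L2_inner a b h (f i))"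
proof -
  have "L2_inner a b h (\<lambda>x. \<Sum>i\<in>I. f i x) = cnj (L2_inner a b (\<lambda>x. \<Sum>i\<in>I. f i x) h)"
    by (rule L2_inner_cnj)
  also have "\<dots> = (\<Sum>i\<in>I. cnj (L2_inner a b (f i) h))"
    by (simp add: L2_inner_sum_left assms)
  finally show ?thesis by (simp flip: L2_inner_cnj)
qed

lemma L2_inner_self:
  "L2_inner a b f f = of_real (LINT x|lebesgue_on {a..b}. (cmod (f x))\<^sup>2)"
  unfolding L2_inner_def integral_complex_of_real[symmetric]
  by (intro Bochner_Integration.integral_cong) (auto simp: complex_norm_square simp flip: of_real_power)

text \<open>The product of \<open>f\<close> and the conjugate of \<open>w\<close> is absolutely
  continuous, so the integral of its derivative is the difference of its end values, which
  \<open>ends\<close> makes zero.\<close>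

lemma integration_by_parts_abs_cont:
  assumes "a < b" and f: "abs_cont_on a b f" and N: "negligible N"
    and f': "\<And>x. x \<in> {a..b} - N \<Longrightarrow> (f has_vector_derivative f' x) (at x within {a..b})"
    and L2: "f' \<in> L2_space a b"
    and w: "\<And>x. x \<in> {a..b} \<Longrightarrow> (w has_vector_derivative w' x) (at x within {a..b})" "continuous_on {a..b} w'"
    and ends: "f a * cnj (w a) = f b * cnj (w b)"
  shows "L2_inner a b f' w = - L2_inner a b f w'"
proof -
  define h where "h x = f' x * cnj (w x) + f x * cnj (w' x)" for x
  have wc: "continuous_on {a..b} w" 
    using w(1) has_vector_derivative_continuous by (blast intro: continuous_on_eq_continuous_within[THEN iffD2])
  have w1: "((\<lambda>x. cnj (w x)) has_vector_derivative cnj (w' x)) (at x within {a..b})" if "x \<in> {a..b}" for x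
    using w(1)[OF that] by (rule has_vector_derivative_cnj)
  have "abs_cont_on a b (\<lambda>x. f x * cnj (w x))"
    by (rule abs_cont_on_mult[OF f abs_cont_on_C1[of a b _ "\<lambda>x. cnj (w' x)"]])
      (use w1 w(2) in \<open>auto intro: continuous_on_cnj\<close>)
  moreover have "((\<lambda>x. f x * cnj (w x)) has_vector_derivative h x) (at x within {a..b})" if "x \<in> {a..b} - N" for x
    using has_vector_derivative_mult[OF f'[OF that] w1] that by (simp add: h_def add.commute)
  ultimately have "(h has_integral (f b * cnj (w b) - f a * cnj (w a))) {a..b}"
    using \<open>a < b\<close> by (intro abs_cont_on_fundamental_theorem[OF _ _ N]) auto
  then have i0: "integral {a..b} h = 0" using ends by (simp add: integral_unique)
  \<comment> \<open>The fundamental theorem gives a gauge integral. Square integrability of the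
    factors makes \<open>h\<close> Lebesgue integrable, so that the two integrals agree.\<close>
  have int: "integrable (lebesgue_on {a..b}) (\<lambda>x. f' x * cnj (w x))"
    "integrable (lebesgue_on {a..b}) (\<lambda>x. f x * cnj (w' x))"
    by (intro L2_mult_integrable L2 L2_continuous wc w(2) abs_cont_on_continuous f)+
  then have "integrable (lebesgue_on {a..b}) h" by (simp add: h_def[abs_def])
  then have "(LINT x|lebesgue_on {a..b}. h x) = 0" using lebesgue_integral_eq_integral[of "{a..b}" h] i0 by simp
  then show ?thesis using int by (simp add: L2_inner_def h_def eq_neg_iff_add_eq_0)
qed

section \<open>Derivatives in the spaces \<open>V\<^sub>n\<close>\<close>

lemma deriv_n_0 [simp]: "deriv_n a b 0 f = f"
  by (simp add: deriv_n_def)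

lemma deriv_n_Suc: "deriv_n a b (Suc j) f x = vector_derivative (deriv_n a b j f) (at x within {a..b})"
  by (simp add: deriv_n_def)

text \<open>\<open>F j\<close> is the \<open>j\<close>-th derivative of a smooth function all of whose derivatives are semi-periodic.\<close>

definition antiperiodic_tower :: "real \<Rightarrow> real \<Rightarrow> (nat \<Rightarrow> real \<Rightarrow> complex) \<Rightarrow> bool" where
  "antiperiodic_tower a b F \<longleftrightarrow>
     (\<forall>j. \<forall>x\<in>{a..b}. (F j has_vector_derivative F (Suc j) x) (at x within {a..b})) \<and>
     (\<forall>j. F j a = - F j b)"


lemma antiperiodic_tower_continuous:
  assumes "antiperiodic_tower a b F"
  shows "continuous_on {a..b} (F j)"
  using assms has_vector_derivative_continuous unfolding antiperiodic_tower_def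
  by (blast intro: continuous_on_eq_continuous_within[THEN iffD2])

lemma antiperiodic_tower_abs_cont:
  assumes "antiperiodic_tower a b F"
  shows "abs_cont_on a b (F j)"
  using assms antiperiodic_tower_continuous[OF assms, of "Suc j"]
  by (intro abs_cont_on_C1[of a b _ "F (Suc j)"]) (auto simp: antiperiodic_tower_def)

text \<open>Membership in \<open>V\<^sub>n\<close> grants differentiability at every point only for
  \<open>Suc j < n\<close>. For \<open>Suc j = n\<close> absolute continuity gives it almost
  everywhere, and at such points the next \<open>deriv_n\<close> is a true derivative.\<close>

lemma sob_deriv_ae:
  assumes f: "f \<in> sob_space a b n" and "j < n"
  obtains N where "negligible N"
    "\<And>x. x \<in> {a..b} - N \<Longrightarrow> (deriv_n a b j f has_vector_derivative deriv_n a b (Suc j) f x) (at x within {a..b})"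
proof
  show "negligible {x \<in> {a..b}. \<not> deriv_n a b j f differentiable at x within {a..b}}"
    using f \<open>j < n\<close> by (intro abs_cont_on_differentiable_ae) (auto simp: sob_space_def)
qed (auto simp: deriv_n_Suc vector_derivative_works)

lemma sob_deriv_L2:
  assumes "f \<in> sob_space a b n" "j \<le> n"
  shows "deriv_n a b j f \<in> L2_space a b"
proof (cases "j = n")
  case False
  then have "abs_cont_on a b (deriv_n a b j f)" using assms by (auto simp: sob_space_def)
  then show ?thesis by (intro L2_continuous abs_cont_on_continuous)
qed (use assms in \<open>simp add: sob_space_def\<close>)

text \<open>Below order \<open>n\<close> all derivatives exist at every point, so subtraction
  commutes with each of them. The induction stops there, because the derivative of order
  \<open>n\<close> of \<open>f\<close> may fail to exist on a null set.\<close>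

lemma deriv_n_diff_tower:
  assumes ab: "a < b" and f: "f \<in> sob_space a b n" and F: "antiperiodic_tower a b F"
  shows "j < n \<Longrightarrow> x \<in> {a..b} \<Longrightarrow> deriv_n a b j (\<lambda>x. f x - F 0 x) x = deriv_n a b j f x - F j x"
    and "Suc j < n \<Longrightarrow> x \<in> {a..b} \<Longrightarrow> 
      (deriv_n a b j (\<lambda>x. f x - F 0 x) has_vector_derivative deriv_n a b (Suc j) f x - F (Suc j) x) (at x within {a..b})"
proof -
  have step: "(deriv_n a b j (\<lambda>x. f x - F 0 x) has_vector_derivative deriv_n a b (Suc j) f x - F (Suc j) x) (at x within {a..b})"
    if eq: "\<And>x. x \<in> {a..b} \<Longrightarrow> deriv_n a b j (\<lambda>x. f x - F 0 x) x = deriv_n a b j f x - F j x"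
      and x: "x \<in> {a..b}" and d: "deriv_n a b j f differentiable (at x within {a..b})" for j x
  proof (rule has_vector_derivative_transform[OF x eq])
    show "((\<lambda>x. deriv_n a b j f x - F j x) has_vector_derivative deriv_n a b (Suc j) f x - F (Suc j) x)
        (at x within {a..b})"
      using d x F by (intro has_vector_derivative_diff)
        (auto simp: deriv_n_Suc vector_derivative_works antiperiodic_tower_def)
  qed
  have d: "deriv_n a b j f differentiable (at x within {a..b})" if "Suc j < n" "x \<in> {a..b}" for j x
    using f that by (auto simp: sob_space_def)
  show eq: "j < n \<Longrightarrow> x \<in> {a..b} \<Longrightarrow> deriv_n a b j (\<lambda>x. f x - F 0 x) x = deriv_n a b j f x - F j x" for j x
  proof (induction j arbitrary: x)
    case (Suc j)
    have "(deriv_n a b j (\<lambda>x. f x - F 0 x) has_vector_derivative deriv_n a b (Suc j) f x - F (Suc j) x)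
        (at x within {a..b})"
      using Suc by (intro step d) auto
    then show ?case
      unfolding deriv_n_Suc[of a b j "\<lambda>x. f x - F 0 x"]
      using Suc.prems by (intro vector_derivative_within_closed_interval[OF ab]) auto
  qed simp
  show "Suc j < n \<Longrightarrow> x \<in> {a..b} \<Longrightarrow> 
      (deriv_n a b j (\<lambda>x. f x - F 0 x) has_vector_derivative deriv_n a b (Suc j) f x - F (Suc j) x) (at x within {a..b})"
    using eq by (intro step d) auto
qed

lemma deriv_n_tower:
  assumes ab: "a < b" and F: "antiperiodic_tower a b F"
  shows "x \<in> {a..b} \<Longrightarrow> deriv_n a b j (F 0) x = F j x"
proof (induction j arbitrary: x)
  case (Suc j)
  have "(deriv_n a b j (F 0) has_vector_derivative F (Suc j) x) (at x within {a..b})"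
    by (rule has_vector_derivative_transform[OF Suc.prems Suc.IH])
      (use F Suc.prems in \<open>auto simp: antiperiodic_tower_def\<close>)
  then show ?case
    unfolding deriv_n_Suc using Suc.prems by (intro vector_derivative_within_closed_interval[OF ab]) auto
qed simp

lemma tower_in_sob_space:
  assumes ab: "a < b" and F: "antiperiodic_tower a b F"
  shows "F 0 \<in> sob_space a b n"
proof -
  note eq = deriv_n_tower[OF assms]
  have "deriv_n a b j (F 0) differentiable (at x within {a..b})" if x: "x \<in> {a..b}" for j x
  proof -
    have "(deriv_n a b j (F 0) has_vector_derivative F (Suc j) x) (at x within {a..b})"
      by (rule has_vector_derivative_transform[OF x eq]) (use F x in \<open>auto simp: antiperiodic_tower_def\<close>)
    then show ?thesis by (rule differentiableI_vector)
  qed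
  moreover have "abs_cont_on a b (deriv_n a b j (F 0))" for j
    by (rule abs_cont_on_cong[OF antiperiodic_tower_abs_cont[OF F] eq])
  moreover have "deriv_n a b j (F 0) a = - deriv_n a b j (F 0) b" for j
    using F ab by (simp add: eq antiperiodic_tower_def)
  moreover have "deriv_n a b n (F 0) \<in> L2_space a b"
    by (rule L2_cong_ae[OF L2_continuous[OF antiperiodic_tower_continuous[OF F]] negligible_empty]) (simp add: eq)
  ultimately show ?thesis by (simp add: sob_space_def)
qed

text \<open>This makes Parseval's identity applicable to \<open>f\<close> minus a partial sum. For
  \<open>n > 0\<close> the top derivative of the difference splits wherever the derivative of
  \<open>f\<close> of order \<open>n - 1\<close> is differentiable, hence almost everywhere, which
  suffices for square integrability.\<close>

lemma sob_space_diff_tower: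
  assumes ab: "a < b" and f: "f \<in> sob_space a b n" and F: "antiperiodic_tower a b F"
  shows "(\<lambda>x. f x - F 0 x) \<in> sob_space a b n"
proof -
  define h where "h = (\<lambda>x. f x - F 0 x)"
  note eq = deriv_n_diff_tower(1)[OF assms, folded h_def]
  have "deriv_n a b j h differentiable (at x within {a..b})" if "Suc j < n" "x \<in> {a..b}" for j x
    using deriv_n_diff_tower(2)[OF assms that] unfolding h_def by (rule differentiableI_vector)
  moreover have "abs_cont_on a b (deriv_n a b j h)" if "j < n" for j
  proof (rule abs_cont_on_cong[OF abs_cont_on_diff[OF _ antiperiodic_tower_abs_cont[OF F]]])
    show "abs_cont_on a b (deriv_n a b j f)" using f that by (auto simp: sob_space_def)
  qed (rule eq[OF that])
  moreover have "deriv_n a b j h a = - deriv_n a b j h b" if "j < n" for j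
  proof -
    have "deriv_n a b j f a = - deriv_n a b j f b" "F j a = - F j b"
      using f F that by (auto simp: sob_space_def antiperiodic_tower_def)
    then show ?thesis using that ab by (simp add: eq)
  qed
  moreover have "deriv_n a b n h \<in> L2_space a b"
  proof (cases n)
    case 0
    then show ?thesis using f antiperiodic_tower_continuous[OF F]
      by (auto simp: sob_space_def h_def intro: L2_diff L2_continuous)
  next
    case (Suc j)
    then obtain N where N: "negligible N"
      "\<And>x. x \<in> {a..b} - N \<Longrightarrow> (deriv_n a b j f has_vector_derivative deriv_n a b n f x) (at x within {a..b})"
      using sob_deriv_ae[OF f, of j] by auto
    have "deriv_n a b n h x = deriv_n a b n f x - F n x" if x: "x \<in> {a..b} - N" for x
    proof -
      have "(deriv_n a b j h has_vector_derivative deriv_n a b n f x - F n x) (at x within {a..b})"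
      proof (rule has_vector_derivative_transform[where f = "\<lambda>x. deriv_n a b j f x - F j x"])
        show "((\<lambda>x. deriv_n a b j f x - F j x) has_vector_derivative deriv_n a b n f x - F n x) (at x within {a..b})"
          using N(2)[OF x] x F Suc by (intro has_vector_derivative_diff) (auto simp: antiperiodic_tower_def)
      qed (use x eq Suc in auto)
      then show ?thesis
        unfolding Suc deriv_n_Suc using x by (intro vector_derivative_within_closed_interval[OF ab]) auto
    qed
    then show ?thesis
      by (intro L2_cong_ae[OF L2_diff[OF sob_deriv_L2[OF f order_refl] L2_continuous[OF antiperiodic_tower_continuous[OF F, of n]]] N(1)])
  qed
  ultimately show ?thesis by (simp add: sob_space_def h_def)
qed

text \<open>Both factors change sign between \<open>a\<close> and \<open>b\<close>, so their product
  has equal end values and the boundary term vanishes.\<close>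

lemma sob_integration_by_parts:
  assumes ab: "a < b" and f: "f \<in> sob_space a b n" and "j < n" and F: "antiperiodic_tower a b F"
  shows "L2_inner a b (deriv_n a b (Suc j) f) (F i) = - L2_inner a b (deriv_n a b j f) (F (Suc i))"
proof -
  obtain N where N: "negligible N"
    "\<And>x. x \<in> {a..b} - N \<Longrightarrow> (deriv_n a b j f has_vector_derivative deriv_n a b (Suc j) f x) (at x within {a..b})"
    using sob_deriv_ae[OF f \<open>j < n\<close>] by blast
  show ?thesis
  proof (rule integration_by_parts_abs_cont[OF ab _ N])
    show "abs_cont_on a b (deriv_n a b j f)" using f \<open>j < n\<close> by (auto simp: sob_space_def)
    show "deriv_n a b (Suc j) f \<in> L2_space a b" using \<open>j < n\<close> by (intro sob_deriv_L2[OF f]) simp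
    show "continuous_on {a..b} (F (Suc i))" by (rule antiperiodic_tower_continuous[OF F])
    have "deriv_n a b j f a = - deriv_n a b j f b" "F i a = - F i b"
      using f F \<open>j < n\<close> by (auto simp: sob_space_def antiperiodic_tower_def)
    then show "deriv_n a b j f a * cnj (F i a) = deriv_n a b j f b * cnj (F i b)" by simp
  qed (use F in \<open>auto simp: antiperiodic_tower_def\<close>)
qed

lemma sob_integration_by_parts_iterated:
  assumes ab: "a < b" and f: "f \<in> sob_space a b n" and F: "antiperiodic_tower a b F"
  shows "j \<le> n \<Longrightarrow> L2_inner a b (deriv_n a b j f) (F i) = (-1) ^ j * L2_inner a b f (F (i + j))"
  by (induction j arbitrary: i) (simp_all add: sob_integration_by_parts[OF ab f _ F])

section \<open>The eigenfunctions\<close>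

text \<open>
  With a phase, one family contains both \<open>z1\<close> and \<open>z2\<close>, and differentiation becomes
  multiplication by the frequency together with a phase shift by \<open>\<pi> / 2\<close>.
\<close>

definition trig :: "real \<Rightarrow> real \<Rightarrow> nat \<Rightarrow> real \<Rightarrow> real \<Rightarrow> complex" where
  "trig a b m \<phi> x = of_real (sqrt (2 / (b - a)) * cos (freq a b m * x + \<phi>))"

lemma z1_eq_trig: "z1 a b m = trig a b m 0"
  by (simp add: fun_eq_iff z1_def trig_def)

lemma z2_eq_trig: "z2 a b m = trig a b m (- pi / 2)"
  by (simp add: fun_eq_iff z2_def trig_def cos_diff flip: minus_divide_left)

lemma trig_expand: "trig a b m \<phi> x = of_real (cos \<phi>) * z1 a b m x - of_real (sin \<phi>) * z2 a b m x"
  by (simp add: z1_def z2_def trig_def cos_add algebra_simps)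

lemma continuous_on_trig [continuous_intros]: "continuous_on A (trig a b m \<phi>)"
  unfolding trig_def[abs_def] by (intro continuous_intros)

lemma trig_tower:
  assumes "a < b" "m \<ge> 1"
  shows "antiperiodic_tower a b (\<lambda>j x. of_real (c * freq a b m ^ j) * trig a b m (\<phi> + j * (pi / 2)) x)"
proof -
  define \<omega> where "\<omega> = freq a b m"
  have deriv: "(trig a b m \<psi> has_vector_derivative of_real \<omega> * trig a b m (\<psi> + pi / 2) x) (at x within {a..b})" for \<psi> x
  proof -
    have "((\<lambda>x. sqrt (2 / (b - a)) * cos (\<omega> * x + \<psi>)) has_field_derivative
        \<omega> * (sqrt (2 / (b - a)) * cos (\<omega> * x + (\<psi> + pi / 2)))) (at x within {a..b})"
      by (auto intro!: derivative_eq_intros simp: cos_add sin_add algebra_simps)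
    then have "((\<lambda>x. complex_of_real (sqrt (2 / (b - a)) * cos (\<omega> * x + \<psi>))) has_vector_derivative
        complex_of_real (\<omega> * (sqrt (2 / (b - a)) * cos (\<omega> * x + (\<psi> + pi / 2))))) (at x within {a..b})"
      by (intro has_vector_derivative_of_real) (simp add: has_real_derivative_iff_has_vector_derivative)
    then show ?thesis by (simp add: trig_def[abs_def] \<omega>_def)
  qed
  have anti: "trig a b m \<psi> a = - trig a b m \<psi> b" for \<psi>
  proof -
    \<comment> \<open>Over the interval the argument of the cosine advances by an odd multiple of
      \<pi>, that is, by whole turns up to one half turn, which changes the sign.\<close>
    have "\<omega> * b = \<omega> * a + (2 * real m - 1) * pi"
      using \<open>a < b\<close> by (simp add: \<omega>_def freq_def field_simps)
    then have "\<omega> * b + \<psi> = (\<omega> * a + \<psi> - pi) + 2 * real m * pi" by (simp add: algebra_simps)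
    then have "cos (\<omega> * b + \<psi>) = cos ((\<omega> * a + \<psi> - pi) + 2 * real m * pi)" by (rule arg_cong)
    also have "\<dots> = cos (\<omega> * a + \<psi> - pi)"
      unfolding cos_add[of "\<omega> * a + \<psi> - pi" "2 * real m * pi"] cos_2npi sin_2npi by simp
    finally show ?thesis by (simp add: trig_def \<omega>_def)
  qed
  show ?thesis
    unfolding antiperiodic_tower_def
  proof (intro conjI allI ballI)
    fix j x
    have "((\<lambda>x. of_real (c * \<omega> ^ j) * trig a b m (\<phi> + j * (pi / 2)) x) has_vector_derivative
        of_real (c * \<omega> ^ j) * (of_real \<omega> * trig a b m (\<phi> + j * (pi / 2) + pi / 2) x)) (at x within {a..b})"
      by (intro has_vector_derivative_mult_right deriv)
    then show "((\<lambda>x. of_real (c * freq a b m ^ j) * trig a b m (\<phi> + j * (pi / 2)) x) has_vector_derivative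
        of_real (c * freq a b m ^ Suc j) * trig a b m (\<phi> + Suc j * (pi / 2)) x) (at x within {a..b})"
      by (simp add: \<omega>_def mult_ac add.assoc add_divide_distrib distrib_left distrib_right add.commute[of "pi / 2"])
  qed (use anti in simp)
qed

lemma trig_phase_add_pi: "trig a b m (\<phi> + real j * pi) x = (-1) ^ j * trig a b m \<phi> x"
proof (induction j)
  case (Suc j)
  have "\<phi> + real (Suc j) * pi = (\<phi> + real j * pi) + pi" by (simp add: distrib_right)
  then have "trig a b m (\<phi> + real (Suc j) * pi) x = - trig a b m (\<phi> + real j * pi) x"
    by (simp add: trig_def flip: add.assoc)
  then show ?case using Suc.IH by simp
qed simp

lemma L2_inner_deriv_trig:
  assumes "a < b" "m \<ge> 1" "f \<in> sob_space a b n" "j \<le> n"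
  shows "L2_inner a b (deriv_n a b j f) (trig a b m \<phi>) =
    (-1) ^ j * of_real (freq a b m ^ j) * L2_inner a b f (trig a b m (\<phi> + j * (pi / 2)))"
  using sob_integration_by_parts_iterated[OF assms(1,3) trig_tower[OF assms(1,2), of 1 \<phi>] assms(4), of 0]
  by (simp add: L2_inner_scale_right)

text \<open>Differentiating the eigenfunction \<open>j\<close> times and moving \<open>j\<close>
  derivatives off \<open>f\<close> each shift the phase by \<open>j * (pi / 2)\<close>, together by
  \<open>j * pi\<close>. The resulting sign \<open>(-1) ^ j\<close> cancels the sign from
  integration by parts, and only \<open>\<omega>\<^sup>2 ^ j\<close> survives. The free phase covers
  \<open>z1\<close> and \<open>z2\<close> at once.\<close>

lemma sob_inner_trig:
  assumes "a < b" "m \<ge> 1" "f \<in> sob_space a b n"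
  shows "sob_inner a b k n f (\<lambda>x. of_real c * trig a b m \<phi> x) =
    of_real (c * eigval a b k m ^ n) * L2_inner a b f (trig a b m \<phi>)"
proof -
  define \<omega> where "\<omega> = freq a b m"
  have "L2_inner a b (deriv_n a b j f) (deriv_n a b j (\<lambda>x. of_real c * trig a b m \<phi> x)) =
      of_real (c * \<omega>\<^sup>2 ^ j) * L2_inner a b f (trig a b m \<phi>)" if "j \<le> n" for j
  proof -
    have "L2_inner a b (deriv_n a b j f) (deriv_n a b j (\<lambda>x. of_real c * trig a b m \<phi> x)) =
        L2_inner a b (deriv_n a b j f) (\<lambda>x. of_real (c * \<omega> ^ j) * trig a b m (\<phi> + j * (pi / 2)) x)"
      using deriv_n_tower[OF assms(1) trig_tower[OF assms(1,2), of c \<phi>], of _ j]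
      by (intro L2_inner_cong) (simp_all add: \<omega>_def)
    also have "\<dots> = of_real (c * \<omega> ^ j) * ((-1) ^ j * of_real (\<omega> ^ j) * L2_inner a b f (trig a b m (\<phi> + real j * pi)))"

    proof -
      have "\<phi> + real j * (pi / 2) + real j * (pi / 2) = \<phi> + real j * pi" by simp
      then show ?thesis
        by (simp only: L2_inner_scale_right L2_inner_deriv_trig[OF assms that] \<omega>_def complex_cnj_complex_of_real)
    qed
    also have "trig a b m (\<phi> + real j * pi) = (\<lambda>x. (-1) ^ j * trig a b m \<phi> x)"
      by (simp add: fun_eq_iff trig_phase_add_pi)
    also have "of_real (c * \<omega> ^ j) * ((-1) ^ j * of_real (\<omega> ^ j) * L2_inner a b f (\<lambda>x. (-1) ^ j * trig a b m \<phi> x))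
        = of_real (c * (\<omega> ^ j * \<omega> ^ j)) * (((-1) ^ j * (-1) ^ j) * L2_inner a b f (trig a b m \<phi>))"
      by (simp add: L2_inner_scale_right mult_ac)
    also have "\<omega> ^ j * \<omega> ^ j = \<omega>\<^sup>2 ^ j" by (simp add: power2_eq_square power_mult_distrib)
    also have "(-1) ^ j * (-1) ^ j = (1::complex)" by (simp flip: power_mult_distrib)
    finally show ?thesis by simp
  qed
  then have "sob_inner a b k n f (\<lambda>x. of_real c * trig a b m \<phi> x) =
      (\<Sum>j=0..n. of_nat (n choose j) * of_real (k ^ (n - j)) * (of_real (c * \<omega>\<^sup>2 ^ j) * L2_inner a b f (trig a b m \<phi>)))"
    unfolding sob_inner_def by (intro sum.cong) auto
  also have "\<dots> = of_real (c * (\<Sum>j=0..n. of_nat (n choose j) * (\<omega>\<^sup>2) ^ j * k ^ (n - j))) * L2_inner a b f (trig a b m \<phi>)"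
    by (simp add: sum_distrib_left sum_distrib_right mult_ac)
  also have "(\<Sum>j=0..n. of_nat (n choose j) * (\<omega>\<^sup>2) ^ j * k ^ (n - j)) = eigval a b k m ^ n"
    by (simp add: eigval_def \<omega>_def binomial_ring atLeast0AtMost)
  finally show ?thesis .
qed

lemma integral_cos_full_periods:
  fixes i :: int
  assumes "a < b" "i \<noteq> 0"
  shows "((\<lambda>x. cos (2 * pi * i / (b - a) * x + c)) has_integral 0) {a..b}"
proof -
  define s where "s = 2 * pi * i / (b - a)"
  have "s \<noteq> 0" using assms by (simp add: s_def)
  have "((\<lambda>x. cos (s * x + c)) has_integral (sin (s * b + c) / s - sin (s * a + c) / s)) {a..b}"
  proof (rule fundamental_theorem_of_calculus)
    show "((\<lambda>x. sin (s * x + c) / s) has_vector_derivative cos (s * x + c)) (at x within {a..b})" for x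
      unfolding has_real_derivative_iff_has_vector_derivative[symmetric]
      using \<open>s \<noteq> 0\<close> by (auto intro!: derivative_eq_intros)
  qed (use assms in simp)
  moreover have "s * b + c = (s * a + c) + of_int i * (2 * pi)"
    using assms by (simp add: s_def field_simps)
  then have "sin (s * b + c) = sin ((s * a + c) + of_int i * (2 * pi))" by (rule arg_cong)
  then have "sin (s * b + c) = sin (s * a + c)" using sin.plus_of_int[of "s * a + c" i] by simp
  ultimately show ?thesis by (simp add: s_def)
qed

text \<open>Sum and difference of two odd multiples of \<open>pi / (b - a)\<close> are even
  multiples, so both cosines in the product formula run through whole periods and integrate to 0.
  The exception is the difference for \<open>m = m'\<close>, which leaves the constant
  \<open>cos (\<phi> - \<psi>)\<close>. Orthogonality of \<open>z1\<close> and \<open>z2\<close> at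
  equal frequency is included: their phases differ by a right angle.\<close>

lemma L2_inner_trig:
  assumes "a < b" "m \<ge> 1" "m' \<ge> 1"
  shows "L2_inner a b (trig a b m \<phi>) (trig a b m' \<psi>) = (if m = m' then of_real (cos (\<phi> - \<psi>)) else 0)"
proof -
  define r where "r x = 1 / (b - a) * (cos (2 * pi * (int m - int m') / (b - a) * x + (\<phi> - \<psi>)) +
      cos (2 * pi * (int m + int m' - 1) / (b - a) * x + (\<phi> + \<psi>)))" for x
  have prod: "cos (freq a b m * x + \<phi>) * cos (freq a b m' * x + \<psi>) * (2 / (b - a)) = r x" for x
  proof -
    have f: "2 * pi * (int m - int m') / (b - a) = freq a b m - freq a b m'"
      "2 * pi * (int m + int m' - 1) / (b - a) = freq a b m + freq a b m'"
      by (simp_all add: freq_def algebra_simps flip: diff_divide_distrib add_divide_distrib)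
    have e: "2 * pi * (int m - int m') / (b - a) * x + (\<phi> - \<psi>) = (freq a b m * x + \<phi>) - (freq a b m' * x + \<psi>)"
      "2 * pi * (int m + int m' - 1) / (b - a) * x + (\<phi> + \<psi>) = (freq a b m * x + \<phi>) + (freq a b m' * x + \<psi>)"
      unfolding f by (simp_all add: algebra_simps)
    show ?thesis unfolding r_def e using \<open>a < b\<close> by (simp add: cos_times_cos field_simps)
  qed
  have "trig a b m \<phi> x * cnj (trig a b m' \<psi> x) = of_real (r x)" for x
  proof -
    define s where "s = sqrt (2 / (b - a))"
    have "trig a b m \<phi> x * cnj (trig a b m' \<psi> x) =
        of_real (cos (freq a b m * x + \<phi>) * cos (freq a b m' * x + \<psi>) * (s * s))"
      by (simp add: trig_def mult_ac flip: s_def)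
    also have "s * s = 2 / (b - a)" using \<open>a < b\<close> by (simp add: s_def)
    finally show ?thesis by (simp only: prod)
  qed
  then have "L2_inner a b (trig a b m \<phi>) (trig a b m' \<psi>) = of_real (LINT x|lebesgue_on {a..b}. r x)"
    by (simp add: L2_inner_def)
  also have "(LINT x|lebesgue_on {a..b}. r x) = integral {a..b} r"
  proof (rule lebesgue_integral_eq_integral)
    show "integrable (lebesgue_on {a..b}) r"
      unfolding r_def by (intro continuous_imp_integrable_real continuous_intros)
  qed simp
  also have "integral {a..b} r = (if m = m' then cos (\<phi> - \<psi>) else 0)"
  proof -
    have 1: "((\<lambda>x. cos (2 * pi * (int m - int m') / (b - a) * x + (\<phi> - \<psi>))) has_integral
        (if m = m' then cos (\<phi> - \<psi>) * (b - a) else 0)) {a..b}"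
      using integral_cos_full_periods[OF \<open>a < b\<close>, of "int m - int m'"] has_integral_const_real[of "cos (\<phi> - \<psi>)" a b] \<open>a < b\<close>
      by (auto simp: mult.commute)
    have 2: "((\<lambda>x. cos (2 * pi * (int m + int m' - 1) / (b - a) * x + (\<phi> + \<psi>))) has_integral 0) {a..b}"
      using integral_cos_full_periods[OF \<open>a < b\<close>, of "int m + int m' - 1"] assms by auto
    have "(r has_integral (1 / (b - a) * ((if m = m' then cos (\<phi> - \<psi>) * (b - a) else 0) + 0))) {a..b}"
      unfolding r_def by (intro has_integral_mult_right has_integral_add 1 2)
    then show ?thesis using \<open>a < b\<close> by (auto simp: integral_unique)
  qed
  finally show ?thesis by simp
qed

section \<open>Completeness in \<open>L\<^sup>2\<close>\<close>

definition L2_norm2 :: "real \<Rightarrow> real \<Rightarrow> (real \<Rightarrow> complex) \<Rightarrow> real" where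
  "L2_norm2 a b f = (LINT x|lebesgue_on {a..b}. (cmod (f x))\<^sup>2)"

text \<open>For squared norms the triangle inequality costs a factor 2; this is why the
  approximations below start from fractions such as \<open>\<epsilon> / 4\<close>.\<close>

lemma L2_norm2_triangle:
  assumes "f \<in> L2_space a b" "g \<in> L2_space a b" "h \<in> L2_space a b"
  shows "L2_norm2 a b (\<lambda>x. f x - h x) \<le> 2 * (L2_norm2 a b (\<lambda>x. f x - g x) + L2_norm2 a b (\<lambda>x. g x - h x))"
proof -
  have "L2_norm2 a b (\<lambda>x. f x - h x) \<le> (LINT x|lebesgue_on {a..b}. 2 * ((cmod (f x - g x))\<^sup>2 + (cmod (g x - h x))\<^sup>2))"
    unfolding L2_norm2_def
  proof (rule integral_mono)
    have "(cmod (f x - h x))\<^sup>2 \<le> (cmod (f x - g x) + cmod (g x - h x))\<^sup>2" for x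
      by (intro power_mono) (use norm_triangle_ineq[of "f x - g x" "g x - h x"] in auto)
    also have "(cmod (f x - g x) + cmod (g x - h x))\<^sup>2 \<le> 2 * ((cmod (f x - g x))\<^sup>2 + (cmod (g x - h x))\<^sup>2)" for x
      using sum_squares_bound[of "cmod (f x - g x)" "cmod (g x - h x)"] by (simp add: power2_sum)
    finally show "(cmod (f x - h x))\<^sup>2 \<le> 2 * ((cmod (f x - g x))\<^sup>2 + (cmod (g x - h x))\<^sup>2)" for x .
  qed (use L2_diff[OF assms(1,3)] L2_diff[OF assms(1,2)] L2_diff[OF assms(2,3)] in \<open>auto simp: L2_space_def\<close>)
  also have "\<dots> = 2 * (L2_norm2 a b (\<lambda>x. f x - g x) + L2_norm2 a b (\<lambda>x. g x - h x))"
    using L2_diff[OF assms(1,2)] L2_diff[OF assms(2,3)] by (simp add: L2_space_def L2_norm2_def)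
  finally show ?thesis .
qed

lemma L2_norm2_eq_inner: "L2_inner a b f f = of_real (L2_norm2 a b f)"
  by (simp add: L2_inner_self L2_norm2_def)

lemma L2_norm2_nonneg [simp]: "0 \<le> L2_norm2 a b f"
  by (simp add: L2_norm2_def)

text \<open>Completing the square. With the coefficients of \<open>h\<close> for \<open>c\<close> it
  gives Bessel's inequality, and for general \<open>c\<close> it shows that those coefficients
  minimise the distance. Parseval's identity uses both.\<close>

lemma L2_norm2_orthonormal_diff:
  assumes "finite I" and \<phi>: "\<And>i. i \<in> I \<Longrightarrow> \<phi> i \<in> L2_space a b" and h: "h \<in> L2_space a b"
    and orth: "\<And>i j. i \<in> I \<Longrightarrow> j \<in> I \<Longrightarrow> L2_inner a b (\<phi> i) (\<phi> j) = (if i = j then 1 else 0)"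
  shows "L2_norm2 a b (\<lambda>x. h x - (\<Sum>i\<in>I. c i * \<phi> i x)) =
    L2_norm2 a b h - (\<Sum>i\<in>I. (cmod (L2_inner a b h (\<phi> i)))\<^sup>2) + (\<Sum>i\<in>I. (cmod (c i - L2_inner a b h (\<phi> i)))\<^sup>2)"
proof -
  define g where "g = (\<lambda>x. \<Sum>i\<in>I. c i * \<phi> i x)"
  define \<alpha> where "\<alpha> i = L2_inner a b h (\<phi> i)" for i
  have c\<phi>: "(\<lambda>x. c i * \<phi> i x) \<in> L2_space a b" if "i \<in> I" for i by (rule L2_scale[OF \<phi>[OF that]])
  have g: "g \<in> L2_space a b" unfolding g_def by (rule L2_sum[OF c\<phi>])
  have hg: "L2_inner a b h g = (\<Sum>i\<in>I. cnj (c i) * \<alpha> i)"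
    unfolding g_def using L2_inner_sum_right[OF c\<phi> h, of I] by (simp add: L2_inner_scale_right \<alpha>_def)
  have gh: "L2_inner a b g h = (\<Sum>i\<in>I. c i * cnj (\<alpha> i))"
    by (simp add: L2_inner_cnj[of a b g h] hg)
  have "L2_inner a b g g = (\<Sum>i\<in>I. c i * L2_inner a b (\<phi> i) g)"
    using L2_inner_sum_left[OF c\<phi> g, of I] by (simp add: g_def L2_inner_scale_left)
  also have "\<dots> = (\<Sum>i\<in>I. c i * cnj (c i))"
  proof (rule sum.cong[OF refl])
    fix i assume i: "i \<in> I"
    have "L2_inner a b (\<phi> i) g = (\<Sum>j\<in>I. cnj (c j) * L2_inner a b (\<phi> i) (\<phi> j))"
      unfolding g_def using L2_inner_sum_right[OF c\<phi> \<phi>[OF i], of I] by (simp add: L2_inner_scale_right)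
    also have "\<dots> = (\<Sum>j\<in>I. if i = j then cnj (c j) else 0)" by (intro sum.cong) (auto simp: orth i)
    also have "\<dots> = cnj (c i)" using i \<open>finite I\<close> by simp
    finally show "c i * L2_inner a b (\<phi> i) g = c i * cnj (c i)" by simp
  qed
  finally have gg: "L2_inner a b g g = (\<Sum>i\<in>I. c i * cnj (c i))" .
  have hgL: "(\<lambda>x. h x - g x) \<in> L2_space a b" by (rule L2_diff[OF h g])
  have sq: "of_real ((cmod z)\<^sup>2) = z * cnj z" for z by (rule complex_norm_square)
  have "complex_of_real (L2_norm2 a b (\<lambda>x. h x - g x)) = 
      L2_inner a b h h - L2_inner a b h g - (L2_inner a b g h - L2_inner a b g g)"
    by (simp add: L2_norm2_eq_inner[symmetric] L2_inner_diff_left[OF h g hgL] L2_inner_diff_right[OF h g h] L2_inner_diff_right[OF h g g])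
  also have "\<dots> = of_real (L2_norm2 a b h) - (\<Sum>i\<in>I. \<alpha> i * cnj (\<alpha> i)) + (\<Sum>i\<in>I. (c i - \<alpha> i) * cnj (c i - \<alpha> i))"
    unfolding hg gh gg L2_norm2_eq_inner[of a b h] by (simp add: algebra_simps sum.distrib sum_subtractf)
  also have "\<dots> = complex_of_real (L2_norm2 a b h - (\<Sum>i\<in>I. (cmod (\<alpha> i))\<^sup>2) + (\<Sum>i\<in>I. (cmod (c i - \<alpha> i))\<^sup>2))"
    by (simp only: of_real_add of_real_diff of_real_sum sq)
  finally show ?thesis unfolding of_real_eq_iff by (simp add: g_def \<alpha>_def)
qed

section \<open>Approximation by continuous functions that vanish at the end points\<close>

text \<open>For \<open>B > 0\<close> this is the radial retraction onto the disc of radius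
  \<open>B\<close>: points of the disc stay fixed, all others move along their ray to its
  boundary.\<close>

definition clip :: "real \<Rightarrow> complex \<Rightarrow> complex" where
  "clip B z = z / of_real (max 1 (cmod z / B))"

lemma clip:
  assumes "0 < B"
  shows cmod_clip_le: "cmod (clip B z) \<le> B" and clip_eq: "cmod z \<le> B \<Longrightarrow> clip B z = z"
    and cmod_diff_clip_le: "cmod (z - clip B z) \<le> cmod z" and continuous_on_clip: "continuous_on A (clip B)"
proof -
  show "cmod (clip B z) \<le> B"
    using assms by (auto simp: clip_def norm_divide max_def field_simps)
  show "cmod z \<le> B \<Longrightarrow> clip B z = z" using assms by (auto simp: clip_def max_def field_simps)
  define t where "t = max 1 (cmod z / B)"
  have t: "1 \<le> t" by (simp add: t_def)
  have "z - clip B z = of_real (1 - 1 / t) * z" using t by (simp add: clip_def t_def[symmetric] field_simps)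
  then have "cmod (z - clip B z) = \<bar>1 - 1 / t\<bar> * cmod z" by (metis norm_mult norm_of_real)
  also have "\<dots> \<le> 1 * cmod z" using t by (intro mult_right_mono) (auto simp: field_simps)
  finally show "cmod (z - clip B z) \<le> cmod z" by simp
  show "continuous_on A (clip B)"
    unfolding clip_def[abs_def] using assms
    by (intro continuous_intros) (auto simp: max_def)
qed

lemma clip_L2:
  assumes "f \<in> borel_measurable (lebesgue_on {a..b})" "0 < B"
  shows "(\<lambda>x. clip B (f x)) \<in> L2_space a b"
  using borel_measurable_continuous_on[OF continuous_on_clip[OF assms(2)] assms(1)] cmod_clip_le[OF assms(2)]
  by (intro L2_bounded)

text \<open>At each point the truncation is eventually the identity, and the error never exceeds
  \<open>cmod (h x)\<close>, so dominated convergence applies.\<close>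

lemma L2_clip_tendsto:
  assumes h: "h \<in> L2_space a b"
  shows "(\<lambda>n. L2_norm2 a b (\<lambda>x. h x - clip (Suc n) (h x))) \<longlonglongrightarrow> 0"
proof -
  have hm: "h \<in> borel_measurable (lebesgue_on {a..b})" using h by (simp add: L2_space_def)
  have "(\<lambda>n. L2_norm2 a b (\<lambda>x. h x - clip (Suc n) (h x))) \<longlonglongrightarrow> (LINT x|lebesgue_on {a..b}. 0)"
    unfolding L2_norm2_def
  proof (rule integral_dominated_convergence[where w = "\<lambda>x. (cmod (h x))\<^sup>2"])
    show "integrable (lebesgue_on {a..b}) (\<lambda>x. (cmod (h x))\<^sup>2)" using h by (simp add: L2_space_def)
    show "(\<lambda>x. (cmod (h x - clip (Suc n) (h x)))\<^sup>2) \<in> borel_measurable (lebesgue_on {a..b})" for n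
      using L2_diff[OF h clip_L2[OF hm, of "Suc n"]] by (auto simp: L2_space_def)
    show "AE x in lebesgue_on {a..b}. norm ((cmod (h x - clip (Suc n) (h x)))\<^sup>2) \<le> (cmod (h x))\<^sup>2" for n
      using cmod_diff_clip_le[of "Suc n"] by (intro AE_I2) (auto intro!: power_mono)
    show "AE x in lebesgue_on {a..b}. (\<lambda>n. (cmod (h x - clip (Suc n) (h x)))\<^sup>2) \<longlonglongrightarrow> 0"
    proof (rule AE_I2)
      fix x
      have "\<forall>\<^sub>F n in sequentially. cmod (h x) \<le> n" using eventually_ge_at_top[of "nat \<lceil>cmod (h x)\<rceil>"] by eventually_elim linarith
      then have "\<forall>\<^sub>F n in sequentially. (cmod (h x - clip (Suc n) (h x)))\<^sup>2 = 0"
        by eventually_elim (auto simp: clip_eq)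
      then show "(\<lambda>n. (cmod (h x - clip (Suc n) (h x)))\<^sup>2) \<longlonglongrightarrow> 0" by (rule tendsto_eventually)
    qed
  qed simp
  then show ?thesis by simp
qed

text \<open>Measurability of \<open>h\<close> supplies continuous functions \<open>g n\<close> that
  converge to it almost everywhere. Clipping them at the same radius as \<open>h\<close> gives a
  uniform bound, so dominated convergence turns this into convergence in \<open>L2_norm2\<close>.
  The zero end values make \<open>u\<close> semi-periodic, as the circle argument requires.\<close>

lemma L2_approx_continuous:
  assumes ab: "a < b" and h: "h \<in> L2_space a b" and "0 < \<epsilon>"
  obtains u where "continuous_on UNIV u" "u a = 0" "u b = 0" "L2_norm2 a b (\<lambda>x. h x - u x) < \<epsilon>"
proof -
  have hm: "h \<in> borel_measurable (lebesgue_on {a..b})" using h by (simp add: L2_space_def)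
  obtain n where n: "L2_norm2 a b (\<lambda>x. h x - clip (Suc n) (h x)) < \<epsilon> / 4"
    using order_tendstoD(2)[OF L2_clip_tendsto[OF h], of "\<epsilon> / 4"] \<open>0 < \<epsilon>\<close>
    by (auto dest: eventually_happens)
  define B where "B = real (Suc n)"
  have B: "0 < B" by (simp add: B_def)
  define k where "k x = clip B (h x)" for x
  have k: "k \<in> L2_space a b" unfolding k_def by (rule clip_L2[OF hm B])
  obtain N g where N: "negligible N" and g: "\<And>n. continuous_on UNIV (g n)"
    and lim: "\<And>x. x \<notin> N \<Longrightarrow> (\<lambda>n. g n x) \<longlonglongrightarrow> (if x \<in> {a..b} then h x else 0)"
  proof -
    have "h measurable_on {a..b}" using hm by (subst measurable_on_iff_borel_measurable) auto
    then show thesis using that unfolding measurable_on_def by blast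
  qed
  \<comment> \<open>A cut-off that is 0 at both end points and, at each point strictly between them,
    equal to 1 for all large \<open>n\<close>. The absolute value keeps it nonnegative on the whole
    line.\<close>
  define \<theta> where "\<theta> n x = min 1 (real n * \<bar>(x - a) * (b - x)\<bar>)" for n x
  define u where "u n x = of_real (\<theta> n x) * clip B (g n x)" for n x
  have ucont: "continuous_on UNIV (u n)" for n
    unfolding u_def \<theta>_def
    by (intro continuous_intros continuous_on_compose2[OF continuous_on_clip[OF B] g]) auto
  have \<theta>: "0 \<le> \<theta> n x" "\<theta> n x \<le> 1" for n x by (auto simp: \<theta>_def)
  have uB: "cmod (u n x) \<le> B" for n x
  proof -
    have "cmod (u n x) = \<theta> n x * cmod (clip B (g n x))" using \<theta> by (simp add: u_def norm_mult)
    also have "\<dots> \<le> 1 * B" by (intro mult_mono \<theta> cmod_clip_le[OF B]) auto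
    finally show ?thesis by simp
  qed
  have uL2: "u n \<in> L2_space a b" for n by (rule L2_continuous[OF continuous_on_subset[OF ucont]]) simp
  have "(\<lambda>n. L2_norm2 a b (\<lambda>x. k x - u n x)) \<longlonglongrightarrow> (LINT x|lebesgue_on {a..b}. 0)"
    unfolding L2_norm2_def
  proof (rule integral_dominated_convergence[where w = "\<lambda>x. (2 * B)\<^sup>2"])
    interpret finite_measure "lebesgue_on {a..b}" by (rule finite_measure_lebesgue_on_Icc)
    show "integrable (lebesgue_on {a..b}) (\<lambda>x. (2 * B)\<^sup>2)" by simp
    show "(\<lambda>x. (cmod (k x - u n x))\<^sup>2) \<in> borel_measurable (lebesgue_on {a..b})" for n
      using L2_diff[OF k uL2[of n]] by (auto simp: L2_space_def)
    have "cmod (k x - u n x) \<le> 2 * B" for n x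
      using norm_triangle_ineq4[of "k x" "u n x"] cmod_clip_le[OF B, of "h x"] uB[of n x] by (simp add: k_def)
    then have "(cmod (k x - u n x))\<^sup>2 \<le> (2 * B)\<^sup>2" for n x by (intro power_mono) auto
    then show "AE x in lebesgue_on {a..b}. norm ((cmod (k x - u n x))\<^sup>2) \<le> (2 * B)\<^sup>2" for n
      by (intro AE_I2) simp
    show "AE x in lebesgue_on {a..b}. (\<lambda>n. (cmod (k x - u n x))\<^sup>2) \<longlonglongrightarrow> 0"
    proof (rule AE_lebesgue_onI)
      show "negligible (N \<union> {a, b})" using N by simp
      fix x assume x: "x \<in> {a..b} - (N \<union> {a, b})"
      then have pos: "0 < (x - a) * (b - x)" by auto
      have "\<forall>\<^sub>F n in sequentially. 1 / ((x - a) * (b - x)) \<le> real n"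
        using eventually_ge_at_top[of "nat \<lceil>1 / ((x - a) * (b - x))\<rceil>"] by eventually_elim linarith
      then have "\<forall>\<^sub>F n in sequentially. \<theta> n x = 1"
        by eventually_elim (use pos in \<open>auto simp: \<theta>_def field_simps\<close>)
      then have "(\<lambda>n. \<theta> n x) \<longlonglongrightarrow> 1" by (rule tendsto_eventually)
      moreover have "(\<lambda>n. clip B (g n x)) \<longlonglongrightarrow> clip B (h x)"
      proof (rule isCont_tendsto_compose[of _ "clip B"])
        show "isCont (clip B) (h x)" using continuous_on_clip[OF B, of UNIV] by (simp add: continuous_on_eq_continuous_at)
        show "(\<lambda>n. g n x) \<longlonglongrightarrow> h x" using lim[of x] x by simp
      qed
      ultimately have "(\<lambda>n. u n x) \<longlonglongrightarrow> of_real 1 * k x"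
        unfolding u_def k_def by (intro tendsto_intros)
      then have "(\<lambda>n. (cmod (k x - u n x))\<^sup>2) \<longlonglongrightarrow> (cmod (k x - of_real 1 * k x))\<^sup>2"
        by (intro tendsto_intros)
      then show "(\<lambda>n. (cmod (k x - u n x))\<^sup>2) \<longlonglongrightarrow> 0" by simp
    qed simp
  qed simp
  then have "(\<lambda>n. L2_norm2 a b (\<lambda>x. k x - u n x)) \<longlonglongrightarrow> 0" by simp
  then obtain n' where n': "L2_norm2 a b (\<lambda>x. k x - u n' x) < \<epsilon> / 4"

    using order_tendstoD(2)[of "\<lambda>n. L2_norm2 a b (\<lambda>x. k x - u n x)" 0 sequentially "\<epsilon> / 4"] \<open>0 < \<epsilon>\<close>
    by (auto dest: eventually_happens)
  have "L2_norm2 a b (\<lambda>x. h x - u n' x) \<le> 2 * (L2_norm2 a b (\<lambda>x. h x - k x) + L2_norm2 a b (\<lambda>x. k x - u n' x))"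
    by (rule L2_norm2_triangle[OF h k uL2])
  also have "\<dots> < \<epsilon>" using n n' by (simp add: k_def B_def)
  finally have "L2_norm2 a b (\<lambda>x. h x - u n' x) < \<epsilon>" .
  moreover have "u n' a = 0" "u n' b = 0" by (simp_all add: u_def \<theta>_def)
  ultimately show thesis using that ucont by blast
qed

section \<open>Harmonics and trigonometric sums\<close>

lemma cfun_scale_apply [simp]: "cfun_scale c f x = c * f x"
  by (simp add: cfun_scale_def)

text \<open>The index counts half turns over a length of \<open>b - a\<close>: even harmonics are
  periodic, odd ones semi-periodic. Up to normalisation the eigenfunctions are the real and
  imaginary parts of the harmonics of positive odd index.\<close>

definition harmonic :: "real \<Rightarrow> real \<Rightarrow> int \<Rightarrow> real \<Rightarrow> complex" where
  "harmonic a b l x = cis (of_int l * pi / (b - a) * x)"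

definition even_harmonics :: "real \<Rightarrow> real \<Rightarrow> (real \<Rightarrow> complex) set" where
  "even_harmonics a b = cfun.span (range (\<lambda>l. harmonic a b (2 * l)))"

text \<open>The index \<open>(m, False)\<close> stands for \<open>z1\<close> (cosine) and \<open>(m, True)\<close> for \<open>z2\<close> (sine).\<close>

definition trig_basis :: "real \<Rightarrow> real \<Rightarrow> nat \<times> bool \<Rightarrow> real \<Rightarrow> complex" where
  "trig_basis a b p = (if snd p then z2 a b (fst p) else z1 a b (fst p))"

definition trig_index :: "nat \<Rightarrow> (nat \<times> bool) set" where
  "trig_index N = {1..N} \<times> UNIV"

lemma finite_trig_index [simp]: "finite (trig_index N)"
  by (simp add: trig_index_def)

lemma sum_trig_index: "(\<Sum>p\<in>trig_index N. f p) = (\<Sum>m=1..N. f (m, False)) + (\<Sum>m=1..N. f (m, True))"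
proof -
  have "(\<Sum>p\<in>trig_index N. f p) = (\<Sum>m=1..N. \<Sum>s\<in>UNIV. f (m, s))"
    unfolding trig_index_def by (simp add: sum.cartesian_product)
  then show ?thesis by (simp add: UNIV_bool sum.distrib add.commute)
qed

text \<open>The span of the eigenfunctions in explicit form: an approximant comes with the cut-off
  and the coefficients to which the orthonormal expansion formula is applied.\<close>

definition trig_sums :: "real \<Rightarrow> real \<Rightarrow> (real \<Rightarrow> complex) set" where
  "trig_sums a b = {(\<lambda>x. \<Sum>p\<in>trig_index N. c p * trig_basis a b p x) |N c. True}"

lemma trig_sumsI: "(\<lambda>x. \<Sum>p\<in>trig_index N. c p * trig_basis a b p x) \<in> trig_sums a b"
  by (auto simp: trig_sums_def)

lemma harmonic_mult: "harmonic a b l x * harmonic a b l' x = harmonic a b (l + l') x"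
  by (simp add: harmonic_def cis_mult add_divide_distrib distrib_right)

lemma subspace_trig_sums: "cfun.subspace (trig_sums a b)"
proof (rule cfun.subspaceI)
  show "0 \<in> trig_sums a b"
    unfolding trig_sums_def by (rule CollectI, rule exI[of _ 0], rule exI[of _ "\<lambda>_. 0"]) (simp add: fun_eq_iff)
  fix f g c assume f: "f \<in> trig_sums a b" and g: "g \<in> trig_sums a b"
  obtain N \<alpha> where f': "f = (\<lambda>x. \<Sum>p\<in>trig_index N. \<alpha> p * trig_basis a b p x)" using f by (auto simp: trig_sums_def)
  obtain M \<beta> where g': "g = (\<lambda>x. \<Sum>p\<in>trig_index M. \<beta> p * trig_basis a b p x)" using g by (auto simp: trig_sums_def)
  have pad: "(\<Sum>p\<in>trig_index K. \<gamma> p * trig_basis a b p x) =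
      (\<Sum>p\<in>trig_index (max N M). (if p \<in> trig_index K then \<gamma> p else 0) * trig_basis a b p x)"
    if "K \<le> max N M" for K \<gamma> x
  proof (rule sum.mono_neutral_cong_left)
    show "trig_index K \<subseteq> trig_index (max N M)" using that by (auto simp: trig_index_def)
  qed auto
  have "f + g = (\<lambda>x. \<Sum>p\<in>trig_index (max N M).
      ((if p \<in> trig_index N then \<alpha> p else 0) + (if p \<in> trig_index M then \<beta> p else 0)) * trig_basis a b p x)"
    by (simp add: fun_eq_iff f' g' pad[of N] pad[of M] distrib_right sum.distrib)
  then show "f + g \<in> trig_sums a b" by (auto simp: trig_sums_def)
  have "cfun_scale c f = (\<lambda>x. \<Sum>p\<in>trig_index N. (c * \<alpha> p) * trig_basis a b p x)"
    by (simp add: fun_eq_iff f' sum_distrib_left mult.assoc)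
  then show "cfun_scale c f \<in> trig_sums a b" by (auto simp: trig_sums_def)
qed

lemma trig_basis_in_trig_sums:
  assumes "m \<ge> 1"
  shows "trig_basis a b (m, s) \<in> trig_sums a b"
proof -
  have "trig_basis a b (m, s) = (\<lambda>x. \<Sum>p\<in>trig_index m. (if p = (m, s) then 1 else 0) * trig_basis a b p x)"
    using assms by (simp add: fun_eq_iff if_distrib[of "\<lambda>t. t * _"] sum.delta' sum.delta trig_index_def cong: if_cong)
  then show ?thesis using trig_sumsI[where N = m and c = "\<lambda>p. if p = (m, s) then 1 else 0" and a = a and b = b] by (simp only:)
qed

lemma odd_harmonic_in_trig_sums:
  assumes ab: "a < b"
  shows "harmonic a b (2 * l + 1) \<in> trig_sums a b"
proof -
  define r where "r = complex_of_real (1 / sqrt (2 / (b - a)))"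
  have r: "r * complex_of_real (sqrt (2 / (b - a))) = 1" using ab by (simp add: r_def flip: of_real_mult)
  have z: "r * z1 a b m x = cos (freq a b m * x)" "r * z2 a b m x = sin (freq a b m * x)" for m x
    using r by (simp_all add: z1_def z2_def flip: mult.assoc)
  \<comment> \<open>\<open>2 * m - 1\<close> is the absolute value of the odd number
    \<open>2 * l + 1\<close>; the sign lost for negative \<open>l\<close> reappears in
    \<open>\<sigma>\<close> as the sign of the sine.\<close>
  define m where "m = (if l \<ge> 0 then nat (l + 1) else nat (- l))"
  define \<sigma> :: complex where "\<sigma> = (if l \<ge> 0 then \<i> else - \<i>)"
  have "m \<ge> 1" by (auto simp: m_def)
  have fr: "(2 * of_int l + 1) * pi / (b - a) * x = (if l \<ge> 0 then freq a b m * x else - (freq a b m * x))" for x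
  proof -
    define q where "q = 2 * real_of_int l + 1"
    have "2 * real m - 1 = (if l \<ge> 0 then q else - q)" by (auto simp: m_def q_def)
    then show ?thesis unfolding freq_def q_def[symmetric] by (simp only:) simp
  qed
  have "harmonic a b (2 * l + 1) = cfun_scale r (trig_basis a b (m, False)) + cfun_scale (\<sigma> * r) (trig_basis a b (m, True))"
  proof
    fix x
    have "harmonic a b (2 * l + 1) x = cis ((2 * of_int l + 1) * pi / (b - a) * x)" by (simp add: harmonic_def)
    also have "\<dots> = cos (freq a b m * x) + \<sigma> * sin (freq a b m * x)"
      unfolding fr by (auto simp: \<sigma>_def complex_eq_iff)
    also have "\<dots> = r * z1 a b m x + \<sigma> * (r * z2 a b m x)" by (simp add: z)
    finally show "harmonic a b (2 * l + 1) x =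
      (cfun_scale r (trig_basis a b (m, False)) + cfun_scale (\<sigma> * r) (trig_basis a b (m, True))) x"
      by (simp add: trig_basis_def mult.assoc)
  qed
  then show ?thesis
    using trig_basis_in_trig_sums[OF \<open>m \<ge> 1\<close>] subspace_trig_sums
    by (metis cfun.subspace_add cfun.subspace_scale)
qed

text \<open>The factor of index 1 moves every even index to an odd one and so leads from periodic
  approximants back to semi-periodic ones.\<close>

lemma harmonic_times_even_in_trig_sums:
  assumes ab: "a < b" and v: "v \<in> even_harmonics a b"
  shows "(\<lambda>x. harmonic a b 1 x * v x) \<in> trig_sums a b"
  using v unfolding even_harmonics_def
proof (induction rule: cfun.span_induct)
  case base
  show ?case
  proof (rule cfun.subspaceI; clarsimp)
    show "(\<lambda>x. 0) \<in> trig_sums a b" using cfun.subspace_0[OF subspace_trig_sums] by (simp add: zero_fun_def)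
    fix f g c assume f: "(\<lambda>x. harmonic a b 1 x * f x) \<in> trig_sums a b"
      and g: "(\<lambda>x. harmonic a b 1 x * g x) \<in> trig_sums a b"
    show "(\<lambda>x. harmonic a b 1 x * (f x + g x)) \<in> trig_sums a b"
      using cfun.subspace_add[OF subspace_trig_sums f g] by (simp add: plus_fun_def distrib_left)
  next
    fix f c assume f: "(\<lambda>x. harmonic a b 1 x * f x) \<in> trig_sums a b"
    show "(\<lambda>x. harmonic a b 1 x * (c * f x)) \<in> trig_sums a b"
      using cfun.subspace_scale[OF subspace_trig_sums f, of c] by (simp add: cfun_scale_def mult_ac)
  qed
next
  case (step f)
  then obtain l where "f = harmonic a b (2 * l)" by blast
  then show ?case using odd_harmonic_in_trig_sums[OF ab, of l] by (simp add: harmonic_mult add.commute)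
qed

text \<open>The algebra property that Stone-Weierstrass relies on. Span induction in each factor
  reduces it to two harmonics, whose indices add.\<close>

lemma even_harmonics_mult:
  assumes f: "f \<in> even_harmonics a b" and g: "g \<in> even_harmonics a b"
  shows "(\<lambda>x. f x * g x) \<in> even_harmonics a b"
proof -
  have sub: "cfun.subspace (even_harmonics a b)" unfolding even_harmonics_def by (rule cfun.subspace_span)
  have sub': "cfun.subspace {f. (\<lambda>x. f x * g x) \<in> even_harmonics a b}" for g
  proof (rule cfun.subspaceI; clarsimp)
    show "(\<lambda>x. 0) \<in> even_harmonics a b" using cfun.subspace_0[OF sub] by (simp add: zero_fun_def)
    fix f f' assume f: "(\<lambda>x. f x * g x) \<in> even_harmonics a b" and f': "(\<lambda>x. f' x * g x) \<in> even_harmonics a b"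
    show "(\<lambda>x. (f x + f' x) * g x) \<in> even_harmonics a b"
      using cfun.subspace_add[OF sub f f'] by (simp add: plus_fun_def distrib_right)
  next
    fix f c assume f: "(\<lambda>x. f x * g x) \<in> even_harmonics a b"
    show "(\<lambda>x. c * f x * g x) \<in> even_harmonics a b"
      using cfun.subspace_scale[OF sub f, of c] by (simp add: cfun_scale_def mult_ac)
  qed
  have "(\<lambda>x. harmonic a b (2 * l) x * g x) \<in> even_harmonics a b" for l
  proof -
    have "(\<lambda>x. g x * harmonic a b (2 * l) x) \<in> even_harmonics a b"
    proof (rule cfun.span_induct[OF g[unfolded even_harmonics_def] sub'])
      fix f assume "f \<in> range (\<lambda>l. harmonic a b (2 * l))"
      then obtain l' where "f = harmonic a b (2 * l')" by blast
      then have "(\<lambda>x. f x * harmonic a b (2 * l) x) = harmonic a b (2 * (l' + l))"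
        by (simp add: harmonic_mult distrib_left)
      then show "(\<lambda>x. f x * harmonic a b (2 * l) x) \<in> even_harmonics a b"
        unfolding even_harmonics_def by (simp only:) (rule cfun.span_base, rule rangeI)
    qed
    then show ?thesis by (simp add: mult.commute)
  qed
  then show ?thesis
    by (intro cfun.span_induct[OF f[unfolded even_harmonics_def] sub']) auto
qed

section \<open>Transport to the unit circle\<close>

text \<open>The point \<open>a\<close> is sent to 1, so that \<open>Arg2pi\<close>, with values from
  0 up to but excluding \<open>2 * pi\<close>, recovers every point of the interval except
  \<open>b\<close>.\<close>

definition circle_param :: "real \<Rightarrow> real \<Rightarrow> real \<Rightarrow> complex" where
  "circle_param a b x = cis (2 * pi * (x - a) / (b - a))"

text \<open>Polynomial functions on the plane are polynomials in the real and imaginary parts. On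
  the circle these are combinations of the point and its conjugate, that is, of the harmonics of
  index 2 and -2, up to the constant phase \<open>\<kappa>\<close> due to starting at
  \<open>a\<close>.\<close>

lemma polynomial_circle_param:
  assumes ab: "a < b" and P: "polynomial_function (P :: complex \<Rightarrow> complex)"
  shows "(\<lambda>x. P (circle_param a b x)) \<in> even_harmonics a b"
proof -
  have sub: "cfun.subspace (even_harmonics a b)" unfolding even_harmonics_def by (rule cfun.subspace_span)
  have addI: "(\<lambda>x. f x + g x) \<in> even_harmonics a b" if "f \<in> even_harmonics a b" "g \<in> even_harmonics a b" for f g
    using cfun.subspace_add[OF sub that] by (simp add: plus_fun_def)
  have scaleI: "(\<lambda>x. c * f x) \<in> even_harmonics a b" if "f \<in> even_harmonics a b" for f c
    using cfun.subspace_scale[OF sub that] by (simp add: cfun_scale_def)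
  have har: "harmonic a b (2 * l) \<in> even_harmonics a b" for l
    unfolding even_harmonics_def by (rule cfun.span_base) simp
  have constI: "(\<lambda>x. c) \<in> even_harmonics a b" for c
    using scaleI[OF har[of 0], of c] by (simp add: harmonic_def)
  define \<kappa> where "\<kappa> = cis (- 2 * pi * a / (b - a))"
  have u: "circle_param a b x = \<kappa> * harmonic a b (2 * 1) x"
    "cnj (circle_param a b x) = cnj \<kappa> * harmonic a b (2 * (-1)) x" for x
    by (simp_all add: circle_param_def \<kappa>_def harmonic_def cis_mult cis_cnj algebra_simps diff_divide_distrib)
  have uin: "(\<lambda>x. circle_param a b x) \<in> even_harmonics a b"
    unfolding u(1) by (intro scaleI har)
  have uin': "(\<lambda>x. cnj (circle_param a b x)) \<in> even_harmonics a b"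
    unfolding u(2) by (intro scaleI har)
  have Re: "(\<lambda>x. of_real (Re (circle_param a b x))) \<in> even_harmonics a b"
    using scaleI[OF addI[OF uin uin'], of "1 / 2"] by (simp add: complex_add_cnj)
  have Im: "(\<lambda>x. of_real (Im (circle_param a b x))) \<in> even_harmonics a b"
  proof -
    have "(\<lambda>x. - \<i> / 2 * (circle_param a b x + (-1) * cnj (circle_param a b x))) \<in> even_harmonics a b"
      by (intro scaleI addI uin uin')
    moreover have "- \<i> / 2 * (z + (-1) * cnj z) = of_real (Im z)" for z by (simp add: complex_eq_iff)
    ultimately show ?thesis by (simp only:)
  qed
  have real: "(\<lambda>x. of_real (p (circle_param a b x))) \<in> even_harmonics a b"
    if "real_polynomial_function p" for p :: "complex \<Rightarrow> real"
    using that
  proof (induction rule: real_polynomial_function.induct)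
    case (linear f)
    then interpret bounded_linear f .
    have f: "complex_of_real (f z) = of_real (f 1) * of_real (Re z) + of_real (f \<i>) * of_real (Im z)" for z
    proof -
      have "f z = f (Re z *\<^sub>R 1 + Im z *\<^sub>R \<i>)" by (rule arg_cong[where f = f]) (simp add: complex_eq_iff)
      also have "\<dots> = Re z * f 1 + Im z * f \<i>" by (simp add: add scaleR)
      finally show ?thesis by (simp add: mult.commute)
    qed
    have "(\<lambda>x. complex_of_real (f (circle_param a b x))) =
        (\<lambda>x. of_real (f 1) * of_real (Re (circle_param a b x)) + of_real (f \<i>) * of_real (Im (circle_param a b x)))"
      by (rule ext) (rule f)
    also have "\<dots> \<in> even_harmonics a b" by (intro addI scaleI Re Im)
    finally show ?case .
  next
    case (const c)
    show ?case by (rule constI)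
  next
    case (add p q)
    then show ?case using addI by simp
  next
    case (mult p q)
    then show ?case using even_harmonics_mult by simp
  qed
  have "real_polynomial_function (\<lambda>z. Re (P z))" "real_polynomial_function (\<lambda>z. Im (P z))"
    using P unfolding polynomial_function_iff_Basis_inner by (auto simp: Basis_complex_def)
  then have "(\<lambda>x. of_real (Re (P (circle_param a b x))) + \<i> * of_real (Im (P (circle_param a b x)))) \<in> even_harmonics a b"
    by (intro addI scaleI real[of "\<lambda>z. Re (P z)"] real[of "\<lambda>z. Im (P z)"])
  then show ?thesis by (simp flip: complex_eq)
qed

text \<open>
  Multiplication by \<open>harmonic a b (- 1)\<close> makes \<open>u\<close> periodic, so that it factors through the circle as
  \<open>G \<circ> e\<close>. Continuity of \<open>G\<close> holds because the preimage of a closed set under \<open>G\<close> is the image under \<open>e\<close>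
  of a compact set.
\<close>

lemma trig_sums_uniformly_dense:
  assumes ab: "a < b" and u: "continuous_on {a..b} u" "u a = 0" "u b = 0" and "0 < \<epsilon>"
  obtains t where "t \<in> trig_sums a b" "\<And>x. x \<in> {a..b} \<Longrightarrow> cmod (u x - t x) < \<epsilon>"
proof -
  define v where "v x = u x * harmonic a b (-1) x" for x
  define e where "e = circle_param a b"
  define \<rho> where "\<rho> z = a + (b - a) * Arg2pi z / (2 * pi)" for z
  define G where "G z = v (\<rho> z)" for z
  have v: "continuous_on {a..b} v" "v a = v b"
    using u ab unfolding v_def harmonic_def cis_conv_exp by (auto intro!: continuous_intros)
  have econt: "continuous_on {a..b} e"
    unfolding e_def circle_param_def cis_conv_exp using ab by (intro continuous_intros) auto
  have Ge: "G (e x) = v x" if x: "x \<in> {a..b}" for x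
  proof (cases "x = b")
    case True
    \<comment> \<open>Here \<open>\<rho>\<close> returns \<open>a\<close> instead of
      \<open>b\<close>. The equality \<open>v a = v b\<close>, a consequence of the zero end values
      of \<open>u\<close>, closes this gap.\<close>
    then have "e x = 1" using ab by (simp add: e_def circle_param_def)
    moreover have "Arg2pi 1 = 0" by (rule Arg2pi_unique[of 1]) auto
    ultimately have "\<rho> (e x) = a" by (simp add: \<rho>_def)
    then show ?thesis using v(2) True by (simp add: G_def)
  next
    case False
    have "Arg2pi (e x) = 2 * pi * (x - a) / (b - a)"
      unfolding e_def circle_param_def cis_conv_exp
      using x False ab by (intro Arg2pi_unique[of 1]) (auto simp: field_simps)
    then have "\<rho> (e x) = x" using ab by (simp add: \<rho>_def)
    then show ?thesis by (simp add: G_def)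
  qed
  have onto: "\<exists>x\<in>{a..b}. z = e x" if z: "z \<in> sphere 0 1" for z
  proof
    have A: "0 \<le> Arg2pi z" "Arg2pi z < 2 * pi" "z = cis (Arg2pi z)"
      using Arg2pi[of z] z by (auto simp: is_Arg_def cis_conv_exp)
    have "(b - a) * Arg2pi z \<le> (b - a) * (2 * pi)" using A(2) ab by (intro mult_left_mono) auto
    then have "(b - a) * Arg2pi z / (2 * pi) \<le> b - a" by (simp add: divide_le_eq)
    then show "\<rho> z \<in> {a..b}" using A(1) ab by (simp add: \<rho>_def)
    have "2 * pi * (\<rho> z - a) / (b - a) = Arg2pi z" using ab by (simp add: \<rho>_def)
    then show "z = e (\<rho> z)" using A(3) by (simp add: e_def circle_param_def)
  qed
  have esphere: "e x \<in> sphere 0 1" for x by (simp add: e_def circle_param_def)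
  have "continuous_on (sphere 0 1) G"
    unfolding continuous_on_closed_vimage[OF closed_sphere]
  proof (intro allI impI)
    fix C :: "complex set" assume "closed C"
    have "G -` C \<inter> sphere 0 1 = e ` ({a..b} \<inter> v -` C)"
      using onto Ge esphere by (fastforce simp: image_iff)
    moreover have "compact (e ` ({a..b} \<inter> v -` C))"
    proof (rule compact_continuous_image)
      have "closed ({a..b} \<inter> v -` C)" using v(1) \<open>closed C\<close> by (intro continuous_closed_preimage) auto
      then show "compact ({a..b} \<inter> v -` C)" by (metis compact_Icc compact_Int_closed Int_left_absorb)
    qed (use econt continuous_on_subset in blast)
    ultimately show "closed (G -` C \<inter> sphere 0 1)" by (simp add: compact_imp_closed)
  qed
  then obtain P where P: "polynomial_function P" "\<And>z. z \<in> sphere 0 1 \<Longrightarrow> cmod (G z - P z) < \<epsilon>"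
    using Stone_Weierstrass_polynomial_function[OF compact_sphere, of 0 1 G \<epsilon>] \<open>0 < \<epsilon>\<close> by blast
  define t where "t x = harmonic a b 1 x * P (e x)" for x
  show thesis
  proof
    show "t \<in> trig_sums a b"
      unfolding t_def e_def by (intro harmonic_times_even_in_trig_sums[OF ab] polynomial_circle_param[OF ab] P)
    fix x assume x: "x \<in> {a..b}"
    have "harmonic a b 1 x * harmonic a b (-1) x = 1" unfolding harmonic_mult by (simp add: harmonic_def)
    then have "u x - t x = harmonic a b 1 x * (v x - P (e x))" by (simp add: v_def t_def algebra_simps)
    then have "cmod (u x - t x) = cmod (G (e x) - P (e x))" by (simp add: norm_mult harmonic_def Ge[OF x])
    then show "cmod (u x - t x) < \<epsilon>" using P(2)[OF esphere] by simp
  qed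
qed

section \<open>Parseval's identity for the eigenfunctions\<close>

lemma trig_basis_L2: "trig_basis a b p \<in> L2_space a b"
  by (auto simp: trig_basis_def z1_eq_trig z2_eq_trig intro!: L2_continuous continuous_on_trig)

lemma trig_basis_orthonormal:
  assumes "a < b" "p \<in> trig_index N" "q \<in> trig_index N"
  shows "L2_inner a b (trig_basis a b p) (trig_basis a b q) = (if p = q then 1 else 0)"
  using assms(2,3)
  by (cases p; cases q) (auto simp: trig_basis_def z1_eq_trig z2_eq_trig trig_index_def L2_inner_trig[OF assms(1)] cos_diff)

lemma L2_approx_trig_sums:
  assumes ab: "a < b" and h: "h \<in> L2_space a b" and "0 < \<epsilon>"
  obtains N c where "L2_norm2 a b (\<lambda>x. h x - (\<Sum>p\<in>trig_index N. c p * trig_basis a b p x)) < \<epsilon>"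
proof -
  obtain u where u: "continuous_on UNIV u" "u a = 0" "u b = 0" "L2_norm2 a b (\<lambda>x. h x - u x) < \<epsilon> / 4"
    using L2_approx_continuous[OF ab h, of "\<epsilon> / 4"] \<open>0 < \<epsilon>\<close> by auto
  \<comment> \<open>A uniform error \<open>\<delta>\<close> costs at most
    \<open>\<delta>\<^sup>2 * (b - a) = \<eta>\<close> in squared norm, and
    \<open>2 * (\<epsilon> / 4 + \<epsilon> / 8)\<close> is less than
    \<open>\<epsilon>\<close>.\<close>
  define \<eta> where "\<eta> = \<epsilon> / 8"
  define \<delta> where "\<delta> = sqrt (\<eta> / (b - a))"
  have "0 < \<eta>" using \<open>0 < \<epsilon>\<close> by (simp add: \<eta>_def)
  then have \<delta>: "0 < \<delta>" "\<delta>\<^sup>2 * (b - a) = \<eta>" using ab by (simp_all add: \<delta>_def)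
  have uc: "continuous_on {a..b} u" using u(1) continuous_on_subset by blast
  obtain t where t: "t \<in> trig_sums a b" "\<And>x. x \<in> {a..b} \<Longrightarrow> cmod (u x - t x) < \<delta>"
    using trig_sums_uniformly_dense[OF ab uc u(2,3) \<delta>(1)] by blast
  obtain N c where tc: "t = (\<lambda>x. \<Sum>p\<in>trig_index N. c p * trig_basis a b p x)" using t(1) by (auto simp: trig_sums_def)
  have uL: "u \<in> L2_space a b" by (rule L2_continuous[OF uc])
  have tL: "t \<in> L2_space a b" unfolding tc by (intro L2_sum L2_scale trig_basis_L2)
  have "L2_norm2 a b (\<lambda>x. u x - t x) \<le> (LINT x|lebesgue_on {a..b}. \<delta>\<^sup>2)"
    unfolding L2_norm2_def
  proof (rule integral_mono)
    interpret finite_measure "lebesgue_on {a..b}" by (rule finite_measure_lebesgue_on_Icc)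
    show "integrable (lebesgue_on {a..b}) (\<lambda>x. \<delta>\<^sup>2)" by simp
    show "integrable (lebesgue_on {a..b}) (\<lambda>x. (cmod (u x - t x))\<^sup>2)"
      using L2_diff[OF uL tL] by (simp add: L2_space_def)
    fix x assume "x \<in> space (lebesgue_on {a..b})"
    then show "(cmod (u x - t x))\<^sup>2 \<le> \<delta>\<^sup>2" using t(2)[of x] by (intro power_mono) auto
  qed
  also have "\<dots> = \<epsilon> / 8" using \<delta>(2) ab unfolding \<eta>_def[symmetric] by (simp add: measure_restrict_space mult.commute)
  finally have "L2_norm2 a b (\<lambda>x. u x - t x) \<le> \<epsilon> / 8" .
  then have "L2_norm2 a b (\<lambda>x. h x - t x) < \<epsilon>"
    using L2_norm2_triangle[OF h uL tL] u(4) \<open>0 < \<epsilon>\<close> by simp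
  then show thesis using that tc by blast
qed

text \<open>A single trigonometric sum with squared error below \<open>\<epsilon>\<close> suffices:
  the coefficients of \<open>h\<close> do at least as well on the same index set, larger index sets
  only increase the sum of squares, and Bessel's inequality bounds it by
  \<open>L2_norm2 a b h\<close>.\<close>

lemma L2_parseval:
  assumes ab: "a < b" and h: "h \<in> L2_space a b"
  shows "(\<lambda>N. \<Sum>p\<in>trig_index N. (cmod (L2_inner a b h (trig_basis a b p)))\<^sup>2) \<longlonglongrightarrow> L2_norm2 a b h"
proof (rule LIMSEQ_I)
  fix \<epsilon> :: real assume "0 < \<epsilon>"
  define \<alpha> where "\<alpha> p = L2_inner a b h (trig_basis a b p)" for p
  note diff = L2_norm2_orthonormal_diff[OF finite_trig_index trig_basis_L2 h trig_basis_orthonormal[OF ab], folded \<alpha>_def]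
  obtain M c where c: "L2_norm2 a b (\<lambda>x. h x - (\<Sum>p\<in>trig_index M. c p * trig_basis a b p x)) < \<epsilon>"
    using L2_approx_trig_sums[OF ab h \<open>0 < \<epsilon>\<close>] by blast
  have low: "L2_norm2 a b h - (\<Sum>p\<in>trig_index M. (cmod (\<alpha> p))\<^sup>2) < \<epsilon>"
    using c sum_nonneg[of "trig_index M" "\<lambda>p. (cmod (c p - \<alpha> p))\<^sup>2"] by (simp add: diff)
  have "norm ((\<Sum>p\<in>trig_index N. (cmod (\<alpha> p))\<^sup>2) - L2_norm2 a b h) < \<epsilon>" if "N \<ge> M" for N
  proof -
    have "(\<Sum>p\<in>trig_index M. (cmod (\<alpha> p))\<^sup>2) \<le> (\<Sum>p\<in>trig_index N. (cmod (\<alpha> p))\<^sup>2)"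
      using that by (intro sum_mono2) (auto simp: trig_index_def)
    moreover have "0 \<le> L2_norm2 a b (\<lambda>x. h x - (\<Sum>p\<in>trig_index N. \<alpha> p * trig_basis a b p x))" by simp
    ultimately show ?thesis using low by (simp add: diff)
  qed
  then show "\<exists>M. \<forall>N\<ge>M. norm ((\<Sum>p\<in>trig_index N. (cmod (L2_inner a b h (trig_basis a b p)))\<^sup>2) - L2_norm2 a b h) < \<epsilon>"
    unfolding \<alpha>_def by blast
qed

section \<open>Fourier expansion in \<open>V\<^sub>n\<close>\<close>

lemma antiperiodic_tower_sum:
  assumes "\<And>i. i \<in> I \<Longrightarrow> antiperiodic_tower a b (F i)"
  shows "antiperiodic_tower a b (\<lambda>j x. \<Sum>i\<in>I. c i * F i j x)"
  unfolding antiperiodic_tower_def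
proof (intro conjI allI ballI)
  fix j x assume "x \<in> {a..b}"
  then show "((\<lambda>x. \<Sum>i\<in>I. c i * F i j x) has_vector_derivative (\<Sum>i\<in>I. c i * F i (Suc j) x)) (at x within {a..b})"
    using assms by (intro has_vector_derivative_sum has_vector_derivative_mult_right) (auto simp: antiperiodic_tower_def)
next
  fix j
  have "F i j a = - F i j b" if "i \<in> I" for i using assms[OF that] by (simp add: antiperiodic_tower_def)
  then show "(\<Sum>i\<in>I. c i * F i j a) = - (\<Sum>i\<in>I. c i * F i j b)" by (simp add: sum_negf[symmetric])
qed

definition sob_basis :: "real \<Rightarrow> real \<Rightarrow> real \<Rightarrow> nat \<Rightarrow> nat \<times> bool \<Rightarrow> real \<Rightarrow> complex" where
  "sob_basis a b k n p = (if snd p then Z2 a b k (fst p) n else Z1 a b k (fst p) n)"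

lemma trig_basis_eq_trig: "trig_basis a b p = trig a b (fst p) (if snd p then - pi / 2 else 0)"
  by (simp add: trig_basis_def z1_eq_trig z2_eq_trig)

lemma sob_basis_eq:
  "sob_basis a b k n p = (\<lambda>x. of_real (eigval a b k (fst p) powr (- real n / 2)) * trig_basis a b p x)"
  by (simp add: fun_eq_iff sob_basis_def trig_basis_def Z1_def Z2_def)

lemma sob_basis_tower:
  assumes "a < b" "fst p \<ge> 1"
  obtains F where "antiperiodic_tower a b F" "F 0 = sob_basis a b k n p"
  using trig_tower[OF assms, of "eigval a b k (fst p) powr (- real n / 2)" "if snd p then - pi / 2 else 0"]
  by (rule that) (simp add: fun_eq_iff sob_basis_eq trig_basis_eq_trig)

lemma eigval_pos: "k > 0 \<Longrightarrow> eigval a b k m > 0"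
  by (simp add: eigval_def add_nonneg_pos)

text \<open>Of the factor \<open>\<mu> ^ n\<close> the normalisation by the power
  \<open>- n / 2\<close> leaves the power \<open>n / 2\<close>. This is (c), with both families in
  one statement.\<close>

lemma sob_inner_sob_basis:
  assumes "a < b" "k > 0" "fst p \<ge> 1" "f \<in> sob_space a b n"
  shows "sob_inner a b k n f (sob_basis a b k n p) =
    of_real (eigval a b k (fst p) powr (real n / 2)) * L2_inner a b f (trig_basis a b p)"
proof -
  define \<mu> where "\<mu> = eigval a b k (fst p)"
  have "\<mu> > 0" using assms(2) by (simp add: \<mu>_def eigval_pos)
  then have "\<mu> powr (- real n / 2) * \<mu> ^ n = \<mu> powr (real n / 2)"
    by (simp add: powr_realpow[symmetric] powr_add[symmetric])
  then show ?thesis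
    using sob_inner_trig[OF assms(1,3,4), of k "\<mu> powr (- real n / 2)"]
    by (simp add: sob_basis_eq trig_basis_eq_trig flip: \<mu>_def)
qed

lemma L2_inner_trig_expand:
  assumes "f \<in> L2_space a b"
  shows "L2_inner a b f (trig a b m \<phi>) =
    of_real (cos \<phi>) * L2_inner a b f (trig_basis a b (m, False)) - of_real (sin \<phi>) * L2_inner a b f (trig_basis a b (m, True))"
proof -
  have "L2_inner a b f (trig a b m \<phi>) = L2_inner a b f
      (\<lambda>x. of_real (cos \<phi>) * trig_basis a b (m, False) x - of_real (sin \<phi>) * trig_basis a b (m, True) x)"
    by (rule L2_inner_cong) (simp_all add: trig_expand trig_basis_def)
  then show ?thesis
    by (simp only: L2_inner_diff_right[OF L2_scale[OF trig_basis_L2] L2_scale[OF trig_basis_L2] assms] L2_inner_scale_right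
        complex_cnj_complex_of_real)
qed

text \<open>A real rotation acts on the real parts and on the imaginary parts separately and
  preserves the sum of squares of each pair.\<close>

lemma cmod_rotation:
  fixes \<alpha> \<beta> :: complex and \<theta> :: real
  shows "(cmod (of_real (cos \<theta>) * \<alpha> - of_real (sin \<theta>) * \<beta>))\<^sup>2 + (cmod (of_real (sin \<theta>) * \<alpha> + of_real (cos \<theta>) * \<beta>))\<^sup>2
    = (cmod \<alpha>)\<^sup>2 + (cmod \<beta>)\<^sup>2"
proof -
  have r: "(c * x - s * y)\<^sup>2 + (s * x + c * y)\<^sup>2 = (c\<^sup>2 + s\<^sup>2) * (x\<^sup>2 + y\<^sup>2)" for c s x y :: real
    by (simp add: power2_eq_square algebra_simps)
  show ?thesis
    using r[of "cos \<theta>" "Re \<alpha>" "sin \<theta>" "Re \<beta>"] r[of "cos \<theta>" "Im \<alpha>" "sin \<theta>" "Im \<beta>"]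
    by (simp add: cmod_power2)
qed

text \<open>Integration by parts turns \<open>j\<close> derivatives into a rotation of the pair of
  coefficients by the angle \<open>j * (pi / 2)\<close>, together with the factor
  \<open>(- freq a b m) ^ j\<close>. The sum of squares is what a rotation leaves alone.\<close>

lemma deriv_coefficients:
  assumes "a < b" "m \<ge> 1" "f \<in> sob_space a b n" "j \<le> n"
  shows "(cmod (L2_inner a b (deriv_n a b j f) (trig_basis a b (m, False))))\<^sup>2 +
      (cmod (L2_inner a b (deriv_n a b j f) (trig_basis a b (m, True))))\<^sup>2 =
    (freq a b m)\<^sup>2 ^ j * ((cmod (L2_inner a b f (trig_basis a b (m, False))))\<^sup>2 +
      (cmod (L2_inner a b f (trig_basis a b (m, True))))\<^sup>2)"
proof -
  define \<theta> where "\<theta> = j * (pi / 2)"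
  define \<alpha> where "\<alpha> = L2_inner a b f (trig_basis a b (m, False))"
  define \<beta> where "\<beta> = L2_inner a b f (trig_basis a b (m, True))"
  have f: "f \<in> L2_space a b" using sob_deriv_L2[OF assms(3), of 0] by simp
  have sq: "(cmod ((-1) ^ j * of_real (freq a b m ^ j) * z))\<^sup>2 = (freq a b m)\<^sup>2 ^ j * (cmod z)\<^sup>2" for z
    by (simp add: norm_mult norm_power power_mult_distrib power_even_abs flip: power_mult) (simp add: mult.commute)
  have c: "L2_inner a b f (trig a b m (0 + \<theta>)) = of_real (cos \<theta>) * \<alpha> - of_real (sin \<theta>) * \<beta>"
    "L2_inner a b f (trig a b m (- pi / 2 + \<theta>)) = of_real (sin \<theta>) * \<alpha> + of_real (cos \<theta>) * \<beta>"
    unfolding L2_inner_trig_expand[OF f] by (simp_all add: \<alpha>_def \<beta>_def cos_diff sin_diff)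
  show ?thesis
    unfolding trig_basis_eq_trig fst_conv snd_conv if_True if_False
      L2_inner_deriv_trig[OF assms] \<theta>_def[symmetric] c sq distrib_left[symmetric] cmod_rotation
    by (simp add: \<alpha>_def \<beta>_def trig_basis_eq_trig)
qed

lemma sob_inner_self:
  "sob_inner a b k n f f = of_real (\<Sum>j=0..n. of_nat (n choose j) * k ^ (n - j) * L2_norm2 a b (deriv_n a b j f))"
  by (simp add: sob_inner_def L2_norm2_eq_inner)

lemma sob_norm_power2:
  assumes "k > 0"
  shows "(sob_norm a b k n f)\<^sup>2 = (\<Sum>j=0..n. of_nat (n choose j) * k ^ (n - j) * L2_norm2 a b (deriv_n a b j f))"
    and "0 \<le> sob_norm a b k n f"
proof -
  have "0 \<le> (\<Sum>j=0..n. of_nat (n choose j) * k ^ (n - j) * L2_norm2 a b (deriv_n a b j f))"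
    using assms by (intro sum_nonneg mult_nonneg_nonneg) auto
  then show "(sob_norm a b k n f)\<^sup>2 = (\<Sum>j=0..n. of_nat (n choose j) * k ^ (n - j) * L2_norm2 a b (deriv_n a b j f))"
    "0 \<le> sob_norm a b k n f"
    by (simp_all add: sob_norm_def inner_norm_def sob_inner_self del: of_real_sum of_real_mult of_real_power)
qed

text \<open>At each frequency the binomial theorem splits \<open>\<mu> ^ n\<close> into the weights
  of the derivatives, so every partial sum is a combination of \<open>n + 1\<close> Parseval sums,
  one for each order \<open>j\<close>. Only finite sums are exchanged before the limit is
  taken.\<close>

lemma sob_parseval:
  assumes "a < b" "k > 0" "f \<in> sob_space a b n"
  shows "(\<lambda>N. \<Sum>p\<in>trig_index N. (cmod (sob_inner a b k n f (sob_basis a b k n p)))\<^sup>2) \<longlonglongrightarrow> (sob_norm a b k n f)\<^sup>2"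
proof -
  define q where "q m = (cmod (L2_inner a b f (trig_basis a b (m, False))))\<^sup>2 +
      (cmod (L2_inner a b f (trig_basis a b (m, True))))\<^sup>2" for m
  have lim: "(\<lambda>N. \<Sum>m=1..N. (freq a b m)\<^sup>2 ^ j * q m) \<longlonglongrightarrow> L2_norm2 a b (deriv_n a b j f)" if "j \<le> n" for j
  proof -
    have "(\<Sum>p\<in>trig_index N. (cmod (L2_inner a b (deriv_n a b j f) (trig_basis a b p)))\<^sup>2) = (\<Sum>m=1..N. (freq a b m)\<^sup>2 ^ j * q m)" for N
      unfolding sum_trig_index sum.distrib[symmetric] q_def
      by (intro sum.cong deriv_coefficients[OF assms(1) _ assms(3) that]) auto
    then show ?thesis using L2_parseval[OF assms(1) sob_deriv_L2[OF assms(3) that]] by simp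
  qed
  have "(\<Sum>p\<in>trig_index N. (cmod (sob_inner a b k n f (sob_basis a b k n p)))\<^sup>2) =
      (\<Sum>j=0..n. of_nat (n choose j) * k ^ (n - j) * (\<Sum>m=1..N. (freq a b m)\<^sup>2 ^ j * q m))" for N
  proof -
    have "(cmod (sob_inner a b k n f (sob_basis a b k n (m, False))))\<^sup>2 + (cmod (sob_inner a b k n f (sob_basis a b k n (m, True))))\<^sup>2
        = (\<Sum>j=0..n. of_nat (n choose j) * k ^ (n - j) * ((freq a b m)\<^sup>2 ^ j * q m))" if "m \<in> {1..N}" for m
    proof -
      define \<mu> where "\<mu> = eigval a b k m"
      have "\<mu> > 0" using assms(2) by (simp add: \<mu>_def eigval_pos)
      then have "(\<mu> powr (real n / 2))\<^sup>2 = \<mu> ^ n"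
        by (simp add: power2_eq_square powr_realpow flip: powr_add)
      then have "(cmod (sob_inner a b k n f (sob_basis a b k n (m, False))))\<^sup>2 + (cmod (sob_inner a b k n f (sob_basis a b k n (m, True))))\<^sup>2
          = \<mu> ^ n * q m"
        using that sob_inner_sob_basis[OF assms(1,2) _ assms(3), of "(m, False)"] sob_inner_sob_basis[OF assms(1,2) _ assms(3), of "(m, True)"]
        by (simp add: q_def norm_mult power_mult_distrib distrib_left flip: \<mu>_def)
      also have "\<mu> ^ n = (\<Sum>j=0..n. of_nat (n choose j) * (freq a b m)\<^sup>2 ^ j * k ^ (n - j))"
        by (simp add: \<mu>_def eigval_def binomial_ring atLeast0AtMost)
      also have "\<dots> * q m = (\<Sum>j=0..n. of_nat (n choose j) * k ^ (n - j) * ((freq a b m)\<^sup>2 ^ j * q m))"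
        unfolding sum_distrib_right by (intro sum.cong) (simp_all add: mult_ac)
      finally show ?thesis .
    qed
    then show ?thesis
      unfolding sum_trig_index sum.distrib[symmetric] sum_distrib_left
      by (subst sum.swap) (intro sum.cong refl)
  qed
  moreover have "(\<lambda>N. \<Sum>j=0..n. of_nat (n choose j) * k ^ (n - j) * (\<Sum>m=1..N. (freq a b m)\<^sup>2 ^ j * q m))
      \<longlonglongrightarrow> (\<Sum>j=0..n. of_nat (n choose j) * k ^ (n - j) * L2_norm2 a b (deriv_n a b j f))"
    by (intro tendsto_sum tendsto_mult_left lim) auto
  ultimately show ?thesis by (simp add: sob_norm_power2(1)[OF assms(2)])
qed

lemma sum_trig_index_lessThan: "(\<Sum>p\<in>trig_index N. f p) = (\<Sum>m<N. f (Suc m, False) + f (Suc m, True))"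
  unfolding sum_trig_index sum.distrib[symmetric]
  by (rule sum.reindex_bij_witness[of _ Suc "\<lambda>m. m - 1"]) auto

section \<open>Remainders of the partial sums\<close>

lemma sob_basis_in_sob_space:
  assumes "a < b" "fst p \<ge> 1"
  shows "sob_basis a b k n p \<in> sob_space a b n"
  using sob_basis_tower[OF assms, of k n] tower_in_sob_space[OF assms(1)] by metis

lemma partial_sum_eq:
  "partial_sum a b k N n f = (\<lambda>x. \<Sum>p\<in>trig_index N. sob_inner a b k n f (sob_basis a b k n p) * sob_basis a b k n p x)"
  by (simp add: fun_eq_iff partial_sum_def sum_trig_index coeff_A_def coeff_B_def sob_basis_def)

lemma sob_remainder_in_sob_space:
  assumes "a < b" "f \<in> sob_space a b n"
  shows "f - partial_sum a b k N n f \<in> sob_space a b n" (is "?g \<in> _")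
proof -
  define c where "c p = sob_inner a b k n f (sob_basis a b k n p)" for p
  have "\<exists>F. antiperiodic_tower a b F \<and> F 0 = sob_basis a b k n p" if "p \<in> trig_index N" for p
  proof -
    have "fst p \<ge> 1" using that by (auto simp: trig_index_def)
    then show ?thesis by (rule sob_basis_tower[OF assms(1)]) blast
  qed
  then obtain F where F: "\<And>p. p \<in> trig_index N \<Longrightarrow> antiperiodic_tower a b (F p)"
    "\<And>p. p \<in> trig_index N \<Longrightarrow> F p 0 = sob_basis a b k n p" by metis
  have g: "?g = (\<lambda>x. f x - (\<Sum>p\<in>trig_index N. c p * F p 0 x))"
    using F(2) by (simp add: fun_eq_iff partial_sum_eq c_def)
  show ?thesis
    unfolding g by (rule sob_space_diff_tower[OF assms antiperiodic_tower_sum[OF F(1)]])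
qed

text \<open>As (c) holds for \<open>f\<close> and for the remainder, the computation takes place in
  \<open>L\<^sup>2\<close>. For \<open>fst q \<le> N\<close> orthonormality there subtracts
  \<open>c q * r q\<close>, which the factor \<open>\<mu> powr (real n / 2)\<close> turns into
  exactly \<open>c q\<close>.\<close>

lemma sob_inner_remainder:
  assumes "a < b" "k > 0" "f \<in> sob_space a b n" "fst q \<ge> 1"
  shows "sob_inner a b k n (f - partial_sum a b k N n f) (sob_basis a b k n q) =
    (if fst q \<le> N then 0 else sob_inner a b k n f (sob_basis a b k n q))"
    (is "sob_inner _ _ _ _ ?g _ = _")
proof -
  define c where "c p = sob_inner a b k n f (sob_basis a b k n p)" for p
  define r where "r p = complex_of_real (eigval a b k (fst p) powr (- real n / 2))" for p :: "nat \<times> bool"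
  have f: "f \<in> L2_space a b" using sob_deriv_L2[OF assms(3), of 0] by simp
  have "L2_inner a b ?g (trig_basis a b q) = 
      L2_inner a b (\<lambda>x. f x - (\<Sum>p\<in>trig_index N. (c p * r p) * trig_basis a b p x)) (trig_basis a b q)"
    by (rule L2_inner_cong) (simp_all add: partial_sum_eq c_def r_def sob_basis_eq mult.assoc)
  also have "\<dots> = L2_inner a b f (trig_basis a b q) - (\<Sum>p\<in>trig_index N. c p * r p * L2_inner a b (trig_basis a b p) (trig_basis a b q))"
    by (simp add: L2_inner_diff_left[OF f L2_sum[OF L2_scale[OF trig_basis_L2]] trig_basis_L2]
        L2_inner_sum_left[OF L2_scale[OF trig_basis_L2] trig_basis_L2] L2_inner_scale_left)
  also have "(\<Sum>p\<in>trig_index N. c p * r p * L2_inner a b (trig_basis a b p) (trig_basis a b q)) =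
      (\<Sum>p\<in>trig_index N. if p = q then c p * r p else 0)"
  proof (rule sum.cong[OF refl])
    fix p assume "p \<in> trig_index N"
    then have "p \<in> trig_index (max N (fst q))" "q \<in> trig_index (max N (fst q))"
      using assms(4) by (auto simp: trig_index_def mem_Times_iff)
    then show "c p * r p * L2_inner a b (trig_basis a b p) (trig_basis a b q) = (if p = q then c p * r p else 0)"
      by (simp add: trig_basis_orthonormal[OF assms(1)])
  qed
  also have "\<dots> = (if fst q \<le> N then c q * r q else 0)"
    using assms(4) by (auto simp: trig_index_def mem_Times_iff sum.delta)
  finally have inner: "L2_inner a b ?g (trig_basis a b q) = L2_inner a b f (trig_basis a b q) - (if fst q \<le> N then c q * r q else 0)" .
  define \<mu> where "\<mu> = eigval a b k (fst q)"
  have "\<mu> > 0" using assms(2) by (simp add: \<mu>_def eigval_pos)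
  then have "\<mu> powr (real n / 2) * \<mu> powr (- real n / 2) = 1" by (simp flip: powr_add)
  then have one: "complex_of_real (\<mu> powr (real n / 2)) * r q = 1" unfolding r_def \<mu>_def[symmetric] by (metis of_real_1 of_real_mult)
  have cq: "c q = of_real (\<mu> powr (real n / 2)) * L2_inner a b f (trig_basis a b q)"
    unfolding c_def \<mu>_def by (rule sob_inner_sob_basis[OF assms(1,2,4,3)])
  have "sob_inner a b k n ?g (sob_basis a b k n q) = of_real (\<mu> powr (real n / 2)) * L2_inner a b ?g (trig_basis a b q)"
    unfolding \<mu>_def by (rule sob_inner_sob_basis[OF assms(1,2,4) sob_remainder_in_sob_space[OF assms(1,3)]])
  also have "\<dots> = (if fst q \<le> N then c q - (of_real (\<mu> powr (real n / 2)) * r q) * c q else c q)"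
    unfolding inner by (simp add: cq algebra_simps)
  also have "\<dots> = (if fst q \<le> N then 0 else c q)" unfolding one by simp
  finally show "sob_inner a b k n ?g (sob_basis a b k n q) = (if fst q \<le> N then 0 else sob_inner a b k n f (sob_basis a b k n q))"
    by (simp add: c_def)
qed

text \<open>Pythagoras, read off from Parseval's identity: for \<open>M \<ge> N\<close> the partial
  sums belonging to \<open>f\<close> and to the remainder differ by the constant sum over
  \<open>trig_index N\<close>, and both have known limits.\<close>

lemma sob_norm_remainder:
  assumes "a < b" "k > 0" "f \<in> sob_space a b n"
  shows "(sob_norm a b k n (f - partial_sum a b k N n f))\<^sup>2 =
    (sob_norm a b k n f)\<^sup>2 - (\<Sum>p\<in>trig_index N. (cmod (sob_inner a b k n f (sob_basis a b k n p)))\<^sup>2)"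
proof (rule LIMSEQ_unique)
  let ?g = "f - partial_sum a b k N n f"
  let ?s = "\<lambda>M. \<Sum>p\<in>trig_index M. (cmod (sob_inner a b k n f (sob_basis a b k n p)))\<^sup>2"
  have "?g \<in> sob_space a b n" by (rule sob_remainder_in_sob_space[OF assms(1,3)])
  then show "(\<lambda>M. \<Sum>p\<in>trig_index M. (cmod (sob_inner a b k n ?g (sob_basis a b k n p)))\<^sup>2) \<longlonglongrightarrow> (sob_norm a b k n ?g)\<^sup>2"
    by (rule sob_parseval[OF assms(1,2)])
  have "(\<lambda>M. ?s M - ?s N) \<longlonglongrightarrow> (sob_norm a b k n f)\<^sup>2 - ?s N"
    by (intro tendsto_diff sob_parseval[OF assms] tendsto_const)
  moreover have "\<forall>\<^sub>F M in sequentially. ?s M - ?s N = (\<Sum>p\<in>trig_index M. (cmod (sob_inner a b k n ?g (sob_basis a b k n p)))\<^sup>2)"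
    using eventually_ge_at_top[of N]
  proof eventually_elim
    case (elim M)
    then have sub: "trig_index N \<subseteq> trig_index M" by (auto simp: trig_index_def)
    have "?s M - ?s N = (\<Sum>p\<in>trig_index M - trig_index N. (cmod (sob_inner a b k n f (sob_basis a b k n p)))\<^sup>2)"
      by (simp add: sum_diff[OF finite_trig_index sub])
    also have "\<dots> = (\<Sum>p\<in>trig_index M. (cmod (sob_inner a b k n ?g (sob_basis a b k n p)))\<^sup>2)"
    proof (rule sum.mono_neutral_cong_left)
      show "\<forall>p\<in>trig_index M - (trig_index M - trig_index N). (cmod (sob_inner a b k n ?g (sob_basis a b k n p)))\<^sup>2 = 0"
        by (auto simp: trig_index_def sob_inner_remainder[OF assms])
      show "(cmod (sob_inner a b k n f (sob_basis a b k n p)))\<^sup>2 = (cmod (sob_inner a b k n ?g (sob_basis a b k n p)))\<^sup>2"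
        if "p \<in> trig_index M - trig_index N" for p
      proof -
        have "fst p \<ge> 1" "\<not> fst p \<le> N" using that by (auto simp: trig_index_def mem_Times_iff)
        then show ?thesis by (simp add: sob_inner_remainder[OF assms])
      qed
    qed auto
    finally show ?case .
  qed
  ultimately show "(\<lambda>M. \<Sum>p\<in>trig_index M. (cmod (sob_inner a b k n ?g (sob_basis a b k n p)))\<^sup>2) \<longlonglongrightarrow> (sob_norm a b k n f)\<^sup>2 - ?s N"
    by (rule Lim_transform_eventually)
qed

lemma sob_norm_remainder_tendsto:
  assumes "a < b" "k > 0" "f \<in> sob_space a b n"
  shows "(\<lambda>N. sob_norm a b k n (f - partial_sum a b k N n f)) \<longlonglongrightarrow> 0"
proof -
  have "(\<lambda>N. (sob_norm a b k n f)\<^sup>2 - (\<Sum>p\<in>trig_index N. (cmod (sob_inner a b k n f (sob_basis a b k n p)))\<^sup>2))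
      \<longlonglongrightarrow> (sob_norm a b k n f)\<^sup>2 - (sob_norm a b k n f)\<^sup>2"
    by (intro tendsto_diff sob_parseval[OF assms] tendsto_const)
  then have "(\<lambda>N. (sob_norm a b k n (f - partial_sum a b k N n f))\<^sup>2) \<longlonglongrightarrow> 0"
    by (simp add: sob_norm_remainder[OF assms])
  from tendsto_real_sqrt[OF this] show ?thesis by (simp add: sob_norm_power2(2)[OF assms(2)])
qed

lemma E_set_eq: "E_set a b k n = sob_basis a b k n ` {p. fst p \<ge> 1}"
proof -
  have "{p :: nat \<times> bool. fst p \<ge> 1} = (\<lambda>m. (m, False)) ` {1..} \<union> (\<lambda>m. (m, True)) ` {1..}"
    by (auto simp: image_iff)
  then show ?thesis by (simp only: image_Un image_image) (auto simp: E_set_def sob_basis_def)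
qed

lemma E_set_complete_orthonormal:
  assumes "a < b" "k > 0"
  shows "complete_orthonormal_set (sob_space a b n) (sob_inner a b k n) (E_set a b k n)"
  unfolding complete_orthonormal_set_def
proof (intro conjI ballI allI impI)
  show "E_set a b k n \<subseteq> sob_space a b n"
    unfolding E_set_eq using sob_basis_in_sob_space[OF assms(1)] by auto
  have orth: "sob_inner a b k n (sob_basis a b k n p) (sob_basis a b k n q) = (if p = q then 1 else 0)"
    if pq: "fst p \<ge> 1" "fst q \<ge> 1" for p q
  proof -
    have "p \<in> trig_index (max (fst p) (fst q))" "q \<in> trig_index (max (fst p) (fst q))"
      using pq by (auto simp: trig_index_def mem_Times_iff)
    then have "L2_inner a b (trig_basis a b p) (trig_basis a b q) = (if p = q then 1 else 0)"
      by (rule trig_basis_orthonormal[OF assms(1)])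
    then have "sob_inner a b k n (sob_basis a b k n p) (sob_basis a b k n q) =
        of_real (eigval a b k (fst q) powr (real n / 2) * eigval a b k (fst p) powr (- real n / 2)) * (if p = q then 1 else 0)"
      unfolding sob_inner_sob_basis[OF assms pq(2) sob_basis_in_sob_space[OF assms(1) pq(1)]]
      unfolding sob_basis_eq L2_inner_scale_left by simp
    moreover have "eigval a b k (fst q) powr (real n / 2) * eigval a b k (fst q) powr (- real n / 2) = 1"
      using eigval_pos[OF assms(2), of a b "fst q"] by (simp flip: powr_add)
    ultimately show ?thesis by (cases "p = q") (simp_all only: of_real_1 mult_1 mult_zero_right if_True if_False simp_thms)
  qed
  show "sob_inner a b k n e e' = (if e = e' then 1 else 0)" if "e \<in> E_set a b k n" "e' \<in> E_set a b k n" for e e'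
  proof -
    obtain p q where pq: "fst p \<ge> 1" "fst q \<ge> 1" "e = sob_basis a b k n p" "e' = sob_basis a b k n q"
      using \<open>e \<in> _\<close> \<open>e' \<in> _\<close> unfolding E_set_eq by blast
    \<comment> \<open>\<open>E_set\<close> is a set of functions, so equal functions must have equal
      indices: two indices for one function would make its inner product with itself both 1 and
      0.\<close>
    have "p = q" if "e = e'"
      using orth[OF pq(1,2)] orth[OF pq(2,2)] that pq(3,4) by (metis one_neq_zero)
    then show ?thesis using orth[OF pq(1,2)] pq(3,4) by auto
  qed
  fix f and \<epsilon> :: real assume f: "f \<in> sob_space a b n" and "0 < \<epsilon>"
  obtain N where N: "sob_norm a b k n (f - partial_sum a b k N n f) < \<epsilon>"
    using order_tendstoD(2)[OF sob_norm_remainder_tendsto[OF assms f] \<open>0 < \<epsilon>\<close>] by (auto dest: eventually_happens)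
  have "(\<lambda>x. \<Sum>p\<in>I. c p * sob_basis a b k n p x) \<in> cfun.span (E_set a b k n)"
    if "finite I" "I \<subseteq> {p. fst p \<ge> 1}" for I c
    using that
  proof (induction I)
    case empty
    have "(\<lambda>x. \<Sum>p\<in>{}. c p * sob_basis a b k n p x) = 0" by (simp add: fun_eq_iff)
    then show ?case using cfun.span_zero[of "E_set a b k n"] by (simp only:)
  next
    case (insert p I)
    have "sob_basis a b k n p \<in> E_set a b k n" using insert.prems by (auto simp: E_set_eq)
    moreover have "(\<lambda>x. \<Sum>p\<in>I. c p * sob_basis a b k n p x) \<in> cfun.span (E_set a b k n)"
      by (rule insert.IH) (use insert.prems in blast)
    ultimately have "cfun_scale (c p) (sob_basis a b k n p) + (\<lambda>x. \<Sum>p\<in>I. c p * sob_basis a b k n p x) \<in> cfun.span (E_set a b k n)"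
      by (rule cfun.span_add[OF cfun.span_scale[OF cfun.span_base]])
    moreover have "(\<lambda>x. \<Sum>p\<in>insert p I. c p * sob_basis a b k n p x) =
        cfun_scale (c p) (sob_basis a b k n p) + (\<lambda>x. \<Sum>p\<in>I. c p * sob_basis a b k n p x)"
      using insert.hyps by (simp add: fun_eq_iff)
    ultimately show ?case by (simp only:)
  qed
  then have "partial_sum a b k N n f \<in> cfun.span (E_set a b k n)"
    unfolding partial_sum_eq by (rule, simp) (auto simp: trig_index_def)
  then show "\<exists>g\<in>cfun.span (E_set a b k n). inner_norm (sob_inner a b k n) (f - g) < \<epsilon>"
    using N unfolding sob_norm_def by blast
qed

theorem theorem4p4:
  fixes a b k :: real and n :: nat
  assumes "a < b" and "k > 0" and "n \<ge> 1"
  shows "complete_orthonormal_set (sob_space a b n) (sob_inner a b k n) (E_set a b k n) \<and>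
    (\<forall>f \<in> sob_space a b n.
       (\<lambda>N. sob_norm a b k n (f - partial_sum a b k N n f)) \<longlonglongrightarrow> 0 \<and>
       (summable (\<lambda>m. (cmod (coeff_A a b k (Suc m) n f))\<^sup>2) \<and>
        summable (\<lambda>m. (cmod (coeff_B a b k (Suc m) n f))\<^sup>2) \<and>
        (sob_norm a b k n f)\<^sup>2 =
          (\<Sum>m. (cmod (coeff_A a b k (Suc m) n f))\<^sup>2) +
          (\<Sum>m. (cmod (coeff_B a b k (Suc m) n f))\<^sup>2)) \<and>
       (\<forall>m\<ge>1.
          coeff_A a b k m n f = of_real (eigval a b k m powr (real n / 2)) * L2_inner a b f (z1 a b m) \<and>
          coeff_B a b k m n f = of_real (eigval a b k m powr (real n / 2)) * L2_inner a b f (z2 a b m)))"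
proof (rule conjI[OF E_set_complete_orthonormal[OF assms(1,2)]], rule ballI)
  fix f assume f: "f \<in> sob_space a b n"
  define A where "A m = (cmod (coeff_A a b k (Suc m) n f))\<^sup>2" for m
  define B where "B m = (cmod (coeff_B a b k (Suc m) n f))\<^sup>2" for m
  have sums: "(\<lambda>m. A m + B m) sums (sob_norm a b k n f)\<^sup>2"
    using sob_parseval[OF assms(1,2) f]
    by (simp add: sums_def sum_trig_index_lessThan A_def B_def coeff_A_def coeff_B_def sob_basis_def)
  \<comment> \<open>All terms are nonnegative, so each of the two series is dominated by the
    combined one, and they may be summed separately.\<close>
  have sA: "summable A" by (rule summable_comparison_test'[OF sums_summable[OF sums]]) (simp add: A_def B_def)
  have sB: "summable B" by (rule summable_comparison_test'[OF sums_summable[OF sums]]) (simp add: A_def B_def)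
  have "(sob_norm a b k n f)\<^sup>2 = suminf A + suminf B"
    using sums_unique[OF sums] suminf_add[OF sA sB] by simp
  moreover have "coeff_A a b k m n f = of_real (eigval a b k m powr (real n / 2)) * L2_inner a b f (z1 a b m) \<and>
      coeff_B a b k m n f = of_real (eigval a b k m powr (real n / 2)) * L2_inner a b f (z2 a b m)" if "m \<ge> 1" for m
    using sob_inner_sob_basis[OF assms(1,2) _ f, of "(m, False)"] sob_inner_sob_basis[OF assms(1,2) _ f, of "(m, True)"] that
    by (simp add: coeff_A_def coeff_B_def sob_basis_def trig_basis_def)
  ultimately show "(\<lambda>N. sob_norm a b k n (f - partial_sum a b k N n f)) \<longlonglongrightarrow> 0 \<and>
       (summable (\<lambda>m. (cmod (coeff_A a b k (Suc m) n f))\<^sup>2) \<and>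
        summable (\<lambda>m. (cmod (coeff_B a b k (Suc m) n f))\<^sup>2) \<and>
        (sob_norm a b k n f)\<^sup>2 =
          (\<Sum>m. (cmod (coeff_A a b k (Suc m) n f))\<^sup>2) +
          (\<Sum>m. (cmod (coeff_B a b k (Suc m) n f))\<^sup>2)) \<and>
       (\<forall>m\<ge>1.
          coeff_A a b k m n f = of_real (eigval a b k m powr (real n / 2)) * L2_inner a b f (z1 a b m) \<and>
          coeff_B a b k m n f = of_real (eigval a b k m powr (real n / 2)) * L2_inner a b f (z2 a b m))"
    using sob_norm_remainder_tendsto[OF assms(1,2) f] sA sB unfolding A_def B_def by blast
qed

end
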